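(* Let $\Gamma$ be the resolution graph of an elliptic normal surface singularity whose link $M=M(\Gamma)$ is a rational homology sphere, and let $m+1$ be the length of its elliptic sequence $\{Z_{B_j}\}_{j=0}^m$ as defined in the context. Then the modified Seiberg--Witten invariant of $M$ associated with the canonical $spin^c$-structure satisfies $$\overline{\mathfrak{sw}}_0(M(\Gamma))=m+1.$$
   Context: **Setting.** Let $(X,o)$ be a complex normal surface singularity with link $M$ a rational homology sphere, and $\widetilde X\to X$ a resolution with exceptional curve $E=\bigcup_{v\in\mathcal V}E_v$. It is good if $E$ is a normal crossing divisor with smooth components. Let $L=\bigoplus_v\mathbb Z E_v$ with its negative definite intersection form $(\,,)$ and $L'=\{l'\in L\otimes\mathbb Q: (l',l)\in\mathbb Z\ \forall l\in L\}$. Rational cycles are ordered coefficientwise; $L_{>0}$ is the set of nonzero effective integral cycles. $|l|$ is the support of $l$; reduced cycles are identified with supports. Put $\mathcal S'=\{l'\in L': (l',E_v)\le 0\ \forall v\}$, $\mathcal S=\mathcal S'\cap L$. $Z_{min}$ is the minimal element of $\mathcal S\setminus\{0\}$; for a reduced cycle $D>0$, $Z_D$ is the minimal (fundamental) cycle of the full subgraph with support $D$. $Z_K\in L'$ is the (anti)canonical cycle, the first Chern class of the dual of $\Omega^2_{\widetilde X}$, i.e. $(Z_K,E_v)=(E_v,E_v)+2-2p_a(E_v)$; $K=-Z_K$. Put $\chi(l')=-(l',l'-Z_K)/2$. The singularity (graph) is elliptic if $\chi(Z_{min})=0$ (equivalently $\min_{l\in L_{>0}}\chi(l)=0$). **Elliptic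 sequence $\{Z_{B_j}\}$.** In the minimal resolution let $s_{[Z_K]}$ be the unique minimal element of $\{l'\in\mathcal S': l'-Z_K\in L\}$ ($=0$ if $Z_K\in L$). Then $N:=Z_K-s_{[Z_K]}\in L_{>0}$. Set $B_0=|N|$ and inductively, if $N\ne\sum_{i\le j}Z_{B_i}$, set $B_{j+1}=|N-\sum_{i\le j}Z_{B_i}|$. All $B_j$ are connected, $B_{j+1}\subsetneq B_j$, and the process stops with $N=\sum_{i=0}^mZ_{B_i}$. The length is $m+1$. **Seiberg--Witten invariant.** Let $\sigma_{can}$ be the canonical $spin^c$-structure of $M$, the restriction to $M$ of the $spin^c$-structure on $\widetilde X$ with first Chern class $-K$. Let $\mathfrak{sw}_{\sigma_{can}}(M)\in\mathbb Q$ be the associated Seiberg--Witten invariant, and $$\overline{\mathfrak{sw}}_0(M)=-\frac{K^2+|\mathcal V|}{8}-\mathfrak{sw}_{\sigma_{can}}(M),$$ where $K^2=(K,K)$ and $|\mathcal V|$ are computed in a good resolution ($K^2+|\mathcal V|$ does not depend on the choice). The sign convention for $\mathfrak{sw}$ is the one of Braun--Némethi and Némethi ("The Seiberg--Witten invariants of negative definite plumbed 3-manifolds"). With this convention the following known formula pins down the invariant: in a good resolution let $E_v^*\in L'$ be given by $(E_v^*,E_w)=-\delta_{vw}$, let $\delta_v$ be the valency of $v$ in the dual graph, and let $\sum_{l'}z(l')\mathbf t^{l'}$ be the Taylor expansion at the origin of $\prod_v(1-\mathbf t^{E_v^*})^{\delta_v-2}$, with $\mathbf t^{l'}=\prod_vt_v^{l'_v}$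 for $l'=\sum_v l'_vE_v$; then for $x\in L$ sufficiently deep in the cone $\mathcal S$, $\sum_{l\in L,\ l\not\ge x}z(l)=\chi(x)+\overline{\mathfrak{sw}}_0(M)$. *)

theory Defs
  imports Complex_Main "HOL-Library.FuncSet" "HOL-Computational_Algebra.Formal_Power_Series"
begin

text \<open>
  The numerical data of a resolution: the set of irreducible exceptional curves, their intersection
  matrix, and their arithmetic genera. Only the values at vertices are meaningful. For a good
  resolution the curves are smooth, so that \<open>pa\<close> is the genus, and they cross normally, so that
  \<open>inter u v\<close> for distinct \<open>u\<close>, \<open>v\<close> is the number of edges joining \<open>u\<close> to \<open>v\<close>
  in the dual graph.
\<close>

record 'v res =
  verts :: "'v set"
  inter :: "'v \<Rightarrow> 'v \<Rightarrow> int"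
  pa    :: "'v \<Rightarrow> nat"

subsection \<open>Cycles\<close>

definition supp :: "('v \<Rightarrow> rat) \<Rightarrow> 'v set" where
  "supp l = {v. l v \<noteq> 0}"

definition rat_cycles :: "'v res \<Rightarrow> ('v \<Rightarrow> rat) set" where
  "rat_cycles G = {l. supp l \<subseteq> verts G}"

definition ip :: "'v res \<Rightarrow> ('v \<Rightarrow> rat) \<Rightarrow> ('v \<Rightarrow> rat) \<Rightarrow> rat" where
  "ip G a b = (\<Sum>u\<in>verts G. \<Sum>w\<in>verts G. a u * b w * of_int (inter G u w))"

definition curve :: "'v \<Rightarrow> 'v \<Rightarrow> rat" where
  "curve v = (\<lambda>w. if w = v then 1 else 0)"

text \<open>The lattice \<open>L\<close> and the dual lattice \<open>L'\<close>.\<close>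

definition lat :: "'v res \<Rightarrow> ('v \<Rightarrow> rat) set" where
  "lat G = {l \<in> rat_cycles G. \<forall>v\<in>verts G. l v \<in> \<int>}"

definition dual_lat :: "'v res \<Rightarrow> ('v \<Rightarrow> rat) set" where
  "dual_lat G = {l' \<in> rat_cycles G. \<forall>l\<in>lat G. ip G l' l \<in> \<int>}"

definition lipman' :: "'v res \<Rightarrow> ('v \<Rightarrow> rat) set" where
  "lipman' G = {l' \<in> dual_lat G. \<forall>v\<in>verts G. ip G l' (curve v) \<le> 0}"

definition lipman :: "'v res \<Rightarrow> ('v \<Rightarrow> rat) set" where
  "lipman G = lipman' G \<inter> lat G"

text \<open>
  Cycles are compared by the pointwise order on functions, so \<open>Least\<close> is the least element for the
  coefficientwise order.
\<close>

definition Z_min :: "'v res \<Rightarrow> 'v \<Rightarrow> rat" where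
  "Z_min G = (LEAST z. z \<in> lipman G - {\<lambda>_. 0})"

definition Z_fund :: "'v res \<Rightarrow> 'v set \<Rightarrow> 'v \<Rightarrow> rat" where
  "Z_fund G D = Z_min (G\<lparr>verts := D\<rparr>)"

definition Z_K :: "'v res \<Rightarrow> 'v \<Rightarrow> rat" where
  "Z_K G = (THE z. z \<in> dual_lat G \<and>
     (\<forall>v\<in>verts G. ip G z (curve v) = ip G (curve v) (curve v) + 2 - 2 * of_nat (pa G v)))"

definition chi :: "'v res \<Rightarrow> ('v \<Rightarrow> rat) \<Rightarrow> rat" where
  "chi G l = - ip G l (\<lambda>v. l v - Z_K G v) / 2"

definition elliptic :: "'v res \<Rightarrow> bool" where
  "elliptic G \<longleftrightarrow> chi G (Z_min G) = 0"

subsection \<open>Good resolution graphs with rational homology sphere link\<close>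

definition negative_definite :: "'v res \<Rightarrow> bool" where
  "negative_definite G \<longleftrightarrow> (\<forall>l\<in>rat_cycles G. l \<noteq> (\<lambda>_. 0) \<longrightarrow> ip G l l < 0)"

definition connected_graph :: "'v res \<Rightarrow> bool" where
  "connected_graph G \<longleftrightarrow> (\<forall>u\<in>verts G. \<forall>v\<in>verts G.
     (u, v) \<in> {(a, b). a \<in> verts G \<and> b \<in> verts G \<and> a \<noteq> b \<and> inter G a b > 0}\<^sup>*)"

text \<open>
  By theorems of Du Val, Mumford and Grauert these are exactly the decorated dual graphs of good
  resolutions of complex normal surface singularities.
\<close>

definition good_resolution_graph :: "'v res \<Rightarrow> bool" where
  "good_resolution_graph G \<longleftrightarrow>
     finite (verts G) \<and> verts G \<noteq> {} \<and>
     (\<forall>u\<in>verts G. \<forall>v\<in>verts G. inter G u v = inter G v u) \<and>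
     (\<forall>u\<in>verts G. \<forall>v\<in>verts G. u \<noteq> v \<longrightarrow> inter G u v \<ge> 0) \<and>
     connected_graph G \<and> negative_definite G"

definition valency :: "'v res \<Rightarrow> 'v \<Rightarrow> int" where
  "valency G v = (\<Sum>w\<in>verts G - {v}. inter G v w)"

text \<open>
  The first Betti number of the plumbed manifold \<open>M\<close> of a connected negative definite graph is twice
  the sum of the genera plus the number of independent cycles (edges minus vertices plus one) of the
  graph. The closed oriented 3-manifold \<open>M\<close> is a rational homology sphere iff this number is zero.
\<close>

definition link_b1 :: "'v res \<Rightarrow> int" where
  "link_b1 G = 2 * (\<Sum>v\<in>verts G. int (pa G v)) +
     ((\<Sum>v\<in>verts G. valency G v) div 2 - int (card (verts G)) + 1)"

definition rational_homology_sphere_link :: "'v res \<Rightarrow> bool" where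
  "rational_homology_sphere_link G \<longleftrightarrow> link_b1 G = 0"

subsection \<open>The minimal resolution\<close>

text \<open>
  An irreducible curve with arithmetic genus 0 is smooth and rational, so these are the curves that
  Castelnuovo's criterion allows to contract.
\<close>

definition minus_one_curve :: "'v res \<Rightarrow> 'v \<Rightarrow> bool" where
  "minus_one_curve G v \<longleftrightarrow> v \<in> verts G \<and> inter G v v = -1 \<and> pa G v = 0"

text \<open>
  Contracting the curve \<open>v\<close>: the pullback of the image of \<open>E\<^sub>u\<close> is \<open>E\<^sub>u + (E\<^sub>u,E\<^sub>v) E\<^sub>v\<close>. The image
  has multiplicity \<open>r = (E\<^sub>u,E\<^sub>v)\<close> at the new point, which raises the arithmetic genus by \<open>r (r - 1) / 2\<close>.
\<close>

definition blow_down :: "'v res \<Rightarrow> 'v \<Rightarrow> 'v res" where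
  "blow_down G v =
     \<lparr>verts = verts G - {v},
      inter = (\<lambda>u w. inter G u w + inter G u v * inter G w v),
      pa = (\<lambda>u. pa G u + (nat (inter G u v) choose 2))\<rparr>"

text \<open>
  \<open>minimal_resolution G H\<close>: \<open>H\<close> is obtained from \<open>G\<close> by successively contracting \<open>(-1)\<close>-curves until
  none is left. The curves of \<open>H\<close> are identified with their strict transforms; \<open>H\<close> need not be good.
\<close>

inductive minimal_resolution :: "'v res \<Rightarrow> 'v res \<Rightarrow> bool" where
  minimal: "(\<nexists>v. minus_one_curve G v) \<Longrightarrow> minimal_resolution G G"
| contract: "minus_one_curve G v \<Longrightarrow> minimal_resolution (blow_down G v) H \<Longrightarrow> minimal_resolution G H"

subsection \<open>The elliptic sequence\<close>

text \<open>To be applied to the data of the minimal resolution.\<close>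

definition s_ZK :: "'v res \<Rightarrow> 'v \<Rightarrow> rat" where
  "s_ZK H = (LEAST s. s \<in> lipman' H \<and> (\<lambda>v. s v - Z_K H v) \<in> lat H)"

definition ell_N :: "'v res \<Rightarrow> 'v \<Rightarrow> rat" where
  "ell_N H = (\<lambda>v. Z_K H v - s_ZK H v)"

fun ell_B :: "'v res \<Rightarrow> nat \<Rightarrow> 'v set" where
  "ell_B H j = supp (\<lambda>v. ell_N H v - (\<Sum>i<j. Z_fund H (ell_B H i) v))"

declare ell_B.simps [simp del]

text \<open>The sequence is \<open>Z_fund H (ell_B H 0), \<dots>, Z_fund H (ell_B H m)\<close>, of length \<open>m + 1\<close>.\<close>

definition ell_seq_stops_at :: "'v res \<Rightarrow> nat \<Rightarrow> bool" where
  "ell_seq_stops_at H m \<longleftrightarrow>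
     ell_N H = (\<lambda>v. \<Sum>i\<le>m. Z_fund H (ell_B H i) v) \<and>
     (\<forall>j<m. ell_N H \<noteq> (\<lambda>v. \<Sum>i\<le>j. Z_fund H (ell_B H i) v))"

subsection \<open>The Seiberg--Witten invariant of the canonical spin-c structure\<close>

definition dual_curve :: "'v res \<Rightarrow> 'v \<Rightarrow> 'v \<Rightarrow> rat" where
  "dual_curve G v = (THE z. z \<in> dual_lat G \<and>
     (\<forall>w\<in>verts G. ip G z (curve w) = (if w = v then -1 else 0)))"

text \<open>
  The coefficient of \<open>t\<^sup>l\<close> in \<open>\<Prod>v. (1 - t\<^bsup>dual_curve v\<^esup>)\<^bsup>valency v - 2\<^esup>\<close>: each factor is a power series
  in \<open>t\<^bsup>dual_curve v\<^esup>\<close>, and \<open>k v\<close> is the exponent chosen in the factor of \<open>v\<close>. Since the dual curves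
  are linearly independent, at most one \<open>k\<close> contributes.
\<close>

definition zcoeff :: "'v res \<Rightarrow> ('v \<Rightarrow> rat) \<Rightarrow> rat" where
  "zcoeff G l =
     (\<Sum>k \<in> {k \<in> verts G \<rightarrow>\<^sub>E UNIV. (\<lambda>w. \<Sum>v\<in>verts G. of_nat (k v) * dual_curve G v w) = l}.
        \<Prod>v\<in>verts G. fps_nth ((1 - fps_X :: rat fps) powi (valency G v - 2)) (k v))"

text \<open>
  The nonvanishing condition makes the index set finite: the coefficients live in the Lipman cone,
  where only finitely many cycles are not above a given one.
\<close>

definition counting_function :: "'v res \<Rightarrow> ('v \<Rightarrow> rat) \<Rightarrow> rat" where
  "counting_function G x = (\<Sum>l \<in> {l \<in> lat G. \<not> x \<le> l \<and> zcoeff G l \<noteq> 0}. zcoeff G l)"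

definition K_cycle :: "'v res \<Rightarrow> 'v \<Rightarrow> rat" where
  "K_cycle G = (\<lambda>v. - Z_K G v)"

definition sw_normalization :: "'v res \<Rightarrow> rat" where
  "sw_normalization G = (ip G (K_cycle G) (K_cycle G) + of_nat (card (verts G))) / 8"

text \<open>
  The Seiberg--Witten invariant of the link for the canonical spin-c structure is the constant that
  makes the counting function of a good resolution graph equal to
  \<open>chi G x - sw_normalization G - sw_can G\<close> for all integral \<open>x\<close> sufficiently deep in the Lipman
  cone, that is, with \<open>(x,E\<^sub>v) \<le> -n\<close> for all \<open>v\<close>, where \<open>n\<close> depends only on \<open>G\<close>.
\<close>

definition sw_can :: "'v res \<Rightarrow> rat" where
  "sw_can G = (THE s. \<exists>n::nat. \<forall>x\<in>lipman G. (\<forall>v\<in>verts G. ip G x (curve v) \<le> - of_nat n) \<longrightarrow>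
     counting_function G x = chi G x + (- sw_normalization G - s))"

definition sw_bar0 :: "'v res \<Rightarrow> rat" where
  "sw_bar0 G = - sw_normalization G - sw_can G"

end

theory Submission
  imports Defs "HOL-Library.Function_Algebras"
begin

text \<open>
  For a tree of rational curves, the coefficient \<open>z(l)\<close> equals minus the alternating sum, over the cubes
  of the lattice based at \<open>l\<close>, of the maximum of \<open>\<chi>\<close> on the cube; this is an induction on leaves.
  Summing over \<open>l \<ge> 0\<close>, \<open>l \<not>\<ge> x\<close> therefore gives \<open>eu [x, Y] - eu [0, Y]\<close> for the weighted Euler
  characteristics of two boxes with a common large corner \<open>Y\<close>. A face of a box can be pushed off
  whenever \<open>\<chi>\<close> is monotone across it. For \<open>x\<close> deep in the Lipman cone this contracts \<open>[x, Y]\<close> to the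
  point \<open>x\<close>, so that the invariant is \<open>- eu [0, Y]\<close>.

  Minimality of \<open>s\<close> allows one to replace \<open>Y\<close> by the sum of the elliptic sequence. Let \<open>v\<close> be a curve
  with multiplicity at least 2 in the minimal elliptic cycle. Starting from a partial sum of the
  sequence, adding \<open>E\<^sub>v\<close> changes \<open>eu\<close> by one, because \<open>\<chi>\<close> is positive on nonzero effective cycles
  without \<open>E\<^sub>v\<close> and on those containing it once; Laufer's algorithm then leads to the next partial sum without
  changing \<open>eu\<close>. The elliptic sequence lives on the minimal resolution, and the properties used here
  are preserved by pulling back along blow-ups.
\<close>

section \<open>Integral cycles\<close>

text \<open>The series lives on a good resolution, the elliptic sequence on the minimal one, whose
  curves may be singular or tangent. What is needed of the sequence is therefore condensed into
  \<open>elliptic_chain\<close>, a notion stable under pulling back. A blow-up changes Z_K, and with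
  it N, to the total transform minus E_v, while the final sum T is just pulled back. So N may
  acquire negative coefficients, and only N \<le> T survives of N = T. The boxes [0, T] and [0, Y]
  are compared through boxes with upper corner N, to which both T and Y descend.

  Each step of the chain counts once because the slab l_v = x_v retracts onto the edge from x to x +
  E_v, along which \<chi> rises from 0 to 1. A point x + l of the slab that could not be lowered
  would satisfy 2 \<chi>(l) \<le> (l, E_v). Positivity of \<chi>(l + E_v) gives (l, E_v) \<le>
  \<chi>(l) by integrality, and positivity of \<chi>(l) excludes both at once. This is the only
  place where the choice of v enters.\<close>

definition cyc :: "'v res \<Rightarrow> ('v \<Rightarrow> int) set" where
  "cyc G = {a. \<forall>v. v \<notin> verts G \<longrightarrow> a v = 0}"

text \<open>Polymorphic in the coefficients: integral cycles carry the combinatorics, rational ones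
  are needed for Z_K and the dual curves.\<close>

definition dot :: "'v res \<Rightarrow> ('v \<Rightarrow> 'a::comm_ring_1) \<Rightarrow> 'v \<Rightarrow> 'a" where
  "dot G a u = (\<Sum>w\<in>verts G. a w * of_int (inter G w u))"

definition ei :: "'v \<Rightarrow> 'v \<Rightarrow> int" where
  "ei v = (\<lambda>w. if w = v then 1 else 0)"

text \<open>\<open>canon G u\<close> is \<open>(Z\<^sub>K, E\<^sub>u)\<close>, and \<open>chi2\<close> is \<open>2 \<chi>\<close>, which stays integral.\<close>

definition canon :: "'v res \<Rightarrow> 'v \<Rightarrow> int" where
  "canon G u = inter G u u + 2 - 2 * int (pa G u)"

definition chi2 :: "'v res \<Rightarrow> ('v \<Rightarrow> int) \<Rightarrow> int" where
  "chi2 G a = (\<Sum>u\<in>verts G. a u * (canon G u - dot G a u))"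

text \<open>Connectedness by cuts instead of paths: the arguments need an edge leaving the support
  of a cycle, and this form passes easily to a contraction.\<close>

definition cut_connected :: "'v res \<Rightarrow> bool" where
  "cut_connected G \<longleftrightarrow> (\<forall>A. A \<subseteq> verts G \<longrightarrow> A \<noteq> {} \<longrightarrow> A \<noteq> verts G \<longrightarrow>
     (\<exists>u\<in>A. \<exists>w\<in>verts G - A. inter G u w > 0))"

lemma dot_add: "dot G (a + b) u = dot G a u + dot G b u"
  by (simp add: dot_def sum.distrib algebra_simps)

lemma dot_diff: "dot G (a - b) u = dot G a u - dot G b u"
  by (simp add: dot_def sum_subtractf algebra_simps)

lemma dot_zero [simp]: "dot G 0 u = 0"
  by (simp add: dot_def)

lemma cyc_add: "a \<in> cyc G \<Longrightarrow> b \<in> cyc G \<Longrightarrow> a + b \<in> cyc G"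
  and cyc_diff: "a \<in> cyc G \<Longrightarrow> b \<in> cyc G \<Longrightarrow> a - b \<in> cyc G"
  and cyc_zero: "0 \<in> cyc G"
  and cyc_ei: "v \<in> verts G \<Longrightarrow> ei v \<in> cyc G"
  by (auto simp: cyc_def ei_def)

lemma ei_nonneg: "0 \<le> ei v"
  by (simp add: ei_def le_fun_def)

lemma ei_nonzero: "ei v \<noteq> 0"
  by (auto simp: fun_eq_iff ei_def)

lemma sum_ei: "finite A \<Longrightarrow> v \<in> A \<Longrightarrow> (\<Sum>u\<in>A. ei v u * f u) = f v"
  by (simp add: ei_def if_distrib[of "\<lambda>x. x * _"] cong: if_cong)

lemma cut_connectedD:
  assumes "cut_connected G" "A \<subseteq> verts G" "A \<noteq> {}" "A \<noteq> verts G"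
  obtains u w where "u \<in> A" "w \<in> verts G" "w \<notin> A" "inter G u w > 0"
  using assms unfolding cut_connected_def by blast

lemma cut_connected_of_connected_graph:
  assumes "connected_graph G"
  shows "cut_connected G"
  unfolding cut_connected_def
proof (intro allI impI)
  fix A assume A: "A \<subseteq> verts G" "A \<noteq> {}" "A \<noteq> verts G"
  then obtain a b where ab: "a \<in> A" "b \<in> verts G" "b \<notin> A" by blast
  let ?R = "{(a, b). a \<in> verts G \<and> b \<in> verts G \<and> a \<noteq> b \<and> inter G a b > 0}"
  have "(a, b) \<in> ?R\<^sup>*" using assms A ab unfolding connected_graph_def by blast
  then have "b \<in> A \<or> (\<exists>u\<in>A. \<exists>w\<in>verts G - A. inter G u w > 0)"
    by (induction rule: rtrancl_induct) (use ab in auto)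
  then show "\<exists>u\<in>A. \<exists>w\<in>verts G - A. inter G u w > 0" using ab by blast
qed

lemma ip_eq_dot:
  assumes "finite (verts G)"
  shows "ip G a b = (\<Sum>u\<in>verts G. b u * dot G a u)"
proof -
  have "ip G a b = (\<Sum>w\<in>verts G. \<Sum>u\<in>verts G. a u * b w * of_int (inter G u w))"
    unfolding ip_def by (rule sum.swap)
  then show ?thesis
    by (simp add: dot_def sum_distrib_left algebra_simps)
qed

lemma ip_curve:
  assumes "finite (verts G)" "v \<in> verts G"
  shows "ip G a (curve v) = dot G a v"
  using assms by (simp add: ip_eq_dot curve_def if_distrib[of "\<lambda>x. x * _"] cong: if_cong)

lemma cyc_eqI_sum:
  assumes "finite (verts G)" "a \<in> cyc G" "b \<in> cyc G" "a \<le> b" "(\<Sum>v\<in>verts G. b v) \<le> (\<Sum>v\<in>verts G. a v)"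
  shows "a = b"
proof (rule ccontr)
  assume "a \<noteq> b"
  then obtain u where u: "a u \<noteq> b u" by (auto simp: fun_eq_iff)
  then have "u \<in> verts G" using assms(2,3) unfolding cyc_def mem_Collect_eq by metis
  then have "(\<Sum>v\<in>verts G. a v) < (\<Sum>v\<in>verts G. b v)"
    using u le_funD[OF assms(4)] assms(1) by (intro sum_strict_mono_ex1) (auto simp: order.strict_iff_order)
  then show False using assms(5) by simp
qed

section \<open>Negative definite intersection forms\<close>

locale plumbing =
  fixes G :: "'v res"
  assumes fin: "finite (verts G)"
    and sym: "\<And>u w. u \<in> verts G \<Longrightarrow> w \<in> verts G \<Longrightarrow> inter G u w = inter G w u"
    and inter_nonneg: "\<And>u w. u \<in> verts G \<Longrightarrow> w \<in> verts G \<Longrightarrow> u \<noteq> w \<Longrightarrow> inter G u w \<ge> 0"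
    and negdef: "negative_definite G"
begin

abbreviation "V \<equiv> verts G"

lemma negdef_rat:
  fixes a :: "'v \<Rightarrow> rat"
  assumes "\<And>v. v \<notin> V \<Longrightarrow> a v = 0" "a \<noteq> 0"
  shows "(\<Sum>u\<in>V. a u * dot G a u) < 0"
proof -
  have "a \<in> rat_cycles G" using assms(1) by (auto simp: rat_cycles_def supp_def)
  moreover have "a \<noteq> (\<lambda>_. 0)" using assms(2) by (simp add: zero_fun_def)
  ultimately have "ip G a a < 0" using negdef unfolding negative_definite_def by blast
  then show ?thesis by (simp add: ip_eq_dot fin)
qed

lemma dot_of_int: "dot G (\<lambda>v. of_int (a v) :: 'a::comm_ring_1) u = of_int (dot G a u)"
  by (simp add: dot_def)

lemma negdef_int:
  assumes "a \<in> cyc G" "a \<noteq> 0"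
  shows "(\<Sum>u\<in>V. a u * dot G a u) < 0"
proof -
  have "(\<Sum>u\<in>V. (of_int (a u) :: rat) * dot G (\<lambda>v. of_int (a v)) u) < 0"
    using assms by (intro negdef_rat) (auto simp: cyc_def fun_eq_iff)
  then have "(of_int (\<Sum>u\<in>V. a u * dot G a u) :: rat) < 0"
    unfolding dot_of_int of_int_sum of_int_mult by simp
  then show ?thesis unfolding of_int_less_0_iff .
qed

lemma pairing_sym: "(\<Sum>u\<in>V. b u * dot G a u) = (\<Sum>u\<in>V. a u * dot G b u)"
proof -
  have "(\<Sum>u\<in>V. b u * dot G a u) = (\<Sum>u\<in>V. \<Sum>w\<in>V. b u * (a w * of_int (inter G w u)))"
    by (simp add: dot_def sum_distrib_left)
  also have "\<dots> = (\<Sum>w\<in>V. \<Sum>u\<in>V. b u * (a w * of_int (inter G w u)))"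
    by (rule sum.swap)
  also have "\<dots> = (\<Sum>w\<in>V. a w * dot G b w)"
    unfolding dot_def sum_distrib_left
    by (intro sum.cong refl) (simp add: sym algebra_simps)
  finally show ?thesis .
qed

lemma inter_self_neg: "v \<in> V \<Longrightarrow> inter G v v < 0"
  using negdef_int[of "ei v"] cyc_ei[of v G] ei_nonzero[of v]
  by (simp add: sum_ei fin dot_def)

lemma dot_ei: "v \<in> V \<Longrightarrow> dot G (ei v) u = inter G v u"
  by (simp add: dot_def sum_ei fin)

lemma chi2_add:
  "chi2 G (a + b) = chi2 G a + chi2 G b - 2 * (\<Sum>u\<in>V. b u * dot G a u)"
  using pairing_sym[of a b] unfolding chi2_def
  by (simp add: dot_add sum.distrib algebra_simps sum_subtractf)

lemma chi2_ei: "v \<in> V \<Longrightarrow> chi2 G (ei v) = 2 - 2 * int (pa G v)"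
  unfolding chi2_def by (simp add: sum_ei fin dot_ei canon_def)

lemma chi2_zero [simp]: "chi2 G 0 = 0"
  by (simp add: chi2_def)

lemma chi2_step:
  "v \<in> V \<Longrightarrow> chi2 G (a + ei v) = chi2 G a + 2 * (1 - int (pa G v) - dot G a v)"
  by (simp add: chi2_add chi2_ei sum_ei fin)

text \<open>Only off-diagonal intersection numbers enter when no curve is common to both
  cycles.\<close>

lemma disj_pairing_nonneg:
  fixes a b :: "'v \<Rightarrow> 'a::linordered_idom"
  assumes "0 \<le> a" "0 \<le> b" "\<And>u. u \<in> V \<Longrightarrow> a u = 0 \<or> b u = 0"
  shows "0 \<le> (\<Sum>u\<in>V. b u * dot G a u)"
proof (intro sum_nonneg)
  fix u assume u: "u \<in> V"
  show "0 \<le> b u * dot G a u"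
  proof (cases "b u = 0")
    case False
    then have au: "a u = 0" using assms(3)[OF u] by simp
    have "0 \<le> dot G a u" unfolding dot_def
    proof (intro sum_nonneg)
      fix w assume w: "w \<in> V"
      show "0 \<le> a w * of_int (inter G w u)"
      proof (cases "w = u")
        case False
        then show ?thesis using assms(1) inter_nonneg[OF w u] by (simp add: le_fun_def)
      qed (simp add: au)
    qed
    then show ?thesis using assms(2) by (simp add: le_fun_def)
  qed simp
qed

text \<open>The self-intersection, the only negative entry of the column, cancels because the
  coefficients at \<open>u\<close> agree.\<close>

lemma dot_mono:
  fixes a b :: "'v \<Rightarrow> 'a::linordered_idom"
  assumes "a \<le> b" "a u = b u" "u \<in> V"
  shows "dot G a u \<le> dot G b u"
  unfolding dot_def
proof (intro sum_mono)
  fix w assume w: "w \<in> V"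
  show "a w * of_int (inter G w u) \<le> b w * of_int (inter G w u)"
    using assms w inter_nonneg[OF w assms(3)] by (cases "w = u") (auto simp: le_fun_def mult_right_mono)
qed

text \<open>Pair \<open>a\<close> with its negative part \<open>b\<close>. The positive part
  contributes nonnegatively and (b, b) < 0, so (a, b) > 0 unless \<open>b\<close> vanishes; but the
  hypothesis, imposed just on the curves of \<open>b\<close>, makes every term nonpositive.\<close>

lemma antinef_nonneg_rat:
  fixes a :: "'v \<Rightarrow> rat"
  assumes "\<And>v. v \<notin> V \<Longrightarrow> a v = 0" "\<And>v. v \<in> V \<Longrightarrow> a v < 0 \<Longrightarrow> dot G a v \<le> 0"
  shows "0 \<le> a"
proof (rule ccontr)
  assume neg: "\<not> 0 \<le> a"
  define b where "b = (\<lambda>v. max 0 (- a v))"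
  define c where "c = (\<lambda>v. max 0 (a v))"
  have a: "a = c - b" by (auto simp: b_def c_def fun_eq_iff max_def)
  obtain v where "a v < 0" using neg by (auto simp: le_fun_def not_le)
  then have "b v \<noteq> 0" by (simp add: b_def)
  then have "b \<noteq> 0" by auto
  then have bb: "(\<Sum>u\<in>V. b u * dot G b u) < 0"
    using assms(1) by (intro negdef_rat) (auto simp: b_def)
  have "0 \<le> (\<Sum>u\<in>V. b u * dot G c u)"
    by (intro disj_pairing_nonneg) (auto simp: b_def c_def le_fun_def max_def)
  with bb have "0 < (\<Sum>u\<in>V. b u * dot G a u)"
    by (simp add: a dot_diff right_diff_distrib sum_subtractf)
  moreover have "(\<Sum>u\<in>V. b u * dot G a u) \<le> 0"
  proof (intro sum_nonpos)
    fix u assume "u \<in> V"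
    then show "b u * dot G a u \<le> 0"
      using assms(2)[of u] by (cases "a u < 0") (auto simp: b_def max_def mult_nonpos_nonpos)
  qed
  ultimately show False by simp
qed

lemma antinef_nonneg:
  assumes "a \<in> cyc G" "\<And>v. v \<in> V \<Longrightarrow> a v < 0 \<Longrightarrow> dot G a v \<le> 0"
  shows "0 \<le> a"
proof -
  have "0 \<le> (\<lambda>v. of_int (a v) :: rat)"
    using assms by (intro antinef_nonneg_rat) (auto simp: cyc_def dot_of_int)
  then show ?thesis by (simp add: le_fun_def)
qed

text \<open>Once the infimum is subtracted, the two cycles have no common curve. The defect in the
  inequality is twice the pairing of these two rests.\<close>

lemma chi2_inf_sup:
  assumes "a \<in> cyc G" "b \<in> cyc G"
  shows "chi2 G (inf a b) + chi2 G (sup a b) \<le> chi2 G a + chi2 G b"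
proof -
  define c where "c = inf a b"
  define a' where "a' = a - c"
  define b' where "b' = b - c"
  have a: "a = c + a'" and b: "b = c + b'" by (simp_all add: a'_def b'_def)
  have s: "sup a b = c + a' + b'"
    by (auto simp: a'_def b'_def c_def fun_eq_iff inf_int_def sup_int_def)
  have "0 \<le> (\<Sum>u\<in>V. b' u * dot G a' u)"
    by (intro disj_pairing_nonneg) (auto simp: a'_def b'_def c_def le_fun_def inf_int_def)
  then show ?thesis
    unfolding s c_def[symmetric] unfolding a b
    by (simp add: chi2_add dot_add distrib_left sum.distrib)
qed

lemma dot_pos:
  fixes a :: "'v \<Rightarrow> int"
  assumes "0 \<le> a" "a w = 0" "u \<in> V" "w \<in> V" "0 < a u" "0 < inter G u w"
  shows "0 < dot G a w"
proof -
  have "0 < a u * inter G u w" using assms by simp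
  also have "\<dots> \<le> dot G a w"
    unfolding dot_def of_int_eq_id id_apply
  proof (rule member_le_sum)
    fix x assume x: "x \<in> V - {u}"
    show "0 \<le> a x * inter G x w"
      using x le_funD[OF assms(1), of x] assms(2,4) inter_nonneg[of x w] by (cases "x = w") auto
  qed (use assms fin in auto)
  finally show ?thesis .
qed

text \<open>An edge leaving the support would produce a positive pairing at its outer end.\<close>

lemma antinef_full_support:
  assumes con: "cut_connected G" and a: "0 \<le> a" "a \<in> cyc G" "a \<noteq> 0"
    and neg: "\<And>v. v \<in> V \<Longrightarrow> dot G a v \<le> 0"
    and v: "v \<in> V"
  shows "1 \<le> a v"
proof (rule ccontr)
  assume "\<not> 1 \<le> a v"
  then have "a v = 0" using a(1) by (simp add: le_fun_def) (metis int_one_le_iff_zero_less linorder_not_le nle_le)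
  define A where "A = {u\<in>V. a u \<noteq> 0}"
  have "A \<subseteq> V" "A \<noteq> {}" "A \<noteq> V"
    using a(2,3) v \<open>a v = 0\<close> by (auto simp: A_def cyc_def fun_eq_iff)
  then obtain u w where uw: "u \<in> A" "w \<in> V" "w \<notin> A" "inter G u w > 0"
    using cut_connectedD[OF con] by metis
  have "0 < a u" using uw(1) le_funD[OF a(1), of u] by (simp add: A_def)
  then have "0 < dot G a w" using uw a(1) by (intro dot_pos[of a w u]) (auto simp: A_def)
  then show False using neg[OF uw(2)] by simp
qed

end

lemma plumbing_of_good: "good_resolution_graph G \<Longrightarrow> plumbing G"
  unfolding good_resolution_graph_def by unfold_locales auto

section \<open>Euler characteristics of boxes of lattice cubes\<close>

definition reduced :: "'v set \<Rightarrow> 'v \<Rightarrow> int" where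
  "reduced I = (\<lambda>v. if v \<in> I then 1 else 0)"

text \<open>A pair \<open>(l, I)\<close> stands for the cube with vertices \<open>l + E\<^sub>J\<close>, \<open>J \<subseteq> I\<close>, of the lattice.\<close>

definition cubes :: "'v set \<Rightarrow> ('v \<Rightarrow> int) \<Rightarrow> ('v \<Rightarrow> int) \<Rightarrow> (('v \<Rightarrow> int) \<times> 'v set) set" where
  "cubes V x y = {(l, I). I \<subseteq> V \<and> x \<le> l \<and> l + reduced I \<le> y}"

text \<open>\<open>F\<close> is an arbitrary function of cubes, because differences of weights
  across a slab are summed in the same way.\<close>

definition eu :: "'v set \<Rightarrow> (('v \<Rightarrow> int) \<Rightarrow> 'v set \<Rightarrow> int) \<Rightarrow> ('v \<Rightarrow> int) \<Rightarrow> ('v \<Rightarrow> int) \<Rightarrow> int" where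
  "eu V F x y = (\<Sum>(l, I)\<in>cubes V x y. (-1) ^ card I * F l I)"

lemma finite_box:
  fixes x y :: "'v \<Rightarrow> int"
  assumes "finite V" "\<And>v. v \<notin> V \<Longrightarrow> x v = y v"
  shows "finite {l. x \<le> l \<and> l \<le> y}"
proof -
  let ?W = "\<Union>v\<in>V. {x v..y v}"
  let ?h = "\<lambda>g v. if v \<in> V then g v else y v"
  have "f \<in> (\<lambda>g v. if v \<in> V then g v else y v) ` (V \<rightarrow>\<^sub>E ?W)" if f: "x \<le> f \<and> f \<le> y" for f
  proof (rule image_eqI)
    have "f v = y v" if "v \<notin> V" for v
      using assms(2)[OF that] f le_funD[of x f v] le_funD[of f y v] by simp
    then show "f = (\<lambda>v. if v \<in> V then restrict f V v else y v)" by auto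
    show "restrict f V \<in> V \<rightarrow>\<^sub>E ?W" using f by (auto simp: le_fun_def)
  qed
  then have "{l. x \<le> l \<and> l \<le> y} \<subseteq> ?h ` (V \<rightarrow>\<^sub>E ?W)" by blast
  moreover have "finite (?h ` (V \<rightarrow>\<^sub>E ?W))" using assms(1) by (intro finite_imageI finite_PiE) auto
  ultimately show ?thesis by (rule finite_subset)
qed

lemma cubesD:
  assumes "(l, I) \<in> cubes V x y"
  shows "I \<subseteq> V" "x \<le> l" "l \<le> y" "l + reduced I \<le> y"
proof -
  show "I \<subseteq> V" "x \<le> l" and le: "l + reduced I \<le> y" using assms by (auto simp: cubes_def)
  show "l \<le> y"
  proof (rule le_funI)
    fix v
    have "l v + reduced I v \<le> y v" using le by (auto simp: le_fun_def)
    then show "l v \<le> y v" by (auto simp: reduced_def split: if_splits)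
  qed
qed

lemma finite_cubes:
  assumes "finite V" "\<And>v. v \<notin> V \<Longrightarrow> x v = y v"
  shows "finite (cubes V x y)"
proof (rule finite_subset)
  show "cubes V x y \<subseteq> {l. x \<le> l \<and> l \<le> y} \<times> Pow V"
    using cubesD[where x = x and y = y and V = V] by auto
  show "finite ({l. x \<le> l \<and> l \<le> y} \<times> Pow V)"
    using assms finite_box by blast
qed

lemma eu_point: "eu V F x x = F x {}"
proof -
  have "cubes V x x = {(x, {})}"
  proof (intro equalityI subsetI)
    fix c assume "c \<in> cubes V x x"
    then obtain l I where c: "c = (l, I)" "(l, I) \<in> cubes V x x" by (cases c) auto
    note d = cubesD[OF c(2)]
    have "l = x" using d by simp
    have "I = {}"
    proof (rule ccontr)
      assume "I \<noteq> {}" then obtain v where "v \<in> I" by blast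
      then show False using le_funD[OF d(4), of v] \<open>l = x\<close> by (simp add: reduced_def)
    qed
    then show "c \<in> {(x, {})}" using c \<open>l = x\<close> by simp
  qed (auto simp: cubes_def le_fun_def reduced_def)
  then show ?thesis by (simp add: eu_def)
qed

text \<open>A cube in the top face in direction \<open>u\<close> cancels against the cube of one
  dimension more that ends on it; the hypothesis says that the two have equal weight. What remains
  is the box without that face.\<close>

lemma eu_top:
  assumes fin: "finite V" and eq: "\<And>v. v \<notin> V \<Longrightarrow> x v = y v" and u: "u \<in> V" "x u < y u"
    and F: "\<And>l I. I \<subseteq> V \<Longrightarrow> x \<le> l \<Longrightarrow> l + reduced I \<le> y \<Longrightarrow> l u = y u \<Longrightarrow> u \<notin> I \<Longrightarrow> F (l - ei u) (insert u I) = F l I"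
  shows "eu V F x y = eu V F x (y - ei u)"
proof -
  let ?C = "cubes V x y" and ?C' = "cubes V x (y - ei u)"
  define D0 where "D0 = {(l, I) \<in> ?C. u \<notin> I \<and> l u = y u}"
  define D1 where "D1 = {(l, I) \<in> ?C. u \<in> I \<and> l u = y u - 1}"
  define t where "t = (\<lambda>(l :: 'a \<Rightarrow> int, I). (-1) ^ card I * F l I)"
  have finC: "finite ?C" using fin eq by (rule finite_cubes)
  have split: "?C = ?C' \<union> (D0 \<union> D1)"
  proof (intro equalityI subsetI)
    fix c assume "c \<in> ?C"
    then obtain l I where c: "c = (l, I)" "(l, I) \<in> ?C" by (cases c) auto
    have "l u + reduced I u \<le> y u" using cubesD(4)[OF c(2)] by (simp add: le_fun_def)
    then consider "l u + reduced I u = y u" | "l u + reduced I u \<le> y u - 1" by linarith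
    then show "c \<in> ?C' \<union> (D0 \<union> D1)"
    proof cases
      case 1
      then have "u \<notin> I \<and> l u = y u \<or> u \<in> I \<and> l u = y u - 1"
        by (cases "u \<in> I") (simp_all add: reduced_def)
      then show ?thesis using c by (auto simp: D0_def D1_def)
    next
      case 2
      then show ?thesis using c cubesD[OF c(2)] by (auto simp: cubes_def le_fun_def ei_def)
    qed
  next
    fix c assume c: "c \<in> ?C' \<union> (D0 \<union> D1)"
    have "y - ei u \<le> y" by (simp add: le_fun_def ei_def)
    then have "?C' \<subseteq> ?C" by (auto simp: cubes_def intro: order_trans)
    then show "c \<in> ?C" using c by (auto simp: D0_def D1_def)
  qed
  have disj: "?C' \<inter> (D0 \<union> D1) = {}" "D0 \<inter> D1 = {}"
  proof -
    have "\<not> (l, I) \<in> D0 \<union> D1" if "(l, I) \<in> ?C'" for l I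
    proof -
      have "l u + reduced I u \<le> y u - 1"
        using le_funD[OF cubesD(4)[OF that], of u] by (simp add: ei_def)
      then show ?thesis by (cases "u \<in> I") (auto simp: D0_def D1_def reduced_def)
    qed
    then show "?C' \<inter> (D0 \<union> D1) = {}" by auto
  qed (auto simp: D0_def D1_def)
  have bij: "bij_betw (\<lambda>(l, I). (l - ei u, insert u I)) D0 D1"
  proof (rule bij_betw_byWitness[where f' = "\<lambda>(l, I). (l + ei u, I - {u})"])
    show "(\<lambda>(l, I). (l - ei u, insert u I)) ` D0 \<subseteq> D1"
    proof clarify
      fix l I assume "(l, I) \<in> D0"
      then have *: "(l, I) \<in> ?C" "u \<notin> I" "l u = y u" by (auto simp: D0_def)
      have "x \<le> l - ei u" using cubesD(2)[OF *(1)] u *(3) by (auto simp: le_fun_def ei_def)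
      moreover have "(l - ei u) + reduced (insert u I) = l + reduced I"
        using *(2) by (auto simp: fun_eq_iff ei_def reduced_def)
      then have "(l - ei u) + reduced (insert u I) \<le> y" using cubesD(4)[OF *(1)] by (simp only:)
      moreover have "(l - ei u) u = y u - 1" using *(3) by (simp add: ei_def)
      ultimately show "(l - ei u, insert u I) \<in> D1"
        using cubesD[OF *(1)] u(1) by (simp add: D1_def cubes_def)
    qed
    show "(\<lambda>(l, I). (l + ei u, I - {u})) ` D1 \<subseteq> D0"
    proof clarify
      fix l I assume "(l, I) \<in> D1"
      then have *: "(l, I) \<in> ?C" "u \<in> I" "l u = y u - 1" by (auto simp: D1_def)
      have "x \<le> l + ei u" using cubesD(2)[OF *(1)] by (auto simp: le_fun_def ei_def add_increasing2)
      moreover have "(l + ei u) + reduced (I - {u}) = l + reduced I"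
        using *(2) by (auto simp: fun_eq_iff ei_def reduced_def)
      then have "(l + ei u) + reduced (I - {u}) \<le> y" using cubesD(4)[OF *(1)] by (simp only:)
      moreover have "(l + ei u) u = y u" using *(3) by (simp add: ei_def)
      ultimately show "(l + ei u, I - {u}) \<in> D0"
        using cubesD[OF *(1)] u(1) by (auto simp: D0_def cubes_def simp del: plus_fun_apply)
    qed
  qed (auto simp: D0_def D1_def)
  have fin01: "finite D0" "finite D1" "finite ?C'"
    using finC split by (metis finite_Un)+
  have "sum t D1 = sum (t \<circ> (\<lambda>(l, I). (l - ei u, insert u I))) D0"
    using sum.reindex_bij_betw[OF bij, of t] by (simp add: comp_def)
  also have "\<dots> = sum (\<lambda>c. - t c) D0"
  proof (rule sum.cong[OF refl])
    fix c assume "c \<in> D0"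
    then obtain l I where c: "c = (l, I)" "(l, I) \<in> ?C" "u \<notin> I" "l u = y u" by (cases c) (auto simp: D0_def)
    have "finite I" using cubesD(1)[OF c(2)] fin finite_subset by blast
    moreover have "F (l - ei u) (insert u I) = F l I"
      using F[OF cubesD(1,2,4)[OF c(2)] c(4,3)] .
    ultimately show "(t \<circ> (\<lambda>(l, I). (l - ei u, insert u I))) c = - t c"
      using c by (simp add: t_def)
  qed
  finally have "sum t D0 + sum t D1 = 0" by (simp add: sum_negf)
  then have "sum t ?C = sum t ?C'"
    unfolding split using disj fin01 by (simp add: sum.union_disjoint)
  then show ?thesis by (simp add: eu_def t_def)
qed

text \<open>The cubes based on the bottom face come in pairs, without and with direction
  \<open>u\<close>. The former fill the box with upper corner \<open>y(u := x u)\<close>, and each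
  pair contributes a difference of weights.\<close>

lemma eu_bottom_face:
  assumes fin: "finite V" and eq: "\<And>v. v \<notin> V \<Longrightarrow> x v = y v" and u: "u \<in> V" "x u < y u"
  shows "eu V F x y = eu V F (x + ei u) y - eu V (\<lambda>l I. F l (insert u I) - F l I) x (y(u := x u))"
proof -
  let ?C = "cubes V x y" and ?C' = "cubes V (x + ei u) y"
  define D0 where "D0 = {(l, I) \<in> ?C. u \<notin> I \<and> l u = x u}"
  define D1 where "D1 = {(l, I) \<in> ?C. u \<in> I \<and> l u = x u}"
  define t where "t = (\<lambda>(l :: 'a \<Rightarrow> int, I). (-1) ^ card I * F l I)"
  have finC: "finite ?C" using fin eq by (rule finite_cubes)
  have split: "?C = ?C' \<union> (D0 \<union> D1)"
  proof (intro equalityI subsetI)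
    fix c assume "c \<in> ?C"
    then obtain l I where c: "c = (l, I)" "(l, I) \<in> ?C" by (cases c) auto
    have "x u \<le> l u" using cubesD(2)[OF c(2)] by (auto simp: le_fun_def)
    then consider "l u = x u" | "x u + 1 \<le> l u" by linarith
    then show "c \<in> ?C' \<union> (D0 \<union> D1)"
    proof cases
      case 1
      then show ?thesis using c by (auto simp: D0_def D1_def)
    next
      case 2
      then show ?thesis using c cubesD[OF c(2)] by (auto simp: cubes_def le_fun_def ei_def)
    qed
  next
    fix c assume c: "c \<in> ?C' \<union> (D0 \<union> D1)"
    have "x \<le> x + ei u" by (simp add: le_fun_def ei_def)
    then have "?C' \<subseteq> ?C" using order_trans[of x "x + ei u"] by (auto simp: cubes_def)
    then show "c \<in> ?C" using c by (auto simp: D0_def D1_def)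
  qed
  have disj: "?C' \<inter> (D0 \<union> D1) = {}" "D0 \<inter> D1 = {}"
  proof -
    have "\<not> (l, I) \<in> D0 \<union> D1" if "(l, I) \<in> ?C'" for l I
    proof -
      have "x u + 1 \<le> l u"
        using le_funD[OF cubesD(2)[OF that], of u] by (simp add: ei_def)
      then show ?thesis by (auto simp: D0_def D1_def)
    qed
    then show "?C' \<inter> (D0 \<union> D1) = {}" by auto
  qed (auto simp: D0_def D1_def)
  have bij: "bij_betw (\<lambda>(l, I). (l, insert u I)) D0 D1"
  proof (rule bij_betw_byWitness[where f' = "\<lambda>(l, I). (l, I - {u})"])
    show "(\<lambda>(l, I). (l, insert u I)) ` D0 \<subseteq> D1"
    proof clarify
      fix l I assume "(l, I) \<in> D0"
      then have *: "(l, I) \<in> ?C" "u \<notin> I" "l u = x u" by (auto simp: D0_def)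
      have "l + reduced (insert u I) \<le> y"
      proof (rule le_funI)
        fix v
        have "l v + reduced I v \<le> y v" using cubesD(4)[OF *(1)] by (simp add: le_fun_def)
        then show "(l + reduced (insert u I)) v \<le> y v" using u *(2,3) by (auto simp: reduced_def)
      qed
      then show "(l, insert u I) \<in> D1"
        using cubesD[OF *(1)] u * by (auto simp: D1_def cubes_def)
    qed
    show "(\<lambda>(l, I). (l, I - {u})) ` D1 \<subseteq> D0"
    proof clarify
      fix l I assume "(l, I) \<in> D1"
      then have *: "(l, I) \<in> ?C" "u \<in> I" "l u = x u" by (auto simp: D1_def)
      have "l + reduced (I - {u}) \<le> y"
      proof (rule le_funI)
        fix v
        have "l v + reduced I v \<le> y v" using cubesD(4)[OF *(1)] by (simp add: le_fun_def)
        then show "(l + reduced (I - {u})) v \<le> y v" using u *(2,3) by (auto simp: reduced_def)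
      qed
      then show "(l, I - {u}) \<in> D0"
        using cubesD[OF *(1)] u * by (auto simp: D0_def cubes_def)
    qed
  qed (auto simp: D0_def D1_def)
  have fin01: "finite D0" "finite D1" "finite ?C'"
    using finC split by (metis finite_Un)+
  have D0: "D0 = cubes V x (y(u := x u))"
  proof (intro equalityI subsetI)
    fix c assume "c \<in> D0"
    then obtain l I where c: "c = (l, I)" "(l, I) \<in> ?C" "u \<notin> I" "l u = x u" by (cases c) (auto simp: D0_def)
    have "l + reduced I \<le> y(u := x u)"
    proof (rule le_funI)
      fix v
      have "l v + reduced I v \<le> y v" using cubesD(4)[OF c(2)] by (simp add: le_fun_def)
      then show "(l + reduced I) v \<le> (y(u := x u)) v" using c(3,4) by (simp add: reduced_def)
    qed
    then show "c \<in> cubes V x (y(u := x u))" using cubesD(1,2)[OF c(2)] c(1) by (simp add: cubes_def)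
  next
    fix c assume "c \<in> cubes V x (y(u := x u))"
    then obtain l I where c: "c = (l, I)" "(l, I) \<in> cubes V x (y(u := x u))" by (cases c) auto
    note d = cubesD[OF c(2)]
    have "l u + reduced I u \<le> x u" "x u \<le> l u" using le_funD[OF d(2), of u] le_funD[OF d(4), of u] by simp_all
    then have "l u = x u" "u \<notin> I" by (cases "u \<in> I"; simp add: reduced_def)+
    moreover have "l + reduced I \<le> y"
    proof (rule le_funI)
      fix v show "(l + reduced I) v \<le> y v"
        using le_funD[OF d(4), of v] u by (cases "v = u") simp_all
    qed
    ultimately show "c \<in> D0" using c d by (auto simp: D0_def cubes_def)
  qed
  have "sum t D1 = sum (t \<circ> (\<lambda>(l, I). (l, insert u I))) D0"
    using sum.reindex_bij_betw[OF bij, of t] by (simp add: comp_def)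
  also have "\<dots> = sum (\<lambda>(l, I). - ((-1) ^ card I * F l (insert u I))) D0"
  proof (rule sum.cong[OF refl])
    fix c assume "c \<in> D0"
    then obtain l I where c: "c = (l, I)" "(l, I) \<in> ?C" "u \<notin> I" "l u = x u" by (cases c) (auto simp: D0_def)
    have "finite I" using cubesD(1)[OF c(2)] fin finite_subset by blast
    then show "(t \<circ> (\<lambda>(l, I). (l, insert u I))) c = (case c of (l, I) \<Rightarrow> - ((-1) ^ card I * F l (insert u I)))"
      using c by (simp add: t_def)
  qed
  finally have "sum t D0 + sum t D1 = - (\<Sum>(l, I)\<in>D0. (-1) ^ card I * (F l (insert u I) - F l I))"
    by (simp add: t_def case_prod_beta algebra_simps sum_subtractf sum_negf)
  moreover have "sum t ?C = sum t ?C' + (sum t D0 + sum t D1)"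
    unfolding split using disj fin01 by (simp add: sum.union_disjoint)
  ultimately show ?thesis by (simp add: eu_def t_def D0)
qed

lemma eu_eq_zero:
  assumes "\<And>l I. I \<subseteq> V \<Longrightarrow> x \<le> l \<Longrightarrow> l + reduced I \<le> y \<Longrightarrow> F l I = 0"
  shows "eu V F x y = 0"
  unfolding eu_def using assms by (intro sum.neutral) (auto simp: cubes_def)

section \<open>The weight function\<close>

text \<open>The weight of a cube in lattice cohomology, doubled like \<open>chi2\<close>.\<close>

definition wt :: "'v res \<Rightarrow> ('v \<Rightarrow> int) \<Rightarrow> 'v set \<Rightarrow> int" where
  "wt G l I = Max ((\<lambda>J. chi2 G (l + reduced J)) ` Pow I)"

text \<open>Every cycle above a retractable \<open>y\<close> descends to \<open>y\<close> by steps along which \<open>\<chi>\<close> does not increase.\<close>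

definition retractable :: "'v res \<Rightarrow> ('v \<Rightarrow> int) \<Rightarrow> bool" where
  "retractable G y \<longleftrightarrow> (\<forall>l\<in>cyc G. 0 \<le> l \<longrightarrow> l \<noteq> 0 \<longrightarrow>
     (\<exists>u\<in>verts G. 0 < l u \<and> dot G (y + l - ei u) u \<le> 1 - int (pa G u)))"

lemma add_ei_le:
  assumes "a \<le> b" "a u < b u"
  shows "a + ei u \<le> b"
proof (rule le_funI)
  fix v show "(a + ei u) v \<le> b v"
    using le_funD[OF assms(1), of v] assms(2) by (cases "v = u") (simp_all add: ei_def)
qed

lemma le_diff_ei:
  assumes "a \<le> b" "a u < b u"
  shows "a \<le> b - ei u"
proof (rule le_funI)
  fix v show "a v \<le> (b - ei u) v"
    using le_funD[OF assms(1), of v] assms(2) by (cases "v = u") (simp_all add: ei_def)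
qed

lemma diff_ei_le:
  assumes "a \<le> b"
  shows "a - ei u \<le> b"
proof (rule le_funI)
  fix v show "(a - ei u) v \<le> b v"
    using le_funD[OF assms, of v] by (cases "v = u") (simp_all add: ei_def)
qed

lemma reduced_empty [simp]: "reduced {} = 0"
  by (simp add: reduced_def fun_eq_iff)

lemma reduced_insert: "u \<notin> J \<Longrightarrow> reduced (insert u J) = reduced J + ei u"
  by (auto simp: reduced_def ei_def fun_eq_iff)

lemma reduced_mono: "J \<subseteq> I \<Longrightarrow> reduced J \<le> reduced I"
  by (auto simp: reduced_def le_fun_def)

lemma wt_empty [simp]: "wt G l {} = chi2 G l"
  by (simp add: wt_def)

lemma wt_insert:
  assumes "finite I" "u \<notin> I"
  shows "wt G l (insert u I) = max (wt G l I) (wt G (l + ei u) I)"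
proof -
  have "(\<lambda>J. chi2 G (l + reduced J)) ` Pow (insert u I) =
    (\<lambda>J. chi2 G (l + reduced J)) ` Pow I \<union> (\<lambda>J. chi2 G (l + ei u + reduced J)) ` Pow I"
  proof -
    have "(\<lambda>J. chi2 G (l + reduced J)) ` (insert u ` Pow I) = (\<lambda>J. chi2 G (l + ei u + reduced J)) ` Pow I"
      unfolding image_image
    proof (intro image_cong refl)
      fix J assume "J \<in> Pow I"
      then have "u \<notin> J" using assms(2) by blast
      then show "chi2 G (l + reduced (insert u J)) = chi2 G (l + ei u + reduced J)"
        by (simp add: reduced_insert ac_simps)
    qed
    then show ?thesis by (simp add: Pow_insert image_Un)
  qed
  then show ?thesis
    unfolding wt_def by (simp only:) (rule Max_Un, use assms(1) in auto)
qed

lemma Max_image_mono: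
  fixes f g :: "'b \<Rightarrow> int"
  assumes "finite A" "A \<noteq> {}" "\<And>x. x \<in> A \<Longrightarrow> f x \<le> g x"
  shows "Max (f ` A) \<le> Max (g ` A)"
proof (rule Max.boundedI)
  fix c assume "c \<in> f ` A"
  then obtain x where "x \<in> A" "c = f x" by blast
  then have "c \<le> g x" "g x \<le> Max (g ` A)" using assms by simp_all
  then show "c \<le> Max (g ` A)" by (rule order_trans)
qed (use assms in auto)

lemma wt_le:
  assumes "finite I" "\<And>J. J \<subseteq> I \<Longrightarrow> chi2 G (a + reduced J) \<le> chi2 G (b + reduced J)"
  shows "wt G a I \<le> wt G b I"
  unfolding wt_def using assms by (intro Max_image_mono) auto

context plumbing
begin

abbreviation "weu \<equiv> eu V (wt G)"

text \<open>If adding E_u does not increase \<chi> at \<open>l\<close>, it does not do so at any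
  vertex of the cube, since the pairing with E_u only grows there. The maximum is thus attained on
  the near face.\<close>

lemma wt_insert_up:
  assumes "I \<subseteq> V" "u \<in> V" "u \<notin> I" "1 - int (pa G u) \<le> dot G l u"
  shows "wt G l (insert u I) = wt G l I"
proof -
  have fI: "finite I" using assms(1) fin finite_subset by blast
  have "wt G (l + ei u) I \<le> wt G l I"
  proof (rule wt_le[OF fI])
    fix J assume J: "J \<subseteq> I"
    have "dot G l u \<le> dot G (l + reduced J) u"
      using assms J by (intro dot_mono) (auto simp: reduced_def le_fun_def)
    moreover have "l + ei u + reduced J = l + reduced J + ei u" by (simp add: ac_simps)
    ultimately show "chi2 G (l + ei u + reduced J) \<le> chi2 G (l + reduced J)"
      using assms(2,4) by (simp only: chi2_step) simp
  qed
  then show ?thesis using wt_insert[OF fI assms(3), of G l] by simp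
qed

text \<open>The mirror image of \<open>wt_insert_up\<close>: the bound at the corner
  \<open>y\<close> passes to all lower points with the same coefficient at \<open>u\<close>, so that
  the maximum is attained on the far face.\<close>

lemma wt_top:
  assumes "I \<subseteq> V" "u \<in> V" "u \<notin> I" "l + reduced I \<le> y" "l u = y u"
    "dot G (y - ei u) u \<le> 1 - int (pa G u)"
  shows "wt G (l - ei u) (insert u I) = wt G l I"
proof -
  have fI: "finite I" using assms(1) fin finite_subset by blast
  have "wt G (l - ei u) I \<le> wt G l I"
  proof (rule wt_le[OF fI])
    fix J assume J: "J \<subseteq> I"
    define z where "z = l + reduced J - ei u"
    have "l + reduced J \<le> y"
    proof (rule le_funI)
      fix v show "(l + reduced J) v \<le> y v"
        using le_funD[OF assms(4), of v] le_funD[OF reduced_mono[OF J], of v] by simp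
    qed
    then have "dot G z u \<le> dot G (y - ei u) u"
      using assms J by (intro dot_mono) (auto simp: z_def le_fun_def reduced_def)
    then have "chi2 G z \<le> chi2 G (z + ei u)"
      using assms(2,6) by (simp only: chi2_step) simp
    moreover have "z + ei u = l + reduced J" "l - ei u + reduced J = z" by (simp_all add: z_def)
    ultimately show "chi2 G (l - ei u + reduced J) \<le> chi2 G (l + reduced J)" by simp
  qed
  then show ?thesis using wt_insert[OF fI assms(3), of G "l - ei u"] by simp
qed

section \<open>Contracting boxes along monotone directions\<close>

abbreviation "size_between x y \<equiv> nat (\<Sum>v\<in>V. y v - x v)"

lemma size_between_ei:
  assumes "u \<in> V" "x \<le> y" "x u < y u"
  shows "size_between x (y - ei u) < size_between x y" "size_between (x + ei u) y < size_between x y"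
proof -
  have s: "(\<Sum>v\<in>V. ei u v) = 1"
    using sum_ei[OF fin assms(1), of "\<lambda>_. 1"] by simp
  have "0 < (\<Sum>v\<in>V. y v - x v)"
    using assms(3) le_funD[OF assms(2)] by (intro sum_pos2[OF fin assms(1)]) auto
  then show "size_between x (y - ei u) < size_between x y" "size_between (x + ei u) y < size_between x y"
    using s by (simp_all add: sum_subtractf sum.distrib)
qed

text \<open>Above \<open>N\<close> there is always a top face that \<open>wt_top\<close> allows to
  remove without passing below \<open>N\<close>.\<close>

lemma eu_retract:
  assumes "x \<in> cyc G" "N \<in> cyc G" "retractable G N" "x \<le> N" "N \<le> Y" "Y \<in> cyc G"
  shows "weu x Y = weu x N"
  using assms(5,6)
proof (induction "size_between N Y" arbitrary: Y rule: less_induct)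
  case less
  show ?case
  proof (cases "Y = N")
    case False
    define l where "l = Y - N"
    have "l \<in> cyc G" unfolding l_def using less.prems(2) assms(2) by (rule cyc_diff)
    moreover have "0 \<le> l" using less.prems(1) by (simp add: l_def le_fun_def)
    moreover have "l \<noteq> 0" using False by (simp add: l_def)
    ultimately obtain u where u: "u \<in> V" "0 < l u" "dot G (N + l - ei u) u \<le> 1 - int (pa G u)"
      using assms(3) unfolding retractable_def by blast
    have Y: "N + l = Y" by (simp add: l_def)
    have Nu: "N u < Y u" using u by (simp add: l_def)
    have eq: "weu x Y = weu x (Y - ei u)"
    proof (rule eu_top[OF fin])
      show "x v = Y v" if "v \<notin> V" for v using that assms(1) less.prems(2) by (simp add: cyc_def)
      show "x u < Y u" using le_funD[OF assms(4), of u] Nu by simp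
      show "wt G (l - ei u) (insert u I) = wt G l I"
        if "I \<subseteq> V" "x \<le> l" "l + reduced I \<le> Y" "l u = Y u" "u \<notin> I" for l I
        using that u(1) u(3)[unfolded Y] by (intro wt_top[where y = Y])
    qed (rule u(1))
    have "N \<le> Y - ei u" using less.prems(1) Nu by (rule le_diff_ei)
    moreover have "Y - ei u \<in> cyc G" by (rule cyc_diff[OF less.prems(2) cyc_ei[OF u(1)]])
    ultimately have "weu x (Y - ei u) = weu x N"
      using size_between_ei(1)[OF u(1) less.prems(1) Nu] by (intro less.hyps)
    with eq show ?thesis by (rule trans)
  qed simp
qed

text \<open>The pairing bound at \<open>x\<close> holds on the whole bottom face, where
  \<open>wt_insert_up\<close> makes the difference weight vanish.\<close>

lemma eu_climb:
  assumes "x \<in> cyc G" "y \<in> cyc G" "u \<in> V" "x u < y u" "1 - int (pa G u) \<le> dot G x u"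
  shows "weu x y = weu (x + ei u) y"
proof -
  have "eu V (\<lambda>l I. wt G l (insert u I) - wt G l I) x (y(u := x u)) = 0"
  proof (rule eu_eq_zero)
    fix l I assume *: "I \<subseteq> V" "x \<le> l" "l + reduced I \<le> y(u := x u)"
    have "l u + reduced I u \<le> x u" "x u \<le> l u"
      using le_funD[OF *(2), of u] le_funD[OF *(3), of u] by simp_all
    then have lu: "l u = x u" "u \<notin> I" by (cases "u \<in> I"; simp add: reduced_def)+
    have "dot G x u \<le> dot G l u" using * lu assms by (intro dot_mono) auto
    then show "wt G l (insert u I) - wt G l I = 0"
      using wt_insert_up[OF *(1) assms(3) lu(2)] assms(5) by simp
  qed
  then show ?thesis
    using eu_bottom_face[OF fin, of x y u "wt G"] assms by (simp add: cyc_def)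
qed

text \<open>A top face of the slab can be removed if both terms of the difference allow it. The term
  with direction \<open>v\<close> needs the bound at \<open>t + ei v\<close>; the other one follows,
  because dropping E_v lowers the pairing with E_u for \<open>u\<close> different from
  \<open>v\<close>.\<close>

lemma eu_slab_retract:
  assumes x: "x \<in> cyc G" and v: "v \<in> V"
    and desc: "\<And>t. t \<in> cyc G \<Longrightarrow> x \<le> t \<Longrightarrow> t \<le> y \<Longrightarrow> t v = x v \<Longrightarrow> t \<noteq> x \<Longrightarrow>
       \<exists>u\<in>V. x u < t u \<and> dot G (t + ei v - ei u) u \<le> 1 - int (pa G u)"
    and t: "t \<in> cyc G" "x \<le> t" "t \<le> y" "t v = x v"
  shows "eu V (\<lambda>l I. wt G l (insert v I) - wt G l I) x t = max (chi2 G x) (chi2 G (x + ei v)) - chi2 G x"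
  using t
proof (induction "size_between x t" arbitrary: t rule: less_induct)
  case less
  let ?F = "\<lambda>l I. wt G l (insert v I) - wt G l I"
  show ?case
  proof (cases "t = x")
    case True
    then show ?thesis by (simp add: eu_point wt_insert)
  next
    case False
    then obtain u where u: "u \<in> V" "x u < t u" "dot G (t + ei v - ei u) u \<le> 1 - int (pa G u)"
      using desc less.prems by blast
    have uv: "u \<noteq> v" using u less.prems by auto
    have "dot G (t - ei u) u \<le> dot G (t + ei v - ei u) u"
      using u(1) uv v by (intro dot_mono) (auto simp: le_fun_def ei_def)
    then have u': "dot G (t - ei u) u \<le> 1 - int (pa G u)" using u(3) by simp
    have eq: "eu V ?F x t = eu V ?F x (t - ei u)"
    proof (rule eu_top[OF fin])
      show "x w = t w" if "w \<notin> V" for w using that x less.prems(1) by (simp add: cyc_def)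
      show "wt G (l - ei u) (insert v (insert u I)) - wt G (l - ei u) (insert u I) = wt G l (insert v I) - wt G l I"
        if *: "I \<subseteq> V" "x \<le> l" "l + reduced I \<le> t" "l u = t u" "u \<notin> I" for l I
      proof -
        have "l + reduced (insert v I) \<le> t + ei v"
        proof (rule le_funI)
          fix w have "l w + reduced I w \<le> t w" using *(3) by (simp add: le_fun_def)
          then show "(l + reduced (insert v I)) w \<le> (t + ei v) w" by (auto simp: reduced_def ei_def split: if_splits)
        qed
        then have "wt G (l - ei u) (insert u (insert v I)) = wt G l (insert v I)"
          using * u uv v by (intro wt_top[where y = "t + ei v"]) (auto simp: ei_def)
        moreover have "wt G (l - ei u) (insert u I) = wt G l I"
          using * u u' by (intro wt_top[where y = t]) auto
        ultimately show ?thesis by (simp add: insert_commute)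
      qed
    qed (use u in auto)
    have a: "x \<le> t - ei u" using less.prems(2) u(2) by (rule le_diff_ei)
    have b: "t - ei u \<le> y" using less.prems(3) by (rule diff_ei_le)
    have c: "t - ei u \<in> cyc G" by (rule cyc_diff[OF less.prems(1) cyc_ei[OF u(1)]])
    have d: "(t - ei u) v = x v" using less.prems(4) uv by (simp add: ei_def)
    show ?thesis
      unfolding eq using size_between_ei(1)[OF u(1) less.prems(2) u(2)] c a b d by (rule less.hyps)
  qed
qed

text \<open>As E_v is rational and orthogonal to \<open>x\<close>, \<chi> rises by one from
  \<open>x\<close> to \<open>x + ei v\<close>; the retracted slab contributes just this rise, which
  is 2 in units of \<open>chi2\<close>.\<close>

lemma eu_jump:
  assumes x: "x \<in> cyc G" and y: "y \<in> cyc G" "x \<le> y" and v: "v \<in> V" "x v < y v"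
    and zero: "pa G v = 0" "dot G x v = 0"
    and desc: "\<And>t. t \<in> cyc G \<Longrightarrow> x \<le> t \<Longrightarrow> t \<le> y \<Longrightarrow> t v = x v \<Longrightarrow> t \<noteq> x \<Longrightarrow>
       \<exists>u\<in>V. x u < t u \<and> dot G (t + ei v - ei u) u \<le> 1 - int (pa G u)"
  shows "weu x y = weu (x + ei v) y - 2"
proof -
  have "eu V (\<lambda>l I. wt G l (insert v I) - wt G l I) x (y(v := x v)) = max (chi2 G x) (chi2 G (x + ei v)) - chi2 G x"
    using v y x by (intro eu_slab_retract[where y = y] desc) (auto simp: cyc_def le_fun_def)
  then have "eu V (\<lambda>l I. wt G l (insert v I) - wt G l I) x (y(v := x v)) = 2"
    using zero by (simp add: chi2_step v)
  then show ?thesis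
    using eu_bottom_face[OF fin, of x y v "wt G"] x y v by (simp add: cyc_def)
qed

text \<open>As long as \<open>b\<close> is not 0, \<open>antinef_nonneg\<close> yields a curve with
  negative coefficient and positive pairing, along which one can climb towards 0.\<close>

lemma eu_below_zero:
  assumes "b \<in> cyc G" "b \<le> 0" "Y \<in> cyc G" "0 \<le> Y"
  shows "weu b Y = weu 0 Y"
  using assms(1,2)
proof (induction "size_between b 0" arbitrary: b rule: less_induct)
  case less
  show ?case
  proof (cases "b = 0")
    case False
    have "\<exists>u\<in>V. b u < 0 \<and> 0 < dot G b u"
    proof (rule ccontr)
      assume "\<not> ?thesis"
      then have "0 \<le> b" using less.prems(1) by (intro antinef_nonneg) (auto simp: not_less)
      then show False using less.prems(2) False by auto
    qed
    then obtain u where u: "u \<in> V" "b u < 0" "0 < dot G b u" by blast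
    have "b u < Y u" using u le_funD[OF assms(4), of u] by simp
    then have eq: "weu b Y = weu (b + ei u) Y"
      using u less.prems assms by (intro eu_climb) auto
    have b0: "b u < 0 u" using u(2) by simp
    have a: "b + ei u \<le> 0" using less.prems(2) b0 by (rule add_ei_le)
    have c: "b + ei u \<in> cyc G" by (rule cyc_add[OF less.prems(1) cyc_ei[OF u(1)]])
    show ?thesis
      unfolding eq using size_between_ei(2)[OF u(1) less.prems(2) b0] c a by (rule less.hyps)
  qed simp
qed

end

section \<open>Elliptic chains\<close>

text \<open>For \<open>N = Z\<^sub>K - s\<close>, the conditions say that \<open>s\<close> is antinef and that no smaller \<open>s - l\<close> is.\<close>

definition canon_max :: "'v res \<Rightarrow> ('v \<Rightarrow> int) \<Rightarrow> bool" where
  "canon_max G N \<longleftrightarrow> N \<in> cyc G \<and> (\<forall>u\<in>verts G. canon G u \<le> dot G N u) \<and>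
     (\<forall>l\<in>cyc G. 0 \<le> l \<longrightarrow> l \<noteq> 0 \<longrightarrow> (\<exists>u\<in>verts G. dot G (N + l) u < canon G u))"

text \<open>\<open>b - a\<close> is the next cycle of the elliptic sequence, and the sequence ends with the sum \<open>T\<close>.\<close>

definition elliptic_step :: "'v res \<Rightarrow> ('v \<Rightarrow> int) \<Rightarrow> ('v \<Rightarrow> int) \<Rightarrow> ('v \<Rightarrow> int) \<Rightarrow> bool" where
  "elliptic_step G T a b \<longleftrightarrow> a \<in> cyc G \<and> b \<in> cyc G \<and> a \<le> b \<and> b \<le> T \<and> a \<noteq> b \<and> chi2 G (b - a) = 0 \<and>
     (\<forall>u\<in>verts G. a u \<noteq> T u \<longrightarrow> dot G a u = 0) \<and>
     (\<forall>u\<in>verts G. a u \<noteq> b u \<longrightarrow> dot G (b - a) u \<le> 0) \<and>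
     (\<forall>y\<in>cyc G. 0 \<le> y \<longrightarrow> y \<le> b - a \<longrightarrow> y \<noteq> 0 \<longrightarrow>
        (\<forall>u\<in>verts G. a u \<noteq> b u \<longrightarrow> dot G y u \<le> 0) \<longrightarrow> y = b - a)"

text \<open>The last condition on \<open>N\<close> is an inequality because it has to survive
  blow-ups, which subtract E_v from \<open>N\<close> but not from the partial sums.\<close>

definition elliptic_chain :: "'v res \<Rightarrow> ('v \<Rightarrow> int) \<Rightarrow> (nat \<Rightarrow> 'v \<Rightarrow> int) \<Rightarrow> nat \<Rightarrow> bool" where
  "elliptic_chain G N x m \<longleftrightarrow> canon_max G N \<and> x 0 = 0 \<and> N \<le> x (Suc m) \<and>
     (\<forall>j\<le>m. elliptic_step G (x (Suc m)) (x j) (x (Suc j)))"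

lemma elliptic_step_orthogonal:
  "elliptic_step G T a b \<Longrightarrow> u \<in> verts G \<Longrightarrow> a u \<noteq> T u \<Longrightarrow> dot G a u = 0"
  by (simp add: elliptic_step_def)

definition essential_vertex :: "'v res \<Rightarrow> 'v \<Rightarrow> bool" where
  "essential_vertex G v \<longleftrightarrow> v \<in> verts G \<and>
     (\<forall>l\<in>cyc G. 0 \<le> l \<longrightarrow> l v = 0 \<longrightarrow> (l \<noteq> 0 \<longrightarrow> 0 < chi2 G l) \<and> 0 < chi2 G (l + ei v))"

context plumbing
begin

text \<open>A curve at which adding \<open>l\<close> lowers the pairing must occur in
  \<open>l\<close>. By adjunction, the strict bound by (Z_K, E_u) becomes at most 1 - 2 p_a(E_u)
  after E_u is removed.\<close>

lemma retractable_of_canon_max: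
  assumes "canon_max G N"
  shows "retractable G N"
  unfolding retractable_def
proof (intro ballI impI)
  fix l assume l: "l \<in> cyc G" "0 \<le> l" "l \<noteq> 0"
  then obtain u where u: "u \<in> V" "dot G (N + l) u < canon G u"
    using assms unfolding canon_max_def by blast
  have N: "canon G u \<le> dot G N u" using assms u(1) unfolding canon_max_def by blast
  have "l u \<noteq> 0"
  proof
    assume "l u = 0"
    then have "dot G N u \<le> dot G (N + l) u"
      using l(2) u(1) by (intro dot_mono) (auto simp: le_fun_def)
    then show False using u N by simp
  qed
  moreover have "0 \<le> l u" using le_funD[OF l(2), of u] by simp
  moreover have "dot G (N + l - ei u) u \<le> 1 - int (pa G u)"
    using u by (simp add: dot_diff dot_ei canon_def)
  ultimately show "\<exists>u\<in>V. 0 < l u \<and> dot G (N + l - ei u) u \<le> 1 - int (pa G u)"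
    using u(1) by force
qed

text \<open>Integrality of \<chi>: without this gap the two inequalities combined in
  \<open>eu_elliptic_step\<close> would not exclude each other.\<close>

lemma even_chi2:
  assumes "a \<in> cyc G" "0 \<le> a"
  shows "even (chi2 G a)"
  using assms
proof (induction "size_between 0 a" arbitrary: a rule: less_induct)
  case less
  show ?case
  proof (cases "a = 0")
    case False
    then obtain u where "a u \<noteq> 0" by (auto simp: fun_eq_iff)
    then have u: "u \<in> V" "0 u < a u"
      using less.prems(1) le_funD[OF less.prems(2), of u] by (auto simp: cyc_def)
    have c: "a - ei u \<in> cyc G" by (rule cyc_diff[OF less.prems(1) cyc_ei[OF u(1)]])
    have "0 \<le> a - ei u" using less.prems(2) u(2) by (rule le_diff_ei)
    with size_between_ei(1)[OF u(1) less.prems(2) u(2)] c have "even (chi2 G (a - ei u))"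
      by (rule less.hyps)
    moreover have "chi2 G a = chi2 G (a - ei u) + 2 * (1 - int (pa G u) - dot G (a - ei u) u)"
      using chi2_step[OF u(1), of "a - ei u"] by simp
    ultimately show ?thesis by simp
  qed simp
qed

text \<open>A computation sequence from \<open>a + y\<close> to \<open>b\<close>. By the minimality
  clause of the step, an unfinished \<open>y\<close> has a positive pairing with a curve that may
  still be added; this curve is orthogonal to \<open>a\<close>, so the pairing with
  \<open>a + y\<close> is the same and \<open>eu_climb\<close> applies.\<close>

lemma eu_laufer:
  assumes st: "elliptic_step G T a b" and T: "T \<in> cyc G" and pa: "\<And>u. u \<in> V \<Longrightarrow> pa G u = 0"
    and y: "y \<in> cyc G" "0 \<le> y" "y \<noteq> 0" "y \<le> b - a"
  shows "weu (a + y) T = weu b T"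
  using y
proof (induction "size_between y (b - a)" arbitrary: y rule: less_induct)
  case less
  note s = st[unfolded elliptic_step_def]
  show ?case
  proof (cases "y = b - a")
    case False
    have "\<exists>u\<in>V. y u < (b - a) u \<and> 0 < dot G y u"
    proof (rule ccontr)
      assume neg: "\<not> ?thesis"
      have "dot G y u \<le> 0" if u: "u \<in> V" "a u \<noteq> b u" for u
      proof (cases "y u < (b - a) u")
        case True
        then show ?thesis using neg u by force
      next
        case False
        then have "y u = (b - a) u" using le_funD[OF less.prems(4), of u] by simp
        then have "dot G y u \<le> dot G (b - a) u" using less.prems(4) u by (intro dot_mono)
        also have "\<dots> \<le> 0" using s u by blast
        finally show ?thesis .
      qed
      then show False using s less.prems False by blast
    qed
    then obtain u where u: "u \<in> V" "y u < (b - a) u" "0 < dot G y u" by blast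
    have bT: "b u \<le> T u" using s by (simp add: le_fun_def)
    have "0 \<le> y u" using le_funD[OF less.prems(2), of u] by simp
    then have "a u \<noteq> T u" using u(2) bT by simp
    then have d: "dot G a u = 0" by (rule elliptic_step_orthogonal[OF st u(1)])
    have ay: "a + y \<in> cyc G" using s less.prems(1) by (intro cyc_add) auto
    have "weu (a + y) T = weu (a + y + ei u) T"
      using u bT d pa by (intro eu_climb[OF ay T]) (auto simp: dot_add)
    also have "a + y + ei u = a + (y + ei u)" by (simp add: add.assoc)
    also have "weu (a + (y + ei u)) T = weu b T"
    proof (rule less.hyps)
      show "size_between (y + ei u) (b - a) < size_between y (b - a)"
        by (rule size_between_ei(2)[OF u(1) less.prems(4) u(2)])
      show "y + ei u \<in> cyc G" by (rule cyc_add[OF less.prems(1) cyc_ei[OF u(1)]])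
      show "0 \<le> y + ei u" using less.prems(2) ei_nonneg[of u] by (simp add: le_fun_def)
      have "0 < (y + ei u) u" using \<open>0 \<le> y u\<close> by (simp add: ei_def)
      then show "y + ei u \<noteq> 0" by (metis less_irrefl zero_fun_apply)
      show "y + ei u \<le> b - a" using less.prems(4) u(2) by (rule add_ei_le)
    qed
    finally show ?thesis .
  qed simp
qed

text \<open>All the change is in the first added curve E_v, by \<open>eu_jump\<close>; from there
  \<open>eu_laufer\<close> reaches \<open>b\<close> for free.\<close>

lemma eu_elliptic_step:
  assumes st: "elliptic_step G T a b" and T: "T \<in> cyc G" and pa: "\<And>u. u \<in> V \<Longrightarrow> pa G u = 0"
    and ess: "essential_vertex G v"
  shows "weu a T = weu b T - 2"
proof -
  have v: "v \<in> V"
    and rat: "\<And>l. l \<in> cyc G \<Longrightarrow> 0 \<le> l \<Longrightarrow> l \<noteq> 0 \<Longrightarrow> l v = 0 \<Longrightarrow> 0 < chi2 G l"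
    and rat1: "\<And>l. l \<in> cyc G \<Longrightarrow> 0 \<le> l \<Longrightarrow> l v = 0 \<Longrightarrow> 0 < chi2 G (l + ei v)"
    using ess by (auto simp: essential_vertex_def)
  note s = st[unfolded elliptic_step_def]
  have aT: "a \<le> T" using s by (meson order_trans)
  have z: "b - a \<in> cyc G" "0 \<le> b - a" "b - a \<noteq> 0"
    using s by (auto simp: le_fun_def intro: cyc_diff)
  \<comment> \<open>\<chi> vanishes on \<open>b - a\<close>, but is positive on nonzero effective
    cycles that avoid E_v.\<close>
  have "(b - a) v \<noteq> 0" using rat[OF z] s by auto
  then have av: "a v < b v" using s by (auto simp: le_fun_def order.strict_iff_order)
  then have avT: "a v < T v" using s le_funD[of b T v] by auto
  have "weu a T = weu (a + ei v) T - 2"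
  proof (rule eu_jump)
    show "dot G a v = 0" using avT by (intro elliptic_step_orthogonal[OF st v]) simp
    fix t assume t: "t \<in> cyc G" "a \<le> t" "t \<le> T" "t v = a v" "t \<noteq> a"
    define l where "l = t - a"
    have l: "l \<in> cyc G" "0 \<le> l" "l \<noteq> 0" "l v = 0"
      using t s by (auto simp: l_def le_fun_def intro: cyc_diff)
    show "\<exists>u\<in>V. a u < t u \<and> dot G (t + ei v - ei u) u \<le> 1 - int (pa G u)"
    proof (rule ccontr)
      assume neg: "\<not> ?thesis"
      \<comment> \<open>If no curve of \<open>l\<close> can be removed, adjunction gives (l + E_v,
        E_u) \<ge> (Z_K, E_u) on all of them. Weighting by the coefficients of \<open>l\<close>
        turns this into \<open>chi2 G l \<le> dot G l v\<close>.\<close>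
      have "0 \<le> l u * (dot G l u + dot G (ei v) u - canon G u)" if u: "u \<in> V" for u
      proof (cases "l u = 0")
        case False
        then have au: "a u < t u" using le_funD[OF t(2), of u] by (auto simp: l_def)
        then have "a u \<noteq> T u" using le_funD[OF t(3), of u] by simp
        then have "dot G a u = 0" by (rule elliptic_step_orthogonal[OF st u])
        then have "dot G (t + ei v - ei u) u = dot G l u + dot G (ei v) u - inter G u u"
          by (simp add: l_def dot_add dot_diff dot_ei u)
        moreover have "1 < dot G (t + ei v - ei u) u" using neg u au pa by force
        ultimately have "0 \<le> dot G l u + dot G (ei v) u - canon G u" using pa u by (simp add: canon_def)
        then show ?thesis using au by (simp add: l_def)
      qed simp
      then have "0 \<le> (\<Sum>u\<in>V. l u * (dot G l u + dot G (ei v) u - canon G u))"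
        by (intro sum_nonneg)
      also have "\<dots> = (\<Sum>u\<in>V. l u * dot G (ei v) u) - chi2 G l"
        by (simp add: chi2_def algebra_simps sum.distrib sum_subtractf)
      also have "(\<Sum>u\<in>V. l u * dot G (ei v) u) = dot G l v"
        by (simp add: pairing_sym[of l] sum_ei fin v)
      finally have 1: "chi2 G l \<le> dot G l v" by simp
      have "0 < chi2 G (l + ei v)" by (rule rat1[OF l(1,2,4)])
      then have 2: "0 < chi2 G l + 2 * (1 - dot G l v)" using chi2_step[OF v, of l] pa v by simp
      have "0 < chi2 G l" by (rule rat[OF l])
      moreover obtain c where "chi2 G l = 2 * c" using even_chi2[OF l(1,2)] by (elim evenE)
      ultimately show False using 1 2 by simp
    qed
  qed (use s T aT v avT pa in auto)
  also have "weu (a + ei v) T = weu b T"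
  proof (rule eu_laufer[OF st T pa])
    show "ei v \<le> b - a"
    proof (rule le_funI)
      fix u show "ei v u \<le> (b - a) u"
        using av le_funD[OF z(2), of u] by (simp add: ei_def)
    qed
  qed (use v ei_nonneg[of v] ei_nonzero[of v] cyc_ei[of v G] in auto)
  finally show ?thesis .
qed

lemma eu_elliptic_chain:
  assumes ch: "elliptic_chain G N x m" and pa: "\<And>u. u \<in> V \<Longrightarrow> pa G u = 0"
    and ess: "essential_vertex G v"
    and Y: "Y \<in> cyc G" "0 \<le> Y" "N \<le> Y"
  shows "weu 0 Y = - 2 * int (m + 1)"
proof -
  define T where "T = x (Suc m)"
  have N: "canon_max G N" and x0: "x 0 = 0" and NT: "N \<le> T"
    and st: "\<And>j. j \<le> m \<Longrightarrow> elliptic_step G T (x j) (x (Suc j))"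
    using ch unfolding elliptic_chain_def T_def by auto
  have T: "T \<in> cyc G" using st[of m] unfolding elliptic_step_def T_def by blast
  have T0: "0 \<le> T" using st[of 0] unfolding elliptic_step_def x0 by (meson order_trans zero_le)
  \<comment> \<open>Each increment is orthogonal to the partial sum before it, so \<chi> is additive
    along the chain.\<close>
  have chi: "chi2 G (x j) = 0" if "j \<le> Suc m" for j
    using that
  proof (induction j)
    case (Suc j)
    note s = st[of j, unfolded elliptic_step_def]
    have "(\<Sum>u\<in>V. (x (Suc j) - x j) u * dot G (x j) u) = 0"
    proof (rule sum.neutral, rule ballI)
      fix u assume u: "u \<in> V"
      show "(x (Suc j) - x j) u * dot G (x j) u = 0"
      proof (cases "x j u = x (Suc j) u")
        case False
        have "x j \<le> x (Suc j)" "x (Suc j) \<le> T" using s Suc.prems by auto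
        then have "x j u \<le> x (Suc j) u" "x (Suc j) u \<le> T u" by (simp_all add: le_fun_def)
        with False have "x j u \<noteq> T u" by simp
        then show ?thesis using s Suc.prems u by simp
      qed simp
    qed
    then show ?case
      using chi2_add[of "x j" "x (Suc j) - x j"] Suc s by simp
  qed (simp add: x0)
  have steps: "weu 0 T = weu (x j) T - 2 * int j" if "j \<le> Suc m" for j
    using that
  proof (induction j)
    case (Suc j)
    have "weu (x j) T = weu (x (Suc j)) T - 2"
      using Suc.prems by (intro eu_elliptic_step[OF st T pa ess]) auto
    then show ?case using Suc by simp
  qed (simp add: x0)
  have T_value: "weu 0 T = - 2 * int (m + 1)"
    using steps[of "Suc m"] chi[of "Suc m"] by (simp add: T_def eu_point)
  \<comment> \<open>0 need not lie below \<open>N\<close> on a nonminimal resolution; this lower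
    corner lies below both.\<close>
  define b where "b = inf 0 N"
  have b: "b \<in> cyc G" "b \<le> 0" "b \<le> N"
    using N by (auto simp: b_def canon_max_def cyc_def inf_int_def)
  have Nc: "N \<in> cyc G" using N by (simp add: canon_max_def)
  have "weu 0 Y = weu b Y"
    by (rule eu_below_zero[OF b(1,2) Y(1,2), symmetric])
  also have "\<dots> = weu b N"
    by (rule eu_retract[OF b(1) Nc retractable_of_canon_max[OF N] b(3) Y(3,1)])
  also have "\<dots> = weu b T"
    by (rule eu_retract[OF b(1) Nc retractable_of_canon_max[OF N] b(3) NT T, symmetric])
  also have "\<dots> = weu 0 T"
    by (rule eu_below_zero[OF b(1,2) T T0])
  finally show ?thesis using T_value by simp
qed

end

section \<open>The minimal elliptic cycle\<close>

text \<open>Ellipticity in terms of all effective cycles rather than \<open>Z_min\<close>: in this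
  form it descends along contractions.\<close>

definition elliptic_base :: "'v res \<Rightarrow> bool" where
  "elliptic_base G \<longleftrightarrow> (\<forall>l\<in>cyc G. 0 \<le> l \<longrightarrow> 0 \<le> chi2 G l) \<and>
     (\<exists>l\<in>cyc G. 0 \<le> l \<and> l \<noteq> 0 \<and> chi2 G l = 0)"

definition zero_cycles :: "'v res \<Rightarrow> ('v \<Rightarrow> int) set" where
  "zero_cycles G = {l \<in> cyc G. 0 \<le> l \<and> l \<noteq> 0 \<and> chi2 G l = 0}"

lemma cyc_inf: "a \<in> cyc G \<Longrightarrow> b \<in> cyc G \<Longrightarrow> inf a b \<in> cyc G"
  and cyc_sup: "a \<in> cyc G \<Longrightarrow> b \<in> cyc G \<Longrightarrow> sup a b \<in> cyc G"
  by (auto simp: cyc_def inf_int_def sup_int_def)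

context plumbing
begin

text \<open>Among the zero cycles having no curve in common with \<open>B\<close>, take
  \<open>a\<close> of largest support. An edge leaves that support. If it ends outside
  \<open>B\<close>, its end can be added without increasing \<chi>, against maximality; if it ends
  in \<open>B\<close>, then (a, B) > 0 and \<chi>(a + B) < 0.\<close>

lemma zero_cycles_meet:
  assumes con: "cut_connected G" and nn: "\<And>l. l \<in> cyc G \<Longrightarrow> 0 \<le> l \<Longrightarrow> 0 \<le> chi2 G l"
    and A: "A \<in> zero_cycles G" and B: "B \<in> zero_cycles G"
  shows "inf A B \<noteq> 0"
proof
  assume "inf A B = 0"
  define P where "P a \<longleftrightarrow> a \<in> zero_cycles G \<and> (\<forall>v. a v = 0 \<or> B v = 0)" for a
  have B': "B \<in> cyc G" "0 \<le> B" "B \<noteq> 0" "chi2 G B = 0" using B by (auto simp: zero_cycles_def)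
  have "P A"
    unfolding P_def
  proof (intro conjI allI A)
    fix v
    have "inf (A v) (B v) = 0" using \<open>inf A B = 0\<close> by (metis inf_fun_def zero_fun_apply)
    then show "A v = 0 \<or> B v = 0" by (auto simp: inf_int_def min_def split: if_splits)
  qed
  moreover have "card {v\<in>V. a v \<noteq> 0} < Suc (card V)" for a :: "'v \<Rightarrow> int"
    using card_mono[OF fin, of "{v\<in>V. a v \<noteq> 0}"] by (simp add: less_Suc_eq_le)
  ultimately obtain a where a: "P a" and max: "\<And>b. P b \<Longrightarrow> card {v\<in>V. b v \<noteq> 0} \<le> card {v\<in>V. a v \<noteq> 0}"
    using ex_has_greatest_nat[of P A "\<lambda>a. card {v\<in>V. a v \<noteq> 0}" "Suc (card V)"] by auto
  have a': "a \<in> cyc G" "0 \<le> a" "a \<noteq> 0" "chi2 G a = 0" and disj: "\<And>v. a v = 0 \<or> B v = 0"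
    using a by (auto simp: P_def zero_cycles_def)
  define S where "S = {v\<in>V. a v \<noteq> 0}"
  have S: "S \<subseteq> V" by (auto simp: S_def)
  have "S \<noteq> {}" using a'(1,3) by (auto simp: S_def cyc_def fun_eq_iff)
  moreover have "S \<noteq> V"
  proof
    assume "S = V"
    then have "B v = 0" for v using disj[of v] B'(1) by (cases "v \<in> V") (auto simp: S_def cyc_def)
    then show False using B'(3) by (simp add: fun_eq_iff)
  qed
  ultimately obtain u w where uw: "u \<in> S" "w \<in> V" "w \<notin> S" "0 < inter G u w"
    using S con by (elim cut_connectedD)
  have aw: "a w = 0" using uw by (simp add: S_def)
  have au: "0 < a u" using uw(1) le_funD[OF a'(2), of u] by (simp add: S_def)
  have d: "0 < dot G a w"
    using a'(2) aw uw au S by (intro dot_pos[of a w u]) auto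
  show False
  proof (cases "B w = 0")
    case True
    have c: "a + ei w \<in> cyc G" by (rule cyc_add[OF a'(1) cyc_ei[OF uw(2)]])
    have p: "0 \<le> a + ei w" using a'(2) by (auto simp: le_fun_def ei_def)
    have "chi2 G (a + ei w) \<le> 0" using d a'(4) by (simp add: chi2_step uw(2))
    with nn[OF c p] have "chi2 G (a + ei w) = 0" by simp
    moreover have "a + ei w \<noteq> 0"
    proof
      assume "a + ei w = 0"
      then have "(a + ei w) w = 0" by simp
      then show False using aw by (simp add: ei_def)
    qed
    moreover have "(a + ei w) v = 0 \<or> B v = 0" for v using disj[of v] True by (auto simp: ei_def)
    ultimately have "P (a + ei w)"
      using c p unfolding P_def zero_cycles_def by blast
    then have "card {v\<in>V. (a + ei w) v \<noteq> 0} \<le> card S" using max unfolding S_def by blast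
    moreover have "insert w S \<subseteq> {v\<in>V. (a + ei w) v \<noteq> 0}"
      using uw(2) aw le_funD[OF a'(2)] by (auto simp: S_def ei_def add_nonneg_eq_0_iff)
    then have "card (insert w S) \<le> card {v\<in>V. (a + ei w) v \<noteq> 0}"
      using fin by (intro card_mono) auto
    moreover have "card (insert w S) = Suc (card S)"
      using uw(3) S fin finite_subset by (intro card_insert_disjoint) auto
    ultimately show False by simp
  next
    case False
    then have Bw: "0 < B w" using le_funD[OF B'(2), of w] by simp
    have "0 \<le> B v * dot G a v" if v: "v \<in> V" for v
    proof (cases "B v = 0")
      case False
      then have "dot G 0 v \<le> dot G a v" using disj[of v] a'(2) v by (intro dot_mono) auto
      then show ?thesis using le_funD[OF B'(2), of v] by simp
    qed simp
    moreover have "0 < B w * dot G a w" using Bw d by simp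
    ultimately have "0 < (\<Sum>v\<in>V. B v * dot G a v)"
      by (intro sum_pos2[OF fin uw(2)])
    then have "chi2 G (a + B) < 0" using a'(4) B'(4) by (simp add: chi2_add)
    moreover have "0 \<le> chi2 G (a + B)"
      using a'(1,2) B'(1,2) by (intro nn cyc_add) (auto simp: le_fun_def)
    ultimately show False by simp
  qed
qed

text \<open>Submodularity together with \<chi> \<ge> 0 puts the infimum of two zero cycles at \<chi>
  = 0, and \<open>zero_cycles_meet\<close> keeps it nonzero. So a zero cycle of smallest coefficient
  sum is the least one: Laufer's minimally elliptic cycle.\<close>

lemma minimal_zero_cycle:
  assumes con: "cut_connected G" and base: "elliptic_base G"
  obtains C where "C \<in> zero_cycles G" "\<And>l. l \<in> zero_cycles G \<Longrightarrow> C \<le> l"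
proof -
  have nn: "0 \<le> chi2 G l" if "l \<in> cyc G" "0 \<le> l" for l
    using base that by (simp add: elliptic_base_def)
  obtain A where "A \<in> zero_cycles G" using base by (auto simp: elliptic_base_def zero_cycles_def)
  then obtain C where C: "C \<in> zero_cycles G"
    and min: "\<And>l. l \<in> zero_cycles G \<Longrightarrow> size_between 0 C \<le> size_between 0 l"
    using ex_has_least_nat[of "\<lambda>l. l \<in> zero_cycles G" A "size_between 0"] by blast
  have C': "C \<in> cyc G" "0 \<le> C" "C \<noteq> 0" "chi2 G C = 0" using C by (auto simp: zero_cycles_def)
  have "C \<le> l" if l: "l \<in> zero_cycles G" for l
  proof -
    have l': "l \<in> cyc G" "0 \<le> l" "chi2 G l = 0" using l by (auto simp: zero_cycles_def)
    have i: "inf C l \<in> cyc G" "0 \<le> inf C l" using C'(1,2) l' cyc_inf by auto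
    have s: "sup C l \<in> cyc G" "0 \<le> sup C l" using C'(1,2) l' cyc_sup by (auto intro: le_supI1)
    have "chi2 G (inf C l) = 0"
      using chi2_inf_sup[OF C'(1) l'(1)] nn[OF i] nn[OF s] C'(4) l'(3) by simp
    then have z: "inf C l \<in> zero_cycles G"
      using i zero_cycles_meet[OF con nn C l] by (simp add: zero_cycles_def)
    have "0 \<le> (\<Sum>v\<in>V. inf C l v)" using le_funD[OF i(2)] by (intro sum_nonneg) simp
    then have "(\<Sum>v\<in>V. C v) \<le> (\<Sum>v\<in>V. inf C l v)" using min[OF z] by simp
    then have "inf C l = C" using C'(1) i(1) by (intro cyc_eqI_sum[OF fin]) auto
    then show ?thesis by (metis inf.cobounded2)
  qed
  with C show ?thesis by (rule that)
qed

text \<open>The minimal zero cycle is not reduced, since reduced cycles have \<chi> > 0. At a curve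
  where its coefficient is at least 2, no cycle with coefficient 0 or 1 can lie above it, so none of
  these is a zero cycle.\<close>

lemma elliptic_vertex:
  assumes con: "cut_connected G" and base: "elliptic_base G"
    and red: "\<And>J. J \<subseteq> V \<Longrightarrow> J \<noteq> {} \<Longrightarrow> 0 < chi2 G (reduced J)"
  obtains v where "essential_vertex G v"
proof -
  have nn: "0 \<le> chi2 G l" if "l \<in> cyc G" "0 \<le> l" for l
    using base that by (simp add: elliptic_base_def)
  obtain C where C: "C \<in> zero_cycles G" and min: "\<And>l. l \<in> zero_cycles G \<Longrightarrow> C \<le> l"
    by (rule minimal_zero_cycle[OF con base]) blast
  have C': "C \<in> cyc G" "0 \<le> C" "C \<noteq> 0" "chi2 G C = 0" using C by (auto simp: zero_cycles_def)
  have "\<exists>v\<in>V. 2 \<le> C v"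
  proof (rule ccontr)
    assume neg: "\<not> ?thesis"
    define J where "J = {v\<in>V. C v \<noteq> 0}"
    have "C = reduced J"
    proof
      fix v show "C v = reduced J v"
        using le_funD[OF C'(2), of v] neg C'(1) by (cases "v \<in> V") (force simp: J_def reduced_def cyc_def)+
    qed
    moreover have "J \<noteq> {}" using C'(1,3) by (auto simp: J_def cyc_def fun_eq_iff)
    ultimately show False using red[of J] C'(4) by (auto simp: J_def)
  qed
  then obtain v where v: "v \<in> V" "2 \<le> C v" by blast
  have "essential_vertex G v"
    unfolding essential_vertex_def
  proof (intro conjI ballI impI v(1))
    fix l assume l: "l \<in> cyc G" "0 \<le> l" "l v = 0" "l \<noteq> 0"
    have "l \<notin> zero_cycles G" using min[of l] l(3) v(2) by (auto simp: le_fun_def dest!: spec[of _ v])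
    then show "0 < chi2 G l" using nn[OF l(1,2)] l by (simp add: zero_cycles_def)
  next
    fix l assume l: "l \<in> cyc G" "0 \<le> l" "l v = 0"
    have c: "l + ei v \<in> cyc G" by (rule cyc_add[OF l(1) cyc_ei[OF v(1)]])
    have p: "0 \<le> l + ei v" using l(2) by (auto simp: le_fun_def ei_def)
    have lv: "(l + ei v) v = 1" using l(3) by (simp add: ei_def)
    then have "l + ei v \<noteq> 0" by (metis zero_fun_apply zero_neq_one)
    moreover have "l + ei v \<notin> zero_cycles G"
    proof
      assume "l + ei v \<in> zero_cycles G"
      then have "C v \<le> (l + ei v) v" by (intro le_funD[OF min])
      then show False using lv v(2) by simp
    qed
    ultimately show "0 < chi2 G (l + ei v)" using nn[OF c p] c p by (simp add: zero_cycles_def)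
  qed
  then show ?thesis by (rule that)
qed

end

section \<open>The zeta function of a tree as an alternating sum\<close>

text \<open>Generation by attaching leaves, made for the induction in
  \<open>tree_alternating_sum\<close>. Both entries of each pair are prescribed because
  \<open>q\<close> is not assumed symmetric.\<close>

inductive tree :: "('v \<Rightarrow> 'v \<Rightarrow> int) \<Rightarrow> 'v set \<Rightarrow> bool" for q where
  single: "tree q {v}"
| leaf: "tree q V \<Longrightarrow> u \<notin> V \<Longrightarrow> w \<in> V \<Longrightarrow> q u w = 1 \<Longrightarrow> q w u = 1 \<Longrightarrow>
    (\<And>x. x \<in> V \<Longrightarrow> x \<noteq> w \<Longrightarrow> q u x = 0 \<and> q x u = 0) \<Longrightarrow> tree q (insert u V)"

definition degree_in :: "('v \<Rightarrow> 'v \<Rightarrow> int) \<Rightarrow> 'v set \<Rightarrow> 'v \<Rightarrow> int" where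
  "degree_in q V v = (\<Sum>w\<in>V - {v}. q v w)"

text \<open>For symmetric \<open>q\<close> every edge inside \<open>J\<close> is counted twice, in
  accordance with \<open>chi2\<close>.\<close>

definition edges2 :: "('v \<Rightarrow> 'v \<Rightarrow> int) \<Rightarrow> 'v set \<Rightarrow> int" where
  "edges2 q J = (\<Sum>u\<in>J. \<Sum>w\<in>J - {u}. q w u)"

text \<open>Extended by zero to negative exponents, so that the recursion \<open>coeff_diff\<close>
  holds without exceptions.\<close>

definition coeff :: "int \<Rightarrow> int \<Rightarrow> rat" where
  "coeff d k = (if k < 0 then 0 else fps_nth ((1 - fps_X :: rat fps) powi d) (nat k))"

text \<open>For \<open>a v\<close> = -(l, E_v) on a tree of rational curves, this is the weight of
  the cube at \<open>l\<close> minus \<open>chi2 G l\<close>. It depends only on the graph and on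
  the numbers \<open>a v\<close>, which the leaf induction can vary freely.\<close>

definition cube_max :: "('v \<Rightarrow> 'v \<Rightarrow> int) \<Rightarrow> ('v \<Rightarrow> int) \<Rightarrow> 'v set \<Rightarrow> int" where
  "cube_max q a I = Max ((\<lambda>J. 2 * (\<Sum>v\<in>J. 1 + a v) - edges2 q J) ` Pow I)"

lemma tree_finite: "tree q V \<Longrightarrow> finite V"
  and tree_nonempty: "tree q V \<Longrightarrow> V \<noteq> {}"
  by (induction rule: tree.induct; simp)+

lemma powi_Suc_one_minus_X:
  "(1 - fps_X :: rat fps) powi (d + 1) = (1 - fps_X) powi d * (1 - fps_X)"
proof (cases "0 \<le> d")
  case True
  then show ?thesis by (simp add: power_int_def nat_add_distrib)
next
  case False
  have inv: "inverse (1 - fps_X :: rat fps) * (1 - fps_X) = 1"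
    by (rule inverse_mult_eq_1) simp
  define n where "n = nat (- d) - 1"
  have d: "d = - int (Suc n)" using False by (simp add: n_def)
  have "(1 - fps_X :: rat fps) powi d = inverse (1 - fps_X) ^ Suc n"
    unfolding d by (simp add: power_int_def del: power_Suc of_nat_Suc)
  moreover have "(1 - fps_X :: rat fps) powi (d + 1) = inverse (1 - fps_X) ^ n"
    unfolding d by (simp add: power_int_def)
  ultimately show ?thesis using inv by (simp add: mult.assoc mult.left_commute)
qed

text \<open>Multiplication by \<open>1 - fps_X\<close> raises the exponent, just as attaching a leaf
  raises the valency of its neighbour.\<close>

lemma coeff_diff: "coeff d k - coeff d (k - 1) = coeff (d + 1) k"
proof -
  consider "k < 0" | "k = 0" | n where "k = int (Suc n)"
    by (metis not_less zero_less_imp_eq_int nat_less_le neq0_conv Suc_pred of_nat_0_less_iff linorder_neqE_linordered_idom)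
  then show ?thesis
  proof cases
    case 3
    have "nat (int (Suc n) - 1) = n" by simp
    then show ?thesis unfolding 3
      by (simp add: coeff_def powi_Suc_one_minus_X right_diff_distrib nat_add_distrib)
  qed (auto simp: coeff_def powi_Suc_one_minus_X)
qed

lemma coeff_neg: "k < 0 \<Longrightarrow> coeff d k = 0"
  by (simp add: coeff_def)

lemma coeff_minus1: "coeff (-1) (int n) = 1"
proof (induction n)
  case 0
  have "coeff (-1) 0 = coeff 0 0" using coeff_diff[of "-1" 0] by (simp add: coeff_neg)
  then show ?case by (simp add: coeff_def)
next
  case (Suc n)
  have "coeff 0 (int (Suc n)) = 0" by (simp add: coeff_def)
  then show ?case using coeff_diff[of "-1" "int (Suc n)"] Suc by simp
qed

lemma coeff_minus2: "coeff (-2) (int n) = of_nat n + 1"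
proof (induction n)
  case 0
  then show ?case using coeff_diff[of "-2" 0] coeff_minus1[of 0] by (simp add: coeff_neg)
next
  case (Suc n)
  then show ?case using coeff_diff[of "-2" "int (Suc n)"] coeff_minus1[of "Suc n"] by simp
qed

section \<open>Alternating sums over the vertex subsets of a tree\<close>

lemma sum_Pow_insert:
  assumes "finite V" "u \<notin> V"
  shows "(\<Sum>I\<in>Pow (insert u V). f I) = (\<Sum>I\<in>Pow V. f I + f (insert u I))"
proof -
  have inj: "inj_on (insert u) (Pow V)" using assms(2) by (auto simp: inj_on_def)
  have "(\<Sum>I\<in>Pow (insert u V). f I) = sum f (Pow V) + sum f (insert u ` Pow V)"
    unfolding Pow_insert using assms by (intro sum.union_disjoint) auto
  then show ?thesis by (simp add: sum.reindex[OF inj] sum.distrib)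
qed

lemma alternating_sum_Pow:
  assumes "finite V" "V \<noteq> {}"
  shows "(\<Sum>I\<in>Pow V. (-1) ^ card I) = (0 :: 'a::comm_ring_1)"
proof -
  obtain u where u: "u \<in> V" using assms by blast
  have "(\<Sum>I\<in>Pow (insert u (V - {u})). (-1 :: 'a) ^ card I) = 0"
  proof (subst sum_Pow_insert)
    show "(\<Sum>I\<in>Pow (V - {u}). (-1 :: 'a) ^ card I + (-1) ^ card (insert u I)) = 0"
    proof (rule sum.neutral, rule ballI)
      fix I assume "I \<in> Pow (V - {u})"
      then have "finite I" "u \<notin> I" using assms finite_subset by auto
      then show "(-1 :: 'a) ^ card I + (-1) ^ card (insert u I) = 0" by simp
    qed
  qed (use assms in auto)
  then show ?thesis using u by (simp add: insert_absorb)
qed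

lemma edges2_insert:
  assumes "finite J" "u \<notin> J"
  shows "edges2 q (insert u J) = edges2 q J + (\<Sum>x\<in>J. q u x + q x u)"
proof -
  have "(\<Sum>w\<in>insert u J - {x}. q w x) = q u x + (\<Sum>w\<in>J - {x}. q w x)" if "x \<in> J" for x
  proof -
    have "insert u J - {x} = insert u (J - {x})" using that assms by auto
    then show ?thesis using assms by simp
  qed
  moreover have "insert u J - {u} = J" using assms by auto
  ultimately show ?thesis using assms by (simp add: edges2_def sum.distrib)
qed

lemma cube_max_insert:
  assumes "finite I" "u \<notin> I"
  shows "cube_max q a (insert u I) = max (cube_max q a I)
    (Max ((\<lambda>J. 2 * (1 + a u) + 2 * (\<Sum>v\<in>J. 1 + a v) - edges2 q J - (\<Sum>x\<in>J. q u x + q x u)) ` Pow I))"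
proof -
  have "(\<lambda>J. 2 * (\<Sum>v\<in>J. 1 + a v) - edges2 q J) ` Pow (insert u I) =
    (\<lambda>J. 2 * (\<Sum>v\<in>J. 1 + a v) - edges2 q J) ` Pow I \<union>
    (\<lambda>J. 2 * (1 + a u) + 2 * (\<Sum>v\<in>J. 1 + a v) - edges2 q J - (\<Sum>x\<in>J. q u x + q x u)) ` Pow I"
  proof -
    have "(\<lambda>J. 2 * (\<Sum>v\<in>J. 1 + a v) - edges2 q J) ` (insert u ` Pow I) =
      (\<lambda>J. 2 * (1 + a u) + 2 * (\<Sum>v\<in>J. 1 + a v) - edges2 q J - (\<Sum>x\<in>J. q u x + q x u)) ` Pow I"
      unfolding image_image
    proof (intro image_cong refl)
      fix J assume "J \<in> Pow I"
      then have "finite J" "u \<notin> J" using assms finite_subset by auto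
      then show "2 * (\<Sum>v\<in>insert u J. 1 + a v) - edges2 q (insert u J) =
        2 * (1 + a u) + 2 * (\<Sum>v\<in>J. 1 + a v) - edges2 q J - (\<Sum>x\<in>J. q u x + q x u)"
        by (simp add: edges2_insert algebra_simps)
    qed
    then show ?thesis by (simp add: Pow_insert image_Un)
  qed
  then show ?thesis
    unfolding cube_max_def by (simp only:) (rule Max_Un, use assms(1) in auto)
qed

text \<open>Adding the leaf \<open>u\<close> to \<open>J\<close> changes the value by 2 (1 + a u),
  minus 2 if its neighbour \<open>w\<close> is in \<open>J\<close>. For negative \<open>a u\<close>
  this is never a gain, otherwise never a loss; in the second case the loss at \<open>w\<close> is
  absorbed by lowering \<open>a w\<close> by one.\<close>

lemma cube_max_leaf:
  assumes fin: "finite I" and u: "u \<notin> I" and w: "q u w = 1" "q w u = 1"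
    and other: "\<And>x. x \<in> I \<Longrightarrow> x \<noteq> w \<Longrightarrow> q u x = 0 \<and> q x u = 0"
  shows "a u < 0 \<Longrightarrow> cube_max q a (insert u I) = cube_max q a I"
    and "0 \<le> a u \<Longrightarrow> cube_max q a (insert u I) = 2 * (1 + a u) + cube_max q (a(w := a w - 1)) I"
proof -
  have adj: "(\<Sum>x\<in>J. q u x + q x u) = (if w \<in> J then 2 else 0)" if J: "J \<subseteq> I" for J
  proof -
    have "(\<Sum>x\<in>J. q u x + q x u) = (\<Sum>x\<in>J. if x = w then 2 else 0)"
      using J w other by (intro sum.cong) auto
    then show ?thesis using finite_subset[OF J fin] by simp
  qed
  let ?f = "\<lambda>J. 2 * (\<Sum>v\<in>J. 1 + a v) - edges2 q J"
  let ?g = "\<lambda>J. 2 * (1 + a u) + 2 * (\<Sum>v\<in>J. 1 + a v) - edges2 q J - (\<Sum>x\<in>J. q u x + q x u)"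
  {
    assume au: "a u < 0"
    have "Max (?g ` Pow I) \<le> Max (?f ` Pow I)"
      using au fin by (intro Max_image_mono) (auto simp: adj)
    then show "cube_max q a (insert u I) = cube_max q a I"
      unfolding cube_max_insert[OF fin u] by (simp add: cube_max_def)
  }
  {
    assume au: "0 \<le> a u"
    have "Max (?f ` Pow I) \<le> Max (?g ` Pow I)"
      using au fin by (intro Max_image_mono) (auto simp: adj)
    moreover have "?g ` Pow I = (\<lambda>c. 2 * (1 + a u) + c) ` (\<lambda>J. 2 * (\<Sum>v\<in>J. 1 + (a(w := a w - 1)) v) - edges2 q J) ` Pow I"
      unfolding image_image
    proof (intro image_cong refl)
      fix J assume "J \<in> Pow I"
      then have J: "J \<subseteq> I" "finite J" using fin finite_subset by auto
      have "(\<Sum>v\<in>J. 1 + (a(w := a w - 1)) v) = (\<Sum>v\<in>J. (1 + a v) - (if v = w then 1 else 0))"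
        by (intro sum.cong) auto
      also have "\<dots> = (\<Sum>v\<in>J. 1 + a v) - (if w \<in> J then 1 else 0)"
        using J(2) by (simp add: sum_subtractf)
      finally show "?g J = 2 * (1 + a u) + (2 * (\<Sum>v\<in>J. 1 + (a(w := a w - 1)) v) - edges2 q J)"
        using adj[OF J(1)] by simp
    qed
    moreover have "Max ((\<lambda>c. 2 * (1 + a u) + c) ` (\<lambda>J. 2 * (\<Sum>v\<in>J. 1 + (a(w := a w - 1)) v) - edges2 q J) ` Pow I) =
      2 * (1 + a u) + cube_max q (a(w := a w - 1)) I"
      unfolding cube_max_def
      by (rule mono_Max_commute[symmetric]) (use fin in \<open>auto simp: mono_def\<close>)
    ultimately show "cube_max q a (insert u I) = 2 * (1 + a u) + cube_max q (a(w := a w - 1)) I"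
      unfolding cube_max_insert[OF fin u] by (simp add: cube_max_def)
  }
qed

lemma degree_in_insert:
  assumes "finite V" "u \<notin> V" "v \<in> V"
  shows "degree_in q (insert u V) v = degree_in q V v + q v u"
proof -
  have "insert u V - {v} = insert u (V - {v})" using assms by auto
  then show ?thesis using assms by (simp add: degree_in_def)
qed

text \<open>If \<open>a u\<close> is negative at the leaf, both sides vanish. Otherwise the left
  side is the difference of the sums for \<open>a\<close> and for \<open>a\<close> lowered at
  \<open>w\<close>, since the constant cancels in the alternating sum. On the right
  \<open>coeff_diff\<close> turns this difference into the factor of \<open>w\<close> with its new
  valency, and the leaf contributes the factor 1.\<close>

lemma tree_alternating_sum:
  assumes "tree q V"
  shows "of_int (\<Sum>I\<in>Pow V. (-1) ^ card I * cube_max q a I) =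
    - 2 * (\<Prod>v\<in>V. coeff (degree_in q V v - 2) (a v))"
  using assms
proof (induction arbitrary: a rule: tree.induct)
  case (single v)
  have P: "Pow {v} = {{}, {v}}" by auto
  have e: "cube_max q a {} = 0" by (simp add: cube_max_def edges2_def)
  have v: "cube_max q a {v} = max 0 (2 * (1 + a v))"
    using cube_max_insert[of "{}" v q a] e by (simp add: edges2_def)
  have c: "coeff (-2) (a v) = max 0 (1 + of_int (a v))"
  proof (cases "a v < 0")
    case True
    then have "1 + (of_int (a v) :: rat) \<le> 0"
      by (metis of_int_1 of_int_add of_int_le_0_iff add.commute zle_add1_eq_le zless_add1_eq add1_zle_eq)
    then show ?thesis using True by (simp add: coeff_neg)
  next
    case False
    then obtain n where "a v = int n" using zero_le_imp_eq_int[of "a v"] by auto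
    then show ?thesis using coeff_minus2[of n] by simp
  qed
  have "of_int (max 0 (2 * (1 + a v))) = 2 * max 0 (1 + (of_int (a v) :: rat))"
    by (auto simp: max_def) (simp_all flip: of_int_add of_int_1)?
  then show ?case by (simp add: P e v c degree_in_def)
next
  case (leaf V u w)
  note fV = tree_finite[OF leaf.hyps(1)] and neV = tree_nonempty[OF leaf.hyps(1)]
  define a' where "a' = a(w := a w - 1)"
  let ?S = "\<lambda>a. \<Sum>I\<in>Pow V. (-1) ^ card I * cube_max q a I"
  have du: "degree_in q (insert u V) u = 1"
  proof -
    have "insert u V - {u} = V" using leaf.hyps by auto
    then have "degree_in q (insert u V) u = (\<Sum>x\<in>V. if x = w then 1 else 0)"
      unfolding degree_in_def using leaf.hyps by (auto intro!: sum.cong)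
    then show ?thesis using fV leaf.hyps by simp
  qed
  have dw: "degree_in q (insert u V) w = degree_in q V w + 1"
    using degree_in_insert[OF fV leaf.hyps(2,3)] leaf.hyps by simp
  have dx: "degree_in q (insert u V) x = degree_in q V x" if "x \<in> V" "x \<noteq> w" for x
    using degree_in_insert[OF fV leaf.hyps(2) that(1)] leaf.hyps(6)[OF that] by simp
  have step: "(\<Sum>I\<in>Pow (insert u V). (-1) ^ card I * cube_max q a I) =
    (\<Sum>I\<in>Pow V. (-1) ^ card I * (cube_max q a I - cube_max q a (insert u I)))"
    unfolding sum_Pow_insert[OF fV leaf.hyps(2)]
  proof (rule sum.cong[OF refl])
    fix I assume "I \<in> Pow V"
    then have "finite I" "u \<notin> I" using fV leaf.hyps(2) finite_subset by auto
    then show "(-1) ^ card I * cube_max q a I + (-1) ^ card (insert u I) * cube_max q a (insert u I) =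
      (-1) ^ card I * (cube_max q a I - cube_max q a (insert u I))" by (simp add: algebra_simps)
  qed
  have lf: "a u < 0 \<Longrightarrow> cube_max q a (insert u I) = cube_max q a I"
    "0 \<le> a u \<Longrightarrow> cube_max q a (insert u I) = 2 * (1 + a u) + cube_max q a' I" if "I \<in> Pow V" for I
    using cube_max_leaf[of I u q w a] that fV leaf.hyps finite_subset[of I V] unfolding a'_def by auto
  show ?case
  proof (cases "a u < 0")
    case True
    then have "(\<Sum>I\<in>Pow (insert u V). (-1) ^ card I * cube_max q a I) = 0"
      unfolding step using lf(1) by (intro sum.neutral) auto
    moreover have "(\<Prod>v\<in>insert u V. coeff (degree_in q (insert u V) v - 2) (a v)) = 0"
      using True fV by (intro prod_zero) (auto simp: coeff_neg)
    ultimately show ?thesis by simp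
  next
    case False
    have "(\<Sum>I\<in>Pow V. (-1) ^ card I * (cube_max q a I - cube_max q a (insert u I))) =
      (\<Sum>I\<in>Pow V. (-1) ^ card I * cube_max q a I - (-1) ^ card I * cube_max q a' I - 2 * (1 + a u) * (-1) ^ card I)"
      using lf(2) False by (intro sum.cong) (auto simp: algebra_simps)
    also have "\<dots> = ?S a - ?S a' - 2 * (1 + a u) * (\<Sum>I\<in>Pow V. (-1) ^ card I)"
      by (simp add: sum_subtractf sum_distrib_left)
    also have "\<dots> = ?S a - ?S a'" by (simp add: alternating_sum_Pow[OF fV neV])
    finally have 1: "of_int (\<Sum>I\<in>Pow (insert u V). (-1) ^ card I * cube_max q a I) =
      - 2 * ((\<Prod>v\<in>V. coeff (degree_in q V v - 2) (a v)) - (\<Prod>v\<in>V. coeff (degree_in q V v - 2) (a' v)))"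
      unfolding step using leaf.IH[of a] leaf.IH[of a'] by simp
    have P: "(\<Prod>v\<in>V. f v) = f w * (\<Prod>v\<in>V - {w}. f v)" for f :: "'a \<Rightarrow> rat"
      by (rule prod.remove[OF fV leaf.hyps(3)])
    have "(\<Prod>v\<in>V - {w}. coeff (degree_in q V v - 2) (a' v)) = (\<Prod>v\<in>V - {w}. coeff (degree_in q V v - 2) (a v))"
      by (intro prod.cong) (auto simp: a'_def)
    then have "(\<Prod>v\<in>V. coeff (degree_in q V v - 2) (a v)) - (\<Prod>v\<in>V. coeff (degree_in q V v - 2) (a' v)) =
      (coeff (degree_in q V w - 2) (a w) - coeff (degree_in q V w - 2) (a w - 1)) *
      (\<Prod>v\<in>V - {w}. coeff (degree_in q V v - 2) (a v))"
      by (simp add: P a'_def left_diff_distrib)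
    also have "\<dots> = coeff (degree_in q (insert u V) w - 2) (a w) *
      (\<Prod>v\<in>V - {w}. coeff (degree_in q (insert u V) v - 2) (a v))"
      using coeff_diff[of "degree_in q V w - 2" "a w"] by (simp add: dw dx algebra_simps)
    also have "\<dots> = (\<Prod>v\<in>V. coeff (degree_in q (insert u V) v - 2) (a v))" by (simp add: P)
    also have "\<dots> = (\<Prod>v\<in>insert u V. coeff (degree_in q (insert u V) v - 2) (a v))"
    proof -
      obtain n where "a u = int n" using False zero_le_imp_eq_int[of "a u"] by auto
      then have "coeff (-1) (a u) = 1" by (simp add: coeff_minus1)
      then show ?thesis using fV leaf.hyps(2) by (simp add: du)
    qed
    finally show ?thesis using 1 by simp
  qed
qed

lemma tree_edges2:
  assumes "tree q V" "J \<subseteq> V" "J \<noteq> {}"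
  shows "edges2 q J < 2 * int (card J)"
  using assms
proof (induction arbitrary: J rule: tree.induct)
  case (single v)
  then have "J = {v}" by auto
  then show ?case by (simp add: edges2_def)
next
  case (leaf V u w)
  note fV = tree_finite[OF leaf.hyps(1)]
  show ?case
  proof (cases "u \<in> J")
    case False
    then show ?thesis using leaf.prems leaf.IH by blast
  next
    case True
    define J' where "J' = J - {u}"
    have J: "J = insert u J'" "u \<notin> J'" "J' \<subseteq> V" "finite J'"
      using True leaf.prems fV finite_subset[of J' V] by (auto simp: J'_def)
    have "(\<Sum>x\<in>J'. q u x + q x u) = (\<Sum>x\<in>J'. if x = w then 2 else 0)"
      using J leaf.hyps by (intro sum.cong) auto
    also have "\<dots> \<le> 2" using J(4) by simp
    finally have "edges2 q J \<le> edges2 q J' + 2" unfolding J(1) by (simp add: edges2_insert J)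
    moreover have "edges2 q J' < 2 * int (card J')" if "J' \<noteq> {}" using leaf.IH[OF J(3) that] .
    moreover have "edges2 q J = 0" if "J' = {}" using J that by (simp add: edges2_def)
    ultimately show ?thesis using J by (cases "J' = {}") auto
  qed
qed

section \<open>The counting function\<close>

text \<open>\<open>U\<close> is the set of directions in which cubes based at \<open>l\<close> may
  extend; inside a box it can be smaller than the vertex set.\<close>

definition alt_sum :: "'v res \<Rightarrow> 'v set \<Rightarrow> ('v \<Rightarrow> int) \<Rightarrow> int" where
  "alt_sum G U l = (\<Sum>I\<in>Pow U. (-1) ^ card I * wt G l I)"

text \<open>The coefficient z(l) in closed form: writing \<open>l\<close> in the dual basis
  determines the exponent at \<open>v\<close> as -(l, E_v).\<close>

definition zprod :: "'v res \<Rightarrow> ('v \<Rightarrow> int) \<Rightarrow> rat" where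
  "zprod G l = (\<Prod>v\<in>verts G. coeff (valency G v - 2) (- dot G l v))"

context plumbing
begin

lemma dot_reduced:
  assumes "J \<subseteq> V"
  shows "dot G (reduced J) u = (\<Sum>x\<in>J. inter G x u)"
proof -
  have "dot G (reduced J) u = (\<Sum>w\<in>V. if w \<in> J then inter G w u else 0)"
    unfolding dot_def by (intro sum.cong) (auto simp: reduced_def)
  also have "\<dots> = (\<Sum>x\<in>V \<inter> J. inter G x u)" using fin by (simp add: sum.inter_restrict)
  finally show ?thesis using assms by (simp add: Int_absorb1)
qed

lemma chi2_add_reduced:
  assumes "J \<subseteq> V" and pa: "\<And>u. u \<in> V \<Longrightarrow> pa G u = 0"
  shows "chi2 G (l + reduced J) = chi2 G l + (2 * (\<Sum>v\<in>J. 1 + - dot G l v) - edges2 (inter G) J)"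
proof -
  have "finite J" using assms(1) fin finite_subset by blast
  then show ?thesis
    using assms(1)
  proof (induction J)
    case empty
    then show ?case by (simp add: edges2_def)
  next
    case (insert u J)
    have "(\<Sum>x\<in>J. inter G u x + inter G x u) = 2 * dot G (reduced J) u"
    proof -
      have "inter G u x + inter G x u = 2 * inter G x u" if "x \<in> J" for x
        using that insert.prems sym[of u x] by auto
      then show ?thesis using insert.prems by (simp add: dot_reduced sum_distrib_left)
    qed
    moreover have "chi2 G (l + reduced (insert u J)) = chi2 G (l + reduced J) + 2 * (1 - dot G (l + reduced J) u)"
      using chi2_step[of u "l + reduced J"] insert.prems pa insert.hyps(2)
      by (simp add: reduced_insert add.assoc)
    moreover have "edges2 (inter G) (insert u J) = edges2 (inter G) J + (\<Sum>x\<in>J. inter G u x + inter G x u)"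
      using insert.hyps by (rule edges2_insert)
    moreover have "(\<Sum>v\<in>insert u J. 1 + - dot G l v) = 1 - dot G l u + (\<Sum>v\<in>J. 1 + - dot G l v)"
      using insert.hyps by simp
    moreover have "chi2 G (l + reduced J) = chi2 G l + (2 * (\<Sum>v\<in>J. 1 + - dot G l v) - edges2 (inter G) J)"
      using insert.IH insert.prems by blast
    ultimately show ?case unfolding dot_add by algebra
  qed
qed

lemma wt_cube_max:
  assumes I: "I \<subseteq> V" and pa: "\<And>u. u \<in> V \<Longrightarrow> pa G u = 0"
  shows "wt G l I = chi2 G l + cube_max (inter G) (\<lambda>v. - dot G l v) I"
proof -
  let ?f = "\<lambda>J. 2 * (\<Sum>v\<in>J. 1 + - dot G l v) - edges2 (inter G) J"
  have fI: "finite (Pow I)" using I fin finite_subset by blast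
  have "wt G l I = Max ((\<lambda>c. chi2 G l + c) ` ?f ` Pow I)"
    unfolding wt_def image_image using chi2_add_reduced[OF _ pa] I
    by (intro arg_cong[where f = Max] image_cong) auto
  also have "\<dots> = chi2 G l + Max (?f ` Pow I)"
    by (rule mono_Max_commute[symmetric]) (use fI in \<open>auto simp: mono_def\<close>)
  finally show ?thesis by (simp add: cube_max_def)
qed

text \<open>The base value \<open>chi2 G l\<close> is multiplied by an alternating sum of signs,
  which is zero. What is left is \<open>tree_alternating_sum\<close>.\<close>

lemma zprod_alternating_sum:
  assumes tr: "tree (inter G) V" and pa: "\<And>u. u \<in> V \<Longrightarrow> pa G u = 0"
  shows "of_int (alt_sum G V l) = - 2 * zprod G l"
proof -
  have "alt_sum G V l =
    (\<Sum>I\<in>Pow V. chi2 G l * (-1) ^ card I + (-1) ^ card I * cube_max (inter G) (\<lambda>v. - dot G l v) I)"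
    unfolding alt_sum_def using wt_cube_max[OF _ pa] by (intro sum.cong) (auto simp: algebra_simps)
  also have "\<dots> = (\<Sum>I\<in>Pow V. (-1) ^ card I * cube_max (inter G) (\<lambda>v. - dot G l v) I)"
    using alternating_sum_Pow[OF fin tree_nonempty[OF tr], where 'a = int]
    by (simp add: sum.distrib flip: sum_distrib_left)
  finally show ?thesis
    using tree_alternating_sum[OF tr] by (simp add: zprod_def valency_def degree_in_def)
qed

text \<open>\<chi> of a reduced cycle is the number of its curves minus the number of edges among
  them.\<close>

lemma reduced_chi2_pos:
  assumes tr: "tree (inter G) V" and pa: "\<And>u. u \<in> V \<Longrightarrow> pa G u = 0"
    and J: "J \<subseteq> V" "J \<noteq> {}"
  shows "0 < chi2 G (reduced J)"
  using tree_edges2[OF tr J] chi2_add_reduced[OF J(1) pa, of 0] by simp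

text \<open>Cubes with and without direction \<open>w\<close> have equal weight and opposite
  sign.\<close>

lemma wt_alternating_zero:
  assumes U: "U \<subseteq> V" and w: "w \<in> U" and pa: "\<And>u. u \<in> V \<Longrightarrow> pa G u = 0"
    and d: "0 < dot G l w"
  shows "alt_sum G U l = 0"
proof -
  have fU: "finite U" using U fin finite_subset by blast
  have "(\<Sum>I\<in>Pow (insert w (U - {w})). (-1) ^ card I * wt G l I) = 0"
  proof (subst sum_Pow_insert)
    show "(\<Sum>I\<in>Pow (U - {w}). (-1) ^ card I * wt G l I + (-1) ^ card (insert w I) * wt G l (insert w I)) = 0"
    proof (rule sum.neutral, rule ballI)
      fix I assume I: "I \<in> Pow (U - {w})"
      then have "finite I" "w \<notin> I" using fU finite_subset by auto
      moreover have "wt G l (insert w I) = wt G l I"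
        using I U w d pa by (intro wt_insert_up) auto
      ultimately show "(-1) ^ card I * wt G l I + (-1) ^ card (insert w I) * wt G l (insert w I) = 0"
        by simp
    qed
  qed (use fU in auto)
  then show ?thesis using w by (simp add: alt_sum_def insert_absorb)
qed

lemma zprod_eq_zero:
  assumes "w \<in> V" "0 < dot G l w"
  shows "zprod G l = 0"
  unfolding zprod_def using assms fin by (intro prod_zero) (auto intro!: bexI[of _ w] simp: coeff_neg)

text \<open>Outside the region \<open>l w \<ge> n\<close> an antinef cycle drops along an edge at most by a factor
  depending on the self-intersections, so one large coefficient makes all coefficients large.\<close>

lemma large_coefficient:
  fixes K :: int
  assumes con: "cut_connected G"
  obtains n0 where "\<And>n l v w. n0 \<le> n \<Longrightarrow> l \<in> cyc G \<Longrightarrow> 0 \<le> l \<Longrightarrow> v \<in> V \<Longrightarrow> n \<le> l v \<Longrightarrow>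
    (\<And>w. w \<in> V \<Longrightarrow> l w < n \<Longrightarrow> dot G l w \<le> 0) \<Longrightarrow> w \<in> V \<Longrightarrow> K \<le> l w"
proof -
  \<comment> \<open>If (l, E_x) \<le> 0, a neighbour of \<open>x\<close> has coefficient at most
    -(E_x, E_x) times that of \<open>x\<close>; \<open>M\<close> is a common bound for this
    factor.\<close>
  define M where "M = 1 + (\<Sum>w\<in>V. \<bar>inter G w w\<bar>)"
  have M1: "1 \<le> M" by (simp add: M_def sum_nonneg)
  have M: "- inter G w w \<le> M" if "w \<in> V" for w
  proof -
    have "\<bar>inter G w w\<bar> \<le> (\<Sum>w\<in>V. \<bar>inter G w w\<bar>)" using that fin by (intro member_le_sum) auto
    then show ?thesis by (simp add: M_def)
  qed
  define c where "c = card V"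
  show ?thesis
  proof (rule that[of "M ^ c * K"])
    fix n l v w
    assume n: "M ^ c * K \<le> n" and l: "l \<in> cyc G" "0 \<le> l" and v: "v \<in> V" "n \<le> l v"
      and neg: "\<And>w. w \<in> V \<Longrightarrow> l w < n \<Longrightarrow> dot G l w \<le> 0" and w: "w \<in> V"
    have l0: "0 \<le> l x" for x using le_funD[OF l(2), of x] by simp
    \<comment> \<open>The curves reached with a loss of at most \<open>M ^ k\<close>. Until all
      curves are reached, an edge leaving this set enlarges it, so \<open>card V\<close> rounds
      suffice; this explains the threshold \<open>M ^ c * K\<close>.\<close>
    define A where "A k = {w\<in>V. n \<le> l w * M ^ k}" for k
    have A: "A k = V \<or> k + 1 \<le> card (A k)" for k
    proof (induction k)
      case 0
      have "{v} \<subseteq> A 0" using v by (simp add: A_def)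
      then have "card {v} \<le> card (A 0)" using fin by (intro card_mono) (auto simp: A_def)
      then show ?case by simp
    next
      case (Suc k)
      have mono: "A k \<subseteq> A (Suc k)"
      proof
        fix x assume x: "x \<in> A k"
        have "l x * M ^ k \<le> l x * M ^ Suc k"
          using M1 l0 by (intro mult_left_mono power_increasing) auto
        then show "x \<in> A (Suc k)" using x by (auto simp: A_def)
      qed
      show ?case
      proof (cases "A k = V")
        case True
        then show ?thesis using mono by (auto simp: A_def)
      next
        case False
        then have k: "k + 1 \<le> card (A k)" using Suc by blast
        then have "A k \<noteq> {}" by auto
        moreover have "A k \<subseteq> V" by (auto simp: A_def)
        ultimately obtain u x where ux: "u \<in> A k" "x \<in> V" "x \<notin> A k" "0 < inter G u x"
          using False cut_connectedD[OF con, of "A k"] by metis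
        have uV: "u \<in> V" and un: "n \<le> l u * M ^ k" using ux(1) by (auto simp: A_def)
        have xn: "l x * M ^ k < n" using ux(2,3) by (auto simp: A_def)
        have "l x * 1 \<le> l x * M ^ k" using M1 l0 by (intro mult_left_mono) auto
        then have d: "dot G l x \<le> 0" using neg[OF ux(2)] xn by simp
        have "l u * inter G u x \<le> (\<Sum>y\<in>V - {x}. l y * inter G y x)"
        proof (rule member_le_sum)
          show "u \<in> V - {x}" using uV ux by auto
          fix y assume "y \<in> V - {x} - {u}"
          then show "0 \<le> l y * inter G y x" using l0 inter_nonneg[of y x] ux(2) by auto
        qed (use fin in simp)
        moreover have "dot G l x = l x * inter G x x + (\<Sum>y\<in>V - {x}. l y * inter G y x)"
          unfolding dot_def of_int_eq_id id_apply by (rule sum.remove[OF fin ux(2)])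
        moreover have "l u * 1 \<le> l u * inter G u x" using ux(4) l0 by (intro mult_left_mono) auto
        moreover have "l x * (- inter G x x) \<le> l x * M" using M[OF ux(2)] l0 by (intro mult_left_mono)
        ultimately have "l u \<le> l x * M" using d by simp
        then have "l u * M ^ k \<le> l x * M * M ^ k" using M1 by (intro mult_right_mono) auto
        then have "x \<in> A (Suc k)" using un ux(2) by (simp add: A_def mult.assoc)
        then have "insert x (A k) \<subseteq> A (Suc k)" using mono by simp
        then have "card (insert x (A k)) \<le> card (A (Suc k))" using fin by (intro card_mono) (auto simp: A_def)
        moreover have "card (insert x (A k)) = Suc (card (A k))"
          using ux(3) fin by (intro card_insert_disjoint) (auto simp: A_def)
        ultimately show ?thesis using k by simp
      qed
    qed
    have "card (A c) \<le> c" unfolding c_def using fin by (intro card_mono) (auto simp: A_def)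
    then have "A c = V" using A[of c] by simp
    then have "n \<le> l w * M ^ c" using w unfolding A_def by blast
    then have "M ^ c * K \<le> M ^ c * l w" using n by (simp add: mult.commute)
    then show "K \<le> l w" using M1 by (simp add: mult_le_cancel_left)
  qed
qed

text \<open>The cubes of [0, Y] that are not in [y, Y] are those whose base point is not above
  \<open>y\<close>. Grouped by base point they give alternating sums, each equal to -2 z(l); the box
  [y, Y] retracts to \<open>y\<close> and [0, Y] has the value -2 (m + 1).\<close>

lemma zprod_sum:
  assumes con: "cut_connected G" and tr: "tree (inter G) V"
    and pa: "\<And>u. u \<in> V \<Longrightarrow> pa G u = 0" and base: "elliptic_base G"
    and ch: "elliptic_chain G N x m"
    and y: "y \<in> cyc G" "0 \<le> y" and ret: "retractable G y"
  shows "(\<Sum>l\<in>{l\<in>cyc G. \<not> y \<le> l \<and> zprod G l \<noteq> 0}. zprod G l) = of_int (chi2 G y) / 2 + of_nat (m + 1)"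
proof -
  obtain v where ess: "essential_vertex G v"
    using elliptic_vertex[OF con base reduced_chi2_pos[OF tr pa]] by metis
  have Nc: "N \<in> cyc G" using ch by (simp add: elliptic_chain_def canon_max_def)
  \<comment> \<open>A bound for \<open>y\<close> and \<open>N\<close>: the corner \<open>Y\<close>
    of constant height at least \<open>K\<close> then lies above both.\<close>
  define K where "K = (\<Sum>w\<in>V. \<bar>y w\<bar> + \<bar>N w\<bar>)"
  have K0: "0 \<le> K" by (simp add: K_def sum_nonneg)
  have K: "y w \<le> K" "N w \<le> K" if "w \<in> V" for w
  proof -
    have "\<bar>y w\<bar> + \<bar>N w\<bar> \<le> K" unfolding K_def using that fin by (intro member_le_sum) auto
    then show "y w \<le> K" "N w \<le> K" by linarith+
  qed
  obtain n0 where n0: "\<And>n l v w. n0 \<le> n \<Longrightarrow> l \<in> cyc G \<Longrightarrow> 0 \<le> l \<Longrightarrow> v \<in> V \<Longrightarrow> n \<le> l v \<Longrightarrow>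
    (\<And>w. w \<in> V \<Longrightarrow> l w < n \<Longrightarrow> dot G l w \<le> 0) \<Longrightarrow> w \<in> V \<Longrightarrow> K \<le> l w"
    using large_coefficient[OF con, of K] by metis
  define n where "n = max n0 K"
  \<comment> \<open>Otherwise \<open>large_coefficient\<close> would lift all coefficients of
    \<open>l\<close> to \<open>K\<close>, and \<open>l\<close> would lie above
    \<open>y\<close>.\<close>
  have large: "\<exists>w\<in>V. l w < n \<and> 0 < dot G l w"
    if "l \<in> cyc G" "0 \<le> l" "\<not> y \<le> l" "u \<in> V" "n \<le> l u" for l u
  proof (rule ccontr)
    assume "\<not> ?thesis"
    then have "K \<le> l w" if "w \<in> V" for w
      using that \<open>l \<in> cyc G\<close> \<open>0 \<le> l\<close> \<open>u \<in> V\<close> \<open>n \<le> l u\<close> by (intro n0[of n l u]) (auto simp: n_def not_less)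
    then have "y w \<le> l w" for w
      using K(1)[of w] y(1) \<open>l \<in> cyc G\<close> by (cases "w \<in> V") (auto simp: cyc_def intro: order_trans)
    then show False using that(3) by (simp add: le_fun_def)
  qed
  define Y where "Y = (\<lambda>w. if w \<in> V then n else 0)"
  have nK: "K \<le> n" by (simp add: n_def)
  have Y: "Y \<in> cyc G" "0 \<le> Y" "N \<le> Y" "y \<le> Y"
  proof -
    show "Y \<in> cyc G" by (simp add: Y_def cyc_def)
    show "0 \<le> Y" using K0 nK by (simp add: Y_def le_fun_def)
    show "N \<le> Y" using K nK Nc by (auto simp: Y_def le_fun_def cyc_def intro: order_trans)
    show "y \<le> Y" using K nK y(1) by (auto simp: Y_def le_fun_def cyc_def intro: order_trans)
  qed
  define R where "R = {l. 0 \<le> l \<and> l \<le> Y \<and> \<not> y \<le> l}"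
  have Rc: "l \<in> cyc G" if "l \<in> R" for l
    unfolding cyc_def
  proof (intro CollectI allI impI)
    fix u assume "u \<notin> V"
    then have "Y u = 0" by (simp add: Y_def)
    moreover have "0 \<le> l u" "l u \<le> Y u" using that by (auto simp: R_def le_fun_def)
    ultimately show "l u = 0" by simp
  qed
  have finR: "finite R"
  proof (rule finite_subset)
    show "R \<subseteq> {l. 0 \<le> l \<and> l \<le> Y}" by (auto simp: R_def)
    show "finite {l. 0 \<le> l \<and> l \<le> Y}" using fin by (rule finite_box) (simp add: Y_def)
  qed
  define U where "U l = {w\<in>V. l w < n}" for l
  let ?t = "\<lambda>(l, I). (-1) ^ card I * wt G l I"
  have split: "cubes V 0 Y = cubes V y Y \<union> (SIGMA l:R. Pow (U l))"
  proof (intro equalityI subsetI)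
    fix c assume "c \<in> cubes V 0 Y"
    then obtain l I where c: "c = (l, I)" "(l, I) \<in> cubes V 0 Y" by (cases c) auto
    note d = cubesD[OF c(2)]
    show "c \<in> cubes V y Y \<union> (SIGMA l:R. Pow (U l))"
    proof (cases "y \<le> l")
      case True
      then show ?thesis using c d by (simp add: cubes_def)
    next
      case False
      have "I \<subseteq> U l"
      proof
        fix w assume "w \<in> I"
        then have "l w + 1 \<le> Y w" using le_funD[OF d(4), of w] by (simp add: reduced_def)
        then show "w \<in> U l" using \<open>w \<in> I\<close> d(1) by (auto simp: U_def Y_def)
      qed
      then show ?thesis using False c d by (simp add: R_def)
    qed
  next
    fix c assume c: "c \<in> cubes V y Y \<union> (SIGMA l:R. Pow (U l))"
    then show "c \<in> cubes V 0 Y"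
    proof
      assume "c \<in> cubes V y Y"
      then show ?thesis using order_trans[OF y(2)] by (auto simp: cubes_def)
    next
      assume "c \<in> (SIGMA l:R. Pow (U l))"
      then obtain l I where c: "c = (l, I)" "l \<in> R" "I \<subseteq> U l" by auto
      have "l + reduced I \<le> Y"
      proof (rule le_funI)
        fix w have "l w \<le> Y w" using c(2) by (simp add: R_def le_fun_def)
        then show "(l + reduced I) w \<le> Y w" using c(3) by (auto simp: reduced_def U_def Y_def)
      qed
      then show ?thesis using c by (auto simp: cubes_def R_def U_def)
    qed
  qed
  have disj: "cubes V y Y \<inter> (SIGMA l:R. Pow (U l)) = {}" by (auto simp: cubes_def R_def)
  have finU: "finite (U l)" for l using fin by (simp add: U_def)
  have "sum ?t (cubes V 0 Y) = sum ?t (cubes V y Y) + sum ?t (SIGMA l:R. Pow (U l))"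
    unfolding split using disj finite_cubes[OF fin, of y Y] finR finU y(1) Y(1)
    by (intro sum.union_disjoint) (auto simp: cyc_def)
  then have "weu 0 Y = weu y Y + (\<Sum>l\<in>R. alt_sum G (U l) l)"
    unfolding eu_def alt_sum_def using finR finU by (subst sum.Sigma) auto
  \<comment> \<open>The box cuts off directions where \<open>l\<close> has reached height
    \<open>n\<close>. In that case \<open>large\<close> gives a direction in \<open>U l\<close>
    along which \<chi> does not increase, and both alternating sums vanish.\<close>
  also have "(\<Sum>l\<in>R. alt_sum G (U l) l) = (\<Sum>l\<in>R. alt_sum G V l)"
  proof (rule sum.cong[OF refl])
    fix l assume l: "l \<in> R"
    show "alt_sum G (U l) l = alt_sum G V l"
    proof (cases "U l = V")
      case False
      then have "\<exists>u\<in>V. \<not> l u < n" unfolding U_def by blast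
      then obtain u where "u \<in> V" "n \<le> l u" by (auto simp: not_less)
      then obtain w where w: "w \<in> V" "l w < n" "0 < dot G l w"
        using large[OF Rc[OF l]] l by (auto simp: R_def)
      then have "alt_sum G (U l) l = 0"
        by (intro wt_alternating_zero[OF _ _ pa]) (auto simp: U_def)
      moreover have "alt_sum G V l = 0"
        using w by (intro wt_alternating_zero[OF _ _ pa]) auto
      ultimately show ?thesis by simp
    qed simp
  qed
  finally have e: "weu 0 Y = weu y Y + (\<Sum>l\<in>R. alt_sum G V l)" .
  have e0: "weu 0 Y = - 2 * int (m + 1)"
    by (rule eu_elliptic_chain[OF ch pa ess Y(1,2,3)])
  have ey: "weu y Y = chi2 G y"
    using eu_retract[OF y(1) y(1) ret order_refl Y(4,1)] by (simp add: eu_point)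
  have "(of_int (\<Sum>l\<in>R. alt_sum G V l) :: rat) = (\<Sum>l\<in>R. - 2 * zprod G l)"
    unfolding of_int_sum[of _ R] by (intro sum.cong refl zprod_alternating_sum[OF tr pa])
  also have "\<dots> = - 2 * (\<Sum>l\<in>R. zprod G l)" by (simp add: sum_distrib_left)
  finally have s: "(of_int (\<Sum>l\<in>R. alt_sum G V l) :: rat) = - 2 * (\<Sum>l\<in>R. zprod G l)" .
  have "(\<Sum>l\<in>R. alt_sum G V l) = - 2 * int (m + 1) - chi2 G y"
    using e e0 ey by simp
  then have r: "(\<Sum>l\<in>R. zprod G l) = of_int (chi2 G y) / 2 + of_nat (m + 1)"
    using s by simp
  \<comment> \<open>A nonzero coefficient forces \<open>l\<close> to be antinef, hence effective,
    and \<open>large\<close> then keeps it below \<open>Y\<close>. So \<open>R\<close> contains all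
    nonzero terms.\<close>
  have "(\<Sum>l\<in>{l\<in>cyc G. \<not> y \<le> l \<and> zprod G l \<noteq> 0}. zprod G l) = (\<Sum>l\<in>R. zprod G l)"
  proof (rule sum.mono_neutral_left[OF finR])
    show "{l\<in>cyc G. \<not> y \<le> l \<and> zprod G l \<noteq> 0} \<subseteq> R"
    proof
      fix l assume l: "l \<in> {l\<in>cyc G. \<not> y \<le> l \<and> zprod G l \<noteq> 0}"
      then have neg: "dot G l w \<le> 0" if "w \<in> V" for w
        using zprod_eq_zero[OF that, of l] by (auto simp: not_less[symmetric])
      have l0: "0 \<le> l" using l neg by (intro antinef_nonneg) auto
      have "l w \<le> Y w" for w
      proof (cases "w \<in> V")
        case True
        have "\<not> n \<le> l w"
        proof
          assume "n \<le> l w"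
          then obtain u where "u \<in> V" "0 < dot G l u" using large[of l w] l l0 True by auto
          then show False using neg[of u] by simp
        qed
        then show ?thesis using True by (simp add: Y_def)
      next
        case False
        then show ?thesis using l by (simp add: Y_def cyc_def)
      qed
      then show "l \<in> R" using l l0 by (simp add: R_def le_fun_def)
    qed
    show "\<forall>l\<in>R - {l \<in> cyc G. \<not> y \<le> l \<and> zprod G l \<noteq> 0}. zprod G l = 0"
      using Rc by (auto simp: R_def)
  qed
  with r show ?thesis by simp
qed

text \<open>Negative definiteness gives a curve of \<open>l\<close> with (l, E_u) < 0. The depth
  required of \<open>y\<close> is exactly what compensates for subtracting E_u.\<close>

lemma deep_retractable:
  assumes pa: "\<And>u. u \<in> V \<Longrightarrow> pa G u = 0" and "y \<in> cyc G"
    and deep: "\<And>u. u \<in> V \<Longrightarrow> dot G y u \<le> inter G u u"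
  shows "retractable G y" "0 \<le> y"
proof -
  show "0 \<le> y"
  proof (rule antinef_nonneg[OF assms(2)])
    fix v assume "v \<in> V" then show "dot G y v \<le> 0" using deep[of v] inter_self_neg[of v] by simp
  qed
  show "retractable G y"
    unfolding retractable_def
  proof (intro ballI impI)
    fix l assume l: "l \<in> cyc G" "0 \<le> l" "l \<noteq> 0"
    have "\<exists>u\<in>V. 0 < l u \<and> dot G l u < 0"
    proof (rule ccontr)
      assume neg: "\<not> ?thesis"
      have "0 \<le> l u * dot G l u" if "u \<in> V" for u
        using neg that le_funD[OF l(2), of u] by (cases "l u = 0") (force simp: not_less)+
      then have "0 \<le> (\<Sum>u\<in>V. l u * dot G l u)" by (intro sum_nonneg)
      then show False using negdef_int[OF l(1,3)] by simp
    qed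
    then obtain u where u: "u \<in> V" "0 < l u" "dot G l u < 0" by blast
    then have "dot G (y + l - ei u) u \<le> 1 - int (pa G u)"
      using deep[of u] pa[of u] by (simp add: dot_add dot_diff dot_ei)
    then show "\<exists>u\<in>V. 0 < l u \<and> dot G (y + l - ei u) u \<le> 1 - int (pa G u)" using u by blast
  qed
qed

end

section \<open>Rational cycles\<close>

text \<open>Gaussian elimination: removing \<open>v0\<close> replaces \<open>q\<close> by its Schur
  complement \<open>q'\<close>, which is again negative definite.\<close>

lemma negative_definite_solvable:
  fixes q :: "'v \<Rightarrow> 'v \<Rightarrow> rat"
  assumes "finite V" "\<And>u w. u \<in> V \<Longrightarrow> w \<in> V \<Longrightarrow> q u w = q w u"
    and "\<And>x. \<exists>v\<in>V. x v \<noteq> 0 \<Longrightarrow> (\<Sum>u\<in>V. \<Sum>w\<in>V. x u * x w * q u w) < 0"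
  shows "\<exists>x. \<forall>v\<in>V. (\<Sum>w\<in>V. x w * q w v) = b v"
  using assms
proof (induction V arbitrary: q b rule: finite_induct)
  case (insert v0 W)
  note sym = insert.prems(1) and neg = insert.prems(2)
  define d where "d = q v0 v0"
  have c: "(\<Sum>w\<in>insert v0 W. curve v0 w * f w) = f v0" for f :: "'v \<Rightarrow> rat"
  proof -
    have "(\<Sum>w\<in>W. curve v0 w * f w) = 0"
      using insert.hyps(2) by (intro sum.neutral) (auto simp: curve_def)
    then show ?thesis using insert.hyps by (simp add: curve_def)
  qed
  have "(\<Sum>u\<in>insert v0 W. \<Sum>w\<in>insert v0 W. curve v0 u * curve v0 w * q u w) < 0"
    by (rule neg) (simp add: curve_def)
  then have d: "d < 0" unfolding mult.assoc sum_distrib_left[symmetric] c d_def .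
  define q' where "q' u w = q u w - q u v0 * q v0 w / d" for u w
  have "\<exists>x. \<forall>v\<in>W. (\<Sum>w\<in>W. x w * q' w v) = b v - q v0 v * b v0 / d"
  proof (rule insert.IH)
    show "q' u w = q' w u" if "u \<in> W" "w \<in> W" for u w
      using that sym[of u w] sym[of u v0] sym[of w v0] by (simp add: q'_def)
    fix x :: "'v \<Rightarrow> rat" assume x: "\<exists>v\<in>W. x v \<noteq> 0"
    define S where "S = (\<Sum>w\<in>W. x w * q w v0)"
    \<comment> \<open>This coefficient at \<open>v0\<close> makes the extended vector orthogonal to
      \<open>v0\<close>, so that the form of \<open>q\<close> on it equals the form of
      \<open>q'\<close> on \<open>x\<close>.\<close>
    define t where "t = - S / d"
    define y where "y = x(v0 := t)"
    have yW: "y w = x w" if "w \<in> W" for w using that insert.hyps by (auto simp: y_def)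
    have S': "(\<Sum>w\<in>W. x w * q v0 w) = S"
      unfolding S_def using sym by (intro sum.cong) auto
    have "(\<Sum>u\<in>insert v0 W. \<Sum>w\<in>insert v0 W. y u * y w * q u w) =
      (t * t * d + t * S) + (\<Sum>u\<in>W. x u * t * q u v0 + (\<Sum>w\<in>W. x u * x w * q u w))"
    proof -
      have "(\<Sum>w\<in>insert v0 W. y v0 * y w * q v0 w) = t * t * d + t * S"
        using insert.hyps yW by (simp add: y_def d_def flip: S') (auto simp: sum_distrib_left mult.assoc intro!: sum.cong)
      moreover have "(\<Sum>u\<in>W. \<Sum>w\<in>insert v0 W. y u * y w * q u w) =
        (\<Sum>u\<in>W. x u * t * q u v0 + (\<Sum>w\<in>W. x u * x w * q u w))"
        using insert.hyps yW by (intro sum.cong) (auto simp: y_def intro!: sum.cong)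
      ultimately show ?thesis using insert.hyps by simp
    qed
    also have "\<dots> = t * t * d + 2 * t * S + (\<Sum>u\<in>W. \<Sum>w\<in>W. x u * x w * q u w)"
      by (simp add: sum.distrib S_def sum_distrib_left algebra_simps)
    also have "t * t * d + 2 * t * S = - (S * S / d)" using d by (simp add: t_def field_simps)
    also have "\<dots> = - (\<Sum>u\<in>W. \<Sum>w\<in>W. x u * x w * (q u v0 * q v0 w / d))"
    proof -
      have "S * S / d = (\<Sum>u\<in>W. x u * q u v0) * (\<Sum>w\<in>W. x w * q v0 w) / d" by (simp only: S' flip: S_def)
      also have "\<dots> = (\<Sum>u\<in>W. \<Sum>w\<in>W. x u * q u v0 * (x w * q v0 w) / d)"
        by (simp add: sum_product sum_divide_distrib)
      finally show ?thesis by (simp add: mult_ac)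
    qed
    also have "\<dots> + (\<Sum>u\<in>W. \<Sum>w\<in>W. x u * x w * q u w) = (\<Sum>u\<in>W. \<Sum>w\<in>W. x u * x w * q' u w)"
      by (simp add: q'_def right_diff_distrib sum_subtractf)
    finally have "(\<Sum>u\<in>insert v0 W. \<Sum>w\<in>insert v0 W. y u * y w * q u w) = (\<Sum>u\<in>W. \<Sum>w\<in>W. x u * x w * q' u w)" .
    moreover have "\<exists>v\<in>insert v0 W. y v \<noteq> 0" using x yW by auto
    ultimately show "(\<Sum>u\<in>W. \<Sum>w\<in>W. x u * x w * q' u w) < 0" using neg[of y] by simp
  qed
  then obtain x where x: "\<And>v. v \<in> W \<Longrightarrow> (\<Sum>w\<in>W. x w * q' w v) = b v - q v0 v * b v0 / d" by blast
  define S where "S = (\<Sum>w\<in>W. x w * q w v0)"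
  define y where "y = x(v0 := (b v0 - S) / d)"
  have y: "(\<Sum>w\<in>insert v0 W. y w * q w v) = (b v0 - S) / d * q v0 v + (\<Sum>w\<in>W. x w * q w v)" for v
  proof -
    have "(\<Sum>w\<in>W. y w * q w v) = (\<Sum>w\<in>W. x w * q w v)"
      using insert.hyps(2) by (intro sum.cong) (auto simp: y_def)
    then show ?thesis using insert.hyps by (simp add: y_def)
  qed
  have "(\<Sum>w\<in>insert v0 W. y w * q w v) = b v" if "v \<in> insert v0 W" for v
  proof (cases "v = v0")
    case True
    then show ?thesis using d by (simp add: y flip: S_def d_def)
  next
    case False
    then have v: "v \<in> W" using that by simp
    have "(\<Sum>w\<in>W. x w * q' w v) = (\<Sum>w\<in>W. x w * q w v) - S * q v0 v / d"
      by (simp add: q'_def S_def right_diff_distrib sum_subtractf sum_distrib_right sum_divide_distrib mult.assoc)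
    with x[OF v] have "(\<Sum>w\<in>W. x w * q w v) = b v - q v0 v * b v0 / d + S * q v0 v / d" by simp
    then show ?thesis unfolding y using d by (simp add: field_simps)
  qed
  then show ?case by blast
qed simp

lemma common_denominator:
  fixes z :: "'v \<Rightarrow> rat"
  assumes "finite V"
  shows "\<exists>D::int. 0 < D \<and> (\<forall>v\<in>V. \<exists>k. of_int D * z v = of_int k)"
  using assms
proof (induction V rule: finite_induct)
  case empty
  then show ?case by (intro exI[of _ 1]) simp
next
  case (insert u V)
  then obtain D where D: "0 < D" "\<And>v. v \<in> V \<Longrightarrow> \<exists>k. of_int D * z v = of_int k" by blast
  obtain p r where pr: "0 < r" "z u = Fract p r" by (cases "z u") auto
  show ?case
  proof (rule exI[of _ "D * r"], intro conjI ballI)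
    show "0 < D * r" using D pr by simp
    fix v assume "v \<in> insert u V"
    then consider "v = u" | "v \<in> V" by blast
    then show "\<exists>k. of_int (D * r) * z v = of_int k"
    proof cases
      case 1
      have "of_int (D * r) * z v = of_int (D * p)"
        unfolding 1 pr(2) using pr(1) by (simp add: Fract_of_int_quotient)
      then show ?thesis by blast
    next
      case 2
      then obtain k where "of_int D * z v = of_int k" using D by blast
      then have "of_int (D * r) * z v = of_int (r * k)" by (simp add: mult_ac)
      then show ?thesis by blast
    qed
  qed
qed

abbreviation rat_cycle :: "('v \<Rightarrow> int) \<Rightarrow> 'v \<Rightarrow> rat" where
  "rat_cycle a \<equiv> (\<lambda>v. of_int (a v))"

lemma lat_eq: "lat G = rat_cycle ` cyc G"
proof (intro equalityI subsetI)
  fix l assume l: "l \<in> lat G"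
  define a where "a v = \<lfloor>l v\<rfloor>" for v
  have z: "l v = 0" if "v \<notin> verts G" for v
    using l that by (auto simp: lat_def rat_cycles_def supp_def)
  have "l v = of_int (a v)" for v
    using l z[of v] by (cases "v \<in> verts G") (auto simp: lat_def a_def elim: Ints_cases)
  then have "l = rat_cycle a" by auto
  moreover have "a \<in> cyc G" using z by (simp add: cyc_def a_def)
  ultimately show "l \<in> rat_cycle ` cyc G" by blast
qed (auto simp: lat_def cyc_def rat_cycles_def supp_def)

lemma rat_cycle_le: "rat_cycle a \<le> rat_cycle b \<longleftrightarrow> a \<le> b"
  by (simp add: le_fun_def)

lemma inj_rat_cycle: "inj rat_cycle"
  by (auto simp: inj_def fun_eq_iff)

context plumbing
begin

lemma rational_solution:
  obtains z :: "'v \<Rightarrow> rat" where "\<And>v. v \<notin> V \<Longrightarrow> z v = 0" "\<And>v. v \<in> V \<Longrightarrow> dot G z v = b v"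
proof -
  have "\<exists>x. \<forall>v\<in>V. (\<Sum>w\<in>V. x w * (of_int (inter G w v) :: rat)) = b v"
  proof (rule negative_definite_solvable[OF fin])
    show "of_int (inter G u w) = (of_int (inter G w u) :: rat)" if "u \<in> V" "w \<in> V" for u w
      using sym that by simp
    fix x :: "'v \<Rightarrow> rat" assume x: "\<exists>v\<in>V. x v \<noteq> 0"
    define y where "y v = (if v \<in> V then x v else 0)" for v
    have "y \<noteq> 0" using x by (auto simp: y_def fun_eq_iff)
    then have "(\<Sum>u\<in>V. y u * dot G y u) < 0" by (intro negdef_rat[of y]) (simp add: y_def)
    also have "(\<Sum>u\<in>V. y u * dot G y u) = (\<Sum>u\<in>V. \<Sum>w\<in>V. x u * x w * of_int (inter G u w))"
      unfolding dot_def sum_distrib_left using sym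
      by (intro sum.cong refl) (simp add: y_def)
    finally show "(\<Sum>u\<in>V. \<Sum>w\<in>V. x u * x w * of_int (inter G u w)) < 0" .
  qed
  then obtain x where x: "\<And>v. v \<in> V \<Longrightarrow> (\<Sum>w\<in>V. x w * (of_int (inter G w v) :: rat)) = b v" by blast
  show ?thesis
  proof (rule that[of "\<lambda>v. if v \<in> V then x v else 0"])
    show "dot G (\<lambda>v. if v \<in> V then x v else 0) v = b v" if "v \<in> V" for v
      using x[OF that] by (simp add: dot_def)
  qed simp
qed

lemma rational_unique:
  fixes y z :: "'v \<Rightarrow> rat"
  assumes "\<And>v. v \<notin> V \<Longrightarrow> y v = 0" "\<And>v. v \<notin> V \<Longrightarrow> z v = 0"
    and "\<And>v. v \<in> V \<Longrightarrow> dot G y v = dot G z v"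
  shows "y = z"
proof (rule ccontr)
  assume "y \<noteq> z"
  then have "y - z \<noteq> 0" by simp
  then have "(\<Sum>u\<in>V. (y - z) u * dot G (y - z) u) < 0"
    using assms(1,2) by (intro negdef_rat[of "y - z"]) auto
  then show False using assms(3) by (simp add: dot_diff)
qed

lemma dual_lat_iff:
  "z \<in> dual_lat G \<longleftrightarrow> (\<forall>v. v \<notin> V \<longrightarrow> z v = 0) \<and> (\<forall>v\<in>V. dot G z v \<in> \<int>)"
proof
  assume z: "z \<in> dual_lat G"
  have "dot G z v \<in> \<int>" if "v \<in> V" for v
  proof -
    have "curve v \<in> lat G" using that by (auto simp: lat_def rat_cycles_def supp_def curve_def)
    then have "ip G z (curve v) \<in> \<int>" using z by (simp add: dual_lat_def)
    then show ?thesis using that by (simp add: ip_curve fin)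
  qed
  then show "(\<forall>v. v \<notin> V \<longrightarrow> z v = 0) \<and> (\<forall>v\<in>V. dot G z v \<in> \<int>)"
    using z by (auto simp: dual_lat_def rat_cycles_def supp_def)
next
  assume z: "(\<forall>v. v \<notin> V \<longrightarrow> z v = 0) \<and> (\<forall>v\<in>V. dot G z v \<in> \<int>)"
  then have "ip G z l \<in> \<int>" if "l \<in> lat G" for l
    using that unfolding ip_eq_dot[OF fin] by (intro Ints_sum Ints_mult) (auto simp: lat_def)
  then show "z \<in> dual_lat G" using z by (auto simp: dual_lat_def rat_cycles_def supp_def)
qed

text \<open>The common shape of the definite descriptions \<open>Z_K\<close> and
  \<open>dual_curve\<close>.\<close>

lemma the_dual:
  fixes b :: "'v \<Rightarrow> int"
  defines "z \<equiv> (THE z. z \<in> dual_lat G \<and> (\<forall>v\<in>V. ip G z (curve v) = of_int (b v)))"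
  shows "\<And>v. v \<notin> V \<Longrightarrow> z v = 0" "\<And>v. v \<in> V \<Longrightarrow> dot G z v = of_int (b v)"
proof -
  let ?P = "\<lambda>z. z \<in> dual_lat G \<and> (\<forall>v\<in>V. ip G z (curve v) = of_int (b v))"
  have P: "?P z \<longleftrightarrow> (\<forall>v. v \<notin> V \<longrightarrow> z v = 0) \<and> (\<forall>v\<in>V. dot G z v = of_int (b v))" for z
    by (auto simp: dual_lat_iff ip_curve fin)
  obtain y :: "'v \<Rightarrow> rat" where y: "\<And>v. v \<notin> V \<Longrightarrow> y v = 0" "\<And>v. v \<in> V \<Longrightarrow> dot G y v = of_int (b v)"
    using rational_solution[of "\<lambda>v. of_int (b v)"] by metis
  have "\<exists>!z. ?P z"
  proof (rule ex1I[of _ y])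
    show "?P y" unfolding P using y by blast
    show "w = y" if "?P w" for w
      using that y unfolding P by (intro rational_unique) auto
  qed
  from theI'[OF this] have "?P z" unfolding z_def .
  then show "\<And>v. v \<notin> V \<Longrightarrow> z v = 0" "\<And>v. v \<in> V \<Longrightarrow> dot G z v = of_int (b v)"
    unfolding P by blast+
qed

lemma Z_K_outside: "v \<notin> V \<Longrightarrow> Z_K G v = 0"
  and dot_Z_K: "v \<in> V \<Longrightarrow> dot G (Z_K G) v = of_int (canon G v)"
proof -
  have c: "ip G (curve v) (curve v) = of_int (inter G v v)" if "v \<in> V" for v
  proof -
    have "ip G (curve v) (curve v) = dot G (rat_cycle (ei v)) v"
      using that by (simp add: ip_curve fin) (auto simp: curve_def ei_def dot_def intro!: sum.cong)
    then show ?thesis using that by (simp only: dot_of_int dot_ei)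
  qed
  have "Z_K G = (THE z. z \<in> dual_lat G \<and> (\<forall>v\<in>V. ip G z (curve v) = of_int (canon G v)))"
    unfolding Z_K_def
    by (intro arg_cong[where f = The] ext conj_cong ball_cong refl)
      (simp add: c canon_def)
  then show "v \<notin> V \<Longrightarrow> Z_K G v = 0" "v \<in> V \<Longrightarrow> dot G (Z_K G) v = of_int (canon G v)"
    using the_dual[of v "canon G"] by simp_all
qed

lemma dual_curve_outside: "w \<notin> V \<Longrightarrow> dual_curve G v w = 0"
  and dot_dual_curve: "w \<in> V \<Longrightarrow> dot G (dual_curve G v) w = (if w = v then -1 else 0)"
proof -
  have "dual_curve G v = (THE z. z \<in> dual_lat G \<and> (\<forall>w\<in>V. ip G z (curve w) = of_int (if w = v then -1 else 0)))"
    unfolding dual_curve_def by (intro arg_cong[where f = The] ext conj_cong ball_cong refl) auto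
  then show "w \<notin> V \<Longrightarrow> dual_curve G v w = 0"
    "w \<in> V \<Longrightarrow> dot G (dual_curve G v) w = (if w = v then -1 else 0)"
    using the_dual[of w "\<lambda>w. if w = v then -1 else 0"] by simp_all
qed

section \<open>Translation of the given invariants to integral cycles\<close>

lemma chi_rat_cycle: "chi G (rat_cycle a) = of_int (chi2 G a) / 2"
proof -
  have "ip G (rat_cycle a) (\<lambda>v. of_int (a v) - Z_K G v) =
    (\<Sum>u\<in>V. of_int (a u) * dot G (rat_cycle a) u) - (\<Sum>u\<in>V. Z_K G u * dot G (rat_cycle a) u)"
    by (simp add: ip_eq_dot fin left_diff_distrib sum_subtractf)
  also have "(\<Sum>u\<in>V. Z_K G u * dot G (rat_cycle a) u) = (\<Sum>u\<in>V. of_int (a u) * of_int (canon G u))"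
    unfolding pairing_sym[of "Z_K G"] by (intro sum.cong) (auto simp: dot_Z_K)
  finally have "ip G (rat_cycle a) (\<lambda>v. of_int (a v) - Z_K G v) = - of_int (chi2 G a)"
    by (simp add: chi2_def dot_of_int right_diff_distrib sum_subtractf)
  then show ?thesis by (simp add: chi_def)
qed

text \<open>Pairing with E_u recovers the exponent \<open>k u\<close> as -(l, E_u). The index set is
  therefore empty if some pairing is positive, and a singleton otherwise.\<close>

lemma zcoeff_rat_cycle:
  assumes a: "a \<in> cyc G"
  shows "zcoeff G (rat_cycle a) = zprod G a"
proof -
  define A where "A = {k \<in> V \<rightarrow>\<^sub>E (UNIV :: nat set). (\<lambda>w. \<Sum>v\<in>V. of_nat (k v) * dual_curve G v w) = rat_cycle a}"
  define s where "s k = (\<lambda>w. \<Sum>v\<in>V. of_nat (k v) * dual_curve G v w)" for k :: "'v \<Rightarrow> nat"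
  have ds: "dot G (s k) u = - of_nat (k u)" if u: "u \<in> V" for k u
  proof -
    have "dot G (s k) u = (\<Sum>v\<in>V. of_nat (k v) * dot G (dual_curve G v) u)"
      unfolding dot_def s_def sum_distrib_left sum_distrib_right
      by (subst sum.swap) (simp add: mult.assoc)
    also have "\<dots> = (\<Sum>v\<in>V. if v = u then - of_nat (k v) else 0)"
      using u by (intro sum.cong) (auto simp: dot_dual_curve)
    finally show ?thesis using u fin by simp
  qed
  have A: "k \<in> A \<longleftrightarrow> k \<in> extensional V \<and> (\<forall>u\<in>V. dot G a u = - int (k u))" for k
  proof -
    have "s k = rat_cycle a \<longleftrightarrow> (\<forall>u\<in>V. dot G (s k) u = dot G (rat_cycle a) u)"
    proof
      assume "\<forall>u\<in>V. dot G (s k) u = dot G (rat_cycle a) u"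
      then show "s k = rat_cycle a"
        using a by (intro rational_unique) (auto simp: s_def dual_curve_outside cyc_def)
    qed simp
    also have "\<dots> \<longleftrightarrow> (\<forall>u\<in>V. dot G a u = - int (k u))"
    proof -
      have "dot G (s k) u = dot G (rat_cycle a) u \<longleftrightarrow> dot G a u = - int (k u)" if "u \<in> V" for u
      proof -
        have "dot G (s k) u = of_int (- int (k u))" using that by (simp add: ds)
        then show ?thesis unfolding dot_of_int of_int_eq_iff by auto
      qed
      then show ?thesis by blast
    qed
    finally show ?thesis unfolding A_def s_def[symmetric] by (auto simp: PiE_def)
  qed
  have z: "zcoeff G (rat_cycle a) = (\<Sum>k\<in>A. \<Prod>v\<in>V. fps_nth ((1 - fps_X :: rat fps) powi (valency G v - 2)) (k v))"
    by (simp add: zcoeff_def A_def)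
  show ?thesis
  proof (cases "\<exists>w\<in>V. 0 < dot G a w")
    case True
    then obtain w where w: "w \<in> V" "0 < dot G a w" by blast
    then have "k \<notin> A" for k using A[of k] by force
    then have "A = {}" by blast
    then show ?thesis unfolding z using zprod_eq_zero[OF w] by simp
  next
    case False
    define k0 where "k0 = restrict (\<lambda>v. nat (- dot G a v)) V"
    have "k \<in> A \<longleftrightarrow> k = k0" for k
    proof
      assume "k \<in> A"
      then have "k \<in> extensional V" "\<And>u. u \<in> V \<Longrightarrow> dot G a u = - int (k u)" using A by blast+
      then show "k = k0" by (intro extensionalityI[of k V]) (auto simp: k0_def)
    next
      assume "k = k0"
      then show "k \<in> A" using False unfolding A by (auto simp: k0_def not_less)
    qed
    then have "A = {k0}" by blast
    then show ?thesis
      unfolding z zprod_def using False by (auto simp: k0_def coeff_def not_less intro!: prod.cong)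
  qed
qed

lemma counting_function_rat_cycle:
  "counting_function G (rat_cycle y) = (\<Sum>l\<in>{l\<in>cyc G. \<not> y \<le> l \<and> zprod G l \<noteq> 0}. zprod G l)"
proof -
  have "{l \<in> lat G. \<not> rat_cycle y \<le> l \<and> zcoeff G l \<noteq> 0} = rat_cycle ` {l\<in>cyc G. \<not> y \<le> l \<and> zprod G l \<noteq> 0}"
  proof (intro equalityI subsetI)
    fix l assume "l \<in> {l \<in> lat G. \<not> rat_cycle y \<le> l \<and> zcoeff G l \<noteq> 0}"
    then obtain a where a: "a \<in> cyc G" "l = rat_cycle a" "\<not> rat_cycle y \<le> rat_cycle a" "zcoeff G (rat_cycle a) \<noteq> 0"
      unfolding lat_eq by blast
    then have "a \<in> {l\<in>cyc G. \<not> y \<le> l \<and> zprod G l \<noteq> 0}"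
      by (simp only: rat_cycle_le zcoeff_rat_cycle mem_Collect_eq simp_thms)
    then show "l \<in> rat_cycle ` {l\<in>cyc G. \<not> y \<le> l \<and> zprod G l \<noteq> 0}" unfolding a(2) by (rule imageI)
  next
    fix l assume "l \<in> rat_cycle ` {l\<in>cyc G. \<not> y \<le> l \<and> zprod G l \<noteq> 0}"
    then obtain a where a: "l = rat_cycle a" "a \<in> cyc G" "\<not> y \<le> a" "zprod G a \<noteq> 0" by blast
    then show "l \<in> {l \<in> lat G. \<not> rat_cycle y \<le> l \<and> zcoeff G l \<noteq> 0}"
      by (simp only: mem_Collect_eq lat_eq rat_cycle_le zcoeff_rat_cycle image_eqI simp_thms)
  qed
  then have "counting_function G (rat_cycle y) = (\<Sum>l\<in>rat_cycle ` {l\<in>cyc G. \<not> y \<le> l \<and> zprod G l \<noteq> 0}. zcoeff G l)"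
    by (simp add: counting_function_def)
  also have "\<dots> = (\<Sum>l\<in>{l\<in>cyc G. \<not> y \<le> l \<and> zprod G l \<noteq> 0}. zcoeff G (rat_cycle l))"
    by (subst sum.reindex) (auto intro: inj_on_subset[OF inj_rat_cycle])
  finally show ?thesis by (simp add: zcoeff_rat_cycle)
qed

lemma lipman_iff:
  "x \<in> lipman G \<longleftrightarrow> (\<exists>a\<in>cyc G. x = rat_cycle a \<and> (\<forall>v\<in>V. dot G a v \<le> 0))"
proof
  assume x: "x \<in> lipman G"
  then obtain a where a: "a \<in> cyc G" "x = rat_cycle a" by (auto simp: lipman_def lat_eq)
  have "dot G a v \<le> 0" if "v \<in> V" for v
    using x that unfolding a(2) by (simp add: lipman_def lipman'_def ip_curve fin dot_of_int)
  then show "\<exists>a\<in>cyc G. x = rat_cycle a \<and> (\<forall>v\<in>V. dot G a v \<le> 0)" using a by blast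
next
  assume "\<exists>a\<in>cyc G. x = rat_cycle a \<and> (\<forall>v\<in>V. dot G a v \<le> 0)"
  then show "x \<in> lipman G"
    by (auto simp: lipman_def lipman'_def lat_eq dual_lat_iff ip_curve fin dot_of_int cyc_def)
qed

text \<open>Solve for pairings -n over the rationals and clear denominators; the positive factor
  \<open>D\<close> only makes the cycle deeper.\<close>

lemma deep_cycle:
  obtains a where "a \<in> cyc G" "\<And>v. v \<in> V \<Longrightarrow> dot G a v \<le> - int n"
proof -
  obtain z :: "'v \<Rightarrow> rat" where z: "\<And>v. v \<notin> V \<Longrightarrow> z v = 0" "\<And>v. v \<in> V \<Longrightarrow> dot G z v = - of_nat n"
    using rational_solution[of "\<lambda>_. - of_nat n"] by metis
  obtain D :: int where D: "0 < D" "\<And>v. v \<in> V \<Longrightarrow> \<exists>k. of_int D * z v = of_int k"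
    using common_denominator[OF fin, of z] by blast
  define a where "a v = \<lfloor>of_int D * z v\<rfloor>" for v
  have a: "of_int (a v) = of_int D * z v" for v
    using D(2)[of v] z(1)[of v] by (cases "v \<in> V") (auto simp: a_def)
  show ?thesis
  proof (rule that[of a])
    show "a \<in> cyc G" using z(1) by (simp add: cyc_def a_def)
    fix v assume v: "v \<in> V"
    have "(of_int (dot G a v) :: rat) = dot G (rat_cycle a) v" by (simp add: dot_of_int)
    also have "\<dots> = of_int D * dot G z v" by (simp add: dot_def a sum_distrib_left mult.assoc)
    also have "\<dots> = of_int (- (D * int n))" using z(2)[OF v] by simp
    finally have "dot G a v = - (D * int n)" by (simp only: of_int_eq_iff)
    moreover have "1 * int n \<le> D * int n" using D(1) by (intro mult_right_mono) auto
    ultimately show "dot G a v \<le> - int n" by simp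
  qed
qed

text \<open>The hypothesis supplies a value that fits the description of \<open>sw_can\<close>. It
  is the only one because two thresholds always admit a common deep cycle, at which the two
  constants are compared.\<close>

lemma sw_bar0_eq:
  assumes "\<And>y. y \<in> cyc G \<Longrightarrow> (\<And>v. v \<in> V \<Longrightarrow> dot G y v \<le> inter G v v) \<Longrightarrow>
    counting_function G (rat_cycle y) = chi G (rat_cycle y) + c"
  shows "sw_bar0 G = c"
proof -
  let ?P = "\<lambda>s n. \<forall>x\<in>lipman G. (\<forall>v\<in>V. ip G x (curve v) \<le> - of_nat n) \<longrightarrow>
     counting_function G x = chi G x + (- sw_normalization G - s)"
  define n0 where "n0 = nat (\<Sum>v\<in>V. \<bar>inter G v v\<bar>)"
  have n0: "- int n0 \<le> inter G v v" if "v \<in> V" for v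
  proof -
    have "\<bar>inter G v v\<bar> \<le> (\<Sum>v\<in>V. \<bar>inter G v v\<bar>)" using that fin by (intro member_le_sum) auto
    then show ?thesis by (simp add: n0_def sum_nonneg)
  qed
  define s0 where "s0 = - sw_normalization G - c"
  have P0: "?P s0 n0"
  proof (intro ballI impI)
    fix x assume x: "x \<in> lipman G" "\<forall>v\<in>V. ip G x (curve v) \<le> - of_nat n0"
    obtain a where a: "a \<in> cyc G" "x = rat_cycle a" using x(1) lipman_iff by blast
    have "dot G a v \<le> inter G v v" if v: "v \<in> V" for v
    proof -
      have "(of_int (dot G a v) :: rat) \<le> of_int (- int n0)"
        using x(2) v by (simp add: a(2) ip_curve fin dot_of_int)
      then show ?thesis using n0[OF v] unfolding of_int_le_iff by simp
    qed
    then show "counting_function G x = chi G x + (- sw_normalization G - s0)"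
      using assms[OF a(1)] by (simp add: a(2) s0_def)
  qed
  have "sw_can G = s0"
    unfolding sw_can_def
  proof (rule the_equality)
    show "\<exists>n. ?P s0 n" using P0 by blast
    fix s assume "\<exists>n. ?P s n"
    then obtain n where n: "?P s n" by blast
    obtain a where a: "a \<in> cyc G" "\<And>v. v \<in> V \<Longrightarrow> dot G a v \<le> - int (max n n0)"
      using deep_cycle[of "max n n0"] by blast
    have x: "rat_cycle a \<in> lipman G" unfolding lipman_iff
    proof (intro bexI[OF _ a(1)] conjI ballI refl)
      fix v assume "v \<in> V" then show "dot G a v \<le> 0" using a(2)[of v] by linarith
    qed
    have "ip G (rat_cycle a) (curve v) \<le> - of_nat k" if v: "v \<in> V" and k: "k \<le> max n n0" for v k
    proof -
      have "dot G a v \<le> - int k" using a(2)[OF v] k by linarith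
      then have "(of_int (dot G a v) :: rat) \<le> of_int (- int k)" unfolding of_int_le_iff .
      then show ?thesis using v by (simp add: ip_curve fin dot_of_int)
    qed
    note le = this
    have "counting_function G (rat_cycle a) = chi G (rat_cycle a) + (- sw_normalization G - s)"
      using x le[of _ n] by (intro n[rule_format]) auto
    moreover have "counting_function G (rat_cycle a) = chi G (rat_cycle a) + (- sw_normalization G - s0)"
      using x le[of _ n0] by (intro P0[rule_format]) auto
    ultimately show "s = s0" by simp
  qed
  then show ?thesis by (simp add: sw_bar0_def s0_def)
qed

end

section \<open>The fundamental cycle and the canonical cycle\<close>

definition antinef_cycles :: "'v res \<Rightarrow> ('v \<Rightarrow> int) set" where
  "antinef_cycles G = {a \<in> cyc G. a \<noteq> 0 \<and> (\<forall>v\<in>verts G. dot G a v \<le> 0)}"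

context plumbing
begin

lemma antinef_inf:
  assumes "\<And>v. v \<in> V \<Longrightarrow> dot G a v \<le> 0" "\<And>v. v \<in> V \<Longrightarrow> dot G b v \<le> (0 :: int)" "v \<in> V"
  shows "dot G (inf a b) v \<le> 0"
proof (cases "a v \<le> b v")
  case True
  then have "dot G (inf a b) v \<le> dot G a v" using assms(3) by (intro dot_mono) (auto simp: inf_absorb1)
  then show ?thesis using assms(1)[OF assms(3)] by simp
next
  case False
  then have "dot G (inf a b) v \<le> dot G b v" using assms(3) by (intro dot_mono) (auto simp: inf_absorb2)
  then show ?thesis using assms(2)[OF assms(3)] by simp
qed

text \<open>Nonzero antinef cycles exist by \<open>deep_cycle\<close> and are closed under infima:
  by connectedness all of them have full support, so an infimum is not 0. One of smallest
  coefficient sum is therefore the least.\<close>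

lemma fundamental_cycle:
  assumes con: "cut_connected G" and ne: "V \<noteq> {}"
  obtains Z where "Z \<in> antinef_cycles G" "\<And>b. b \<in> antinef_cycles G \<Longrightarrow> Z \<le> b" "Z_min G = rat_cycle Z"
    "\<And>v. v \<in> V \<Longrightarrow> 1 \<le> Z v"
proof -
  obtain v0 where v0: "v0 \<in> V" using ne by blast
  have full: "1 \<le> a v" if "a \<in> antinef_cycles G" "v \<in> V" for a v
    using that antinef_nonneg[of a] by (intro antinef_full_support[OF con]) (auto simp: antinef_cycles_def)
  obtain A where A: "A \<in> antinef_cycles G"
  proof -
    obtain a where a: "a \<in> cyc G" "\<And>v. v \<in> V \<Longrightarrow> dot G a v \<le> - int 1"
      using deep_cycle[of 1] by blast
    have "a \<noteq> 0" using a(2)[OF v0] by auto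
    moreover have "dot G a v \<le> 0" if "v \<in> V" for v using a(2)[OF that] by simp
    ultimately show ?thesis using a(1) by (intro that[of a]) (simp add: antinef_cycles_def)
  qed
  obtain Z where Z: "Z \<in> antinef_cycles G"
    and min: "\<And>b. b \<in> antinef_cycles G \<Longrightarrow> size_between 0 Z \<le> size_between 0 b"
    using ex_has_least_nat[of "\<lambda>a. a \<in> antinef_cycles G" A "size_between 0"] A by blast
  have least: "Z \<le> b" if b: "b \<in> antinef_cycles G" for b
  proof -
    have c: "Z \<in> cyc G" "b \<in> cyc G" using Z b by (auto simp: antinef_cycles_def)
    have "1 \<le> inf Z b v0" using full[OF Z v0] full[OF b v0] by simp
    then have "inf Z b \<noteq> 0" by (metis not_one_le_zero zero_fun_apply)
    then have i: "inf Z b \<in> antinef_cycles G"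
      using Z b cyc_inf[OF c] antinef_inf[of Z b] by (auto simp: antinef_cycles_def)
    have "0 \<le> (\<Sum>v\<in>V. inf Z b v)" using full[OF i] by (intro sum_nonneg) force
    then have "(\<Sum>v\<in>V. Z v) \<le> (\<Sum>v\<in>V. inf Z b v)" using min[OF i] by simp
    then have "inf Z b = Z" using c by (intro cyc_eqI_sum[OF fin] cyc_inf) auto
    then show ?thesis by (metis inf.cobounded2)
  qed
  have mem: "x \<in> lipman G - {\<lambda>_. 0} \<longleftrightarrow> (\<exists>a\<in>antinef_cycles G. x = rat_cycle a)" for x
  proof -
    have "rat_cycle a = (\<lambda>_. 0) \<longleftrightarrow> a = 0" for a :: "'v \<Rightarrow> int" by (auto simp: fun_eq_iff)
    then show ?thesis by (auto simp: lipman_iff antinef_cycles_def)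
  qed
  have "Z_min G = rat_cycle Z"
    unfolding Z_min_def
  proof (rule Least_equality)
    show "rat_cycle Z \<in> lipman G - {\<lambda>_. 0}" unfolding mem using Z by blast
    fix y assume "y \<in> lipman G - {\<lambda>_. 0}"
    then obtain a where "a \<in> antinef_cycles G" "y = rat_cycle a" unfolding mem by blast
    then show "rat_cycle Z \<le> y" using least[of a] by (simp add: le_fun_def)
  qed
  with Z least show ?thesis using full[OF Z] by (intro that[of Z])
qed

text \<open>Laufer's computation sequence from \<open>D\<close> to \<open>Z\<close>: below
  \<open>Z\<close> some curve has positive pairing and may still be added, and adding it does not
  increase \<chi>.\<close>

lemma chi2_below_fundamental:
  assumes Z: "Z \<in> antinef_cycles G" and least: "\<And>b. b \<in> antinef_cycles G \<Longrightarrow> Z \<le> b"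
    and D: "D \<in> cyc G" "0 \<le> D" "D \<le> Z" "D \<noteq> 0"
  shows "chi2 G Z \<le> chi2 G D"
  using D
proof (induction "size_between D Z" arbitrary: D rule: less_induct)
  case less
  show ?case
  proof (cases "D = Z")
    case False
    have "\<exists>u\<in>V. D u < Z u \<and> 0 < dot G D u"
    proof (rule ccontr)
      assume neg: "\<not> ?thesis"
      have "dot G D u \<le> 0" if u: "u \<in> V" for u
      proof (cases "D u < Z u")
        case True
        then show ?thesis using neg u by force
      next
        case False
        then have "D u = Z u" using le_funD[OF less.prems(3), of u] by simp
        then have "dot G D u \<le> dot G Z u" using less.prems(3) u by (intro dot_mono)
        then show ?thesis using Z u by (force simp: antinef_cycles_def)
      qed
      then have "D \<in> antinef_cycles G" using less.prems by (simp add: antinef_cycles_def)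
      then show False using least[of D] less.prems(3) False by simp
    qed
    then obtain u where u: "u \<in> V" "D u < Z u" "0 < dot G D u" by blast
    have c: "D + ei u \<in> cyc G" by (rule cyc_add[OF less.prems(1) cyc_ei[OF u(1)]])
    have nn: "0 \<le> D + ei u" using less.prems(2) ei_nonneg[of u] by (simp add: le_fun_def)
    have le: "D + ei u \<le> Z" using less.prems(3) u(2) by (rule add_ei_le)
    have "0 < (D + ei u) u" using le_funD[OF less.prems(2), of u] by (simp add: ei_def)
    then have nz: "D + ei u \<noteq> 0" by (metis less_irrefl zero_fun_apply)
    have "chi2 G Z \<le> chi2 G (D + ei u)"
      using size_between_ei(2)[OF u(1) less.prems(3) u(2)] c nn le nz by (rule less.hyps)
    also have "\<dots> \<le> chi2 G D" using u by (simp add: chi2_step)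
    finally show ?thesis .
  qed simp
qed

text \<open>By submodularity and \<chi>(Z) = 0 it suffices to treat the infimum and the supremum
  with \<open>Z\<close>. The infimum lies below \<open>Z\<close>. The supremum is
  \<open>Z + D'\<close>, where \<chi>(Z + D') \<ge> \<chi>(D') as \<open>Z\<close> is antinef, and
  \<open>D'\<close> is smaller than \<open>D\<close> as \<open>Z\<close> has full support.\<close>

lemma elliptic_base_of_elliptic:
  assumes con: "cut_connected G" and ne: "V \<noteq> {}" and ell: "elliptic G"
  shows "elliptic_base G"
proof -
  obtain Z where Z: "Z \<in> antinef_cycles G" and least: "\<And>b. b \<in> antinef_cycles G \<Longrightarrow> Z \<le> b"
    and zm: "Z_min G = rat_cycle Z" and full: "\<And>v. v \<in> V \<Longrightarrow> 1 \<le> Z v"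
    using fundamental_cycle[OF con ne] by blast
  have Z': "Z \<in> cyc G" "Z \<noteq> 0" "\<And>v. v \<in> V \<Longrightarrow> dot G Z v \<le> 0" using Z by (auto simp: antinef_cycles_def)
  have Z0: "0 \<le> Z" using Z' by (intro antinef_nonneg)
  have chiZ: "chi2 G Z = 0" using ell by (simp add: elliptic_def zm chi_rat_cycle)
  have "0 \<le> chi2 G D" if "D \<in> cyc G" "0 \<le> D" for D
    using that
  proof (induction "size_between 0 D" arbitrary: D rule: less_induct)
    case less
    show ?case
    proof (cases "D = 0")
      case False
      define D' where "D' = sup D Z - Z"
      have D'c: "D' \<in> cyc G" unfolding D'_def using less.prems(1) Z'(1) by (intro cyc_diff cyc_sup)
      have D'0: "0 \<le> D'" by (simp add: D'_def le_fun_def)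
      obtain u where u: "u \<in> V" "0 < D u"
      proof -
        obtain u where "D u \<noteq> 0" using False by (auto simp: fun_eq_iff)
        then show ?thesis using less.prems(1) le_funD[OF less.prems(2), of u] that[of u] by (force simp: cyc_def)
      qed
      have le: "D' v \<le> D v" if "v \<in> V" for v
        using full[OF that] le_funD[OF less.prems(2), of v] by (simp add: D'_def sup_int_def)
      have "D' u < D u" using full[OF u(1)] u(2) by (simp add: D'_def sup_int_def)
      then have "(\<Sum>v\<in>V. D' v) < (\<Sum>v\<in>V. D v)"
        using le u by (intro sum_strict_mono_ex1[OF fin]) auto
      moreover have "0 \<le> (\<Sum>v\<in>V. D' v)" using le_funD[OF D'0] by (intro sum_nonneg) simp
      ultimately have "size_between 0 D' < size_between 0 D" by simp
      then have IH: "0 \<le> chi2 G D'" using D'c D'0 by (rule less.hyps)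
      have "(\<Sum>v\<in>V. D' v * dot G Z v) \<le> 0"
        using Z'(3) le_funD[OF D'0] by (intro sum_nonpos) (simp add: mult_nonneg_nonpos)
      then have "0 \<le> chi2 G (Z + D')" using IH by (simp add: chi2_add chiZ)
      then have s: "0 \<le> chi2 G (sup D Z)" by (simp add: D'_def)
      have i: "0 \<le> chi2 G (inf D Z)"
      proof (cases "inf D Z = 0")
        case False
        then show ?thesis
          using chi2_below_fundamental[OF Z least, of "inf D Z"] chiZ less.prems Z0 cyc_inf[OF less.prems(1) Z'(1)] False by simp
      qed simp
      show ?thesis
        using chi2_inf_sup[OF less.prems(1) Z'(1)] s i chiZ by simp
    qed simp
  qed
  then show ?thesis using Z'(1,2) Z0 chiZ by (auto simp: elliptic_base_def)
qed

section \<open>The canonical cycle of a minimal resolution\<close>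

lemma canon_nonpos:
  assumes "\<nexists>v. minus_one_curve G v" "u \<in> V"
  shows "canon G u \<le> 0"
proof (cases "pa G u = 0")
  case True
  then have "inter G u u \<noteq> - 1" using assms by (auto simp: minus_one_curve_def)
  then show ?thesis using inter_self_neg[OF assms(2)] True by (simp add: canon_def)
qed (use inter_self_neg[OF assms(2)] in \<open>simp add: canon_def\<close>)

text \<open>The substitution s = Z_K - N turns the least \<open>s\<close> into the greatest
  \<open>N\<close> satisfying \<open>P\<close>. Such cycles are closed under suprema and bounded by
  Z_K, because antinef rational cycles are effective. Minimality of the resolution puts 0 among
  them, whence \<open>0 \<le> N\<close>.\<close>

lemma canon_max_of_s_ZK:
  assumes min: "\<nexists>v. minus_one_curve G v"
  obtains N where "canon_max G N" "0 \<le> N" "ell_N G = rat_cycle N"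
proof -
  define P where "P N \<longleftrightarrow> N \<in> cyc G \<and> (\<forall>u\<in>V. canon G u \<le> dot G N u)" for N
  define S where "S = {s \<in> lipman' G. (\<lambda>v. s v - Z_K G v) \<in> lat G}"
  have S: "s \<in> S \<longleftrightarrow> (\<exists>N. P N \<and> s = (\<lambda>v. Z_K G v - of_int (N v)))" for s
  proof
    assume s: "s \<in> S"
    then obtain a where a: "a \<in> cyc G" "(\<lambda>v. s v - Z_K G v) = rat_cycle a" by (auto simp: S_def lat_eq)
    have s_eq: "s = (\<lambda>v. Z_K G v - of_int ((- a) v))"
    proof
      fix v have "s v - Z_K G v = of_int (a v)" using a(2) by metis
      then show "s v = Z_K G v - of_int ((- a) v)" by simp
    qed
    have "canon G u \<le> dot G (- a) u" if u: "u \<in> V" for u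
    proof -
      have "dot G s u \<le> 0" using s u by (simp add: S_def lipman'_def ip_curve fin)
      moreover have "dot G s u = dot G (Z_K G - rat_cycle (- a)) u"
        by (subst s_eq) (simp add: fun_diff_def)
      ultimately have "(of_int (canon G u) :: rat) \<le> of_int (dot G (- a) u)"
        using u by (simp only: dot_diff dot_Z_K dot_of_int)
      then show ?thesis by simp
    qed
    moreover have "- a \<in> cyc G" using a(1) by (simp add: cyc_def)
    ultimately show "\<exists>N. P N \<and> s = (\<lambda>v. Z_K G v - of_int (N v))" using s_eq P_def by blast
  next
    assume "\<exists>N. P N \<and> s = (\<lambda>v. Z_K G v - of_int (N v))"
    then obtain N where N: "P N" "s = (\<lambda>v. Z_K G v - of_int (N v))" by blast
    have d: "dot G s u = of_int (canon G u - dot G N u)" if "u \<in> V" for u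
    proof -
      have "dot G s u = dot G (Z_K G - rat_cycle N) u" by (simp add: N(2) fun_diff_def)
      then show ?thesis using that by (simp only: dot_diff dot_Z_K dot_of_int of_int_diff)
    qed
    have "s \<in> lipman' G"
      unfolding lipman'_def dual_lat_iff mem_Collect_eq
    proof (intro conjI allI ballI impI)
      fix v assume "v \<notin> V" then show "s v = 0" using N by (simp add: P_def cyc_def Z_K_outside)
    next
      fix v assume v: "v \<in> V"
      show "dot G s v \<in> \<int>" using d[OF v] by simp
      show "ip G s (curve v) \<le> 0" using d[OF v] N(1) v by (simp add: ip_curve fin P_def)
    qed
    moreover have "- N \<in> cyc G" using N(1) by (simp add: P_def cyc_def)
    then have "rat_cycle (- N) \<in> lat G" unfolding lat_eq by (rule imageI)
    then have "(\<lambda>v. s v - Z_K G v) \<in> lat G" by (simp add: N(2))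
    ultimately show "s \<in> S" by (simp add: S_def)
  qed
  have bound: "of_int (N v) \<le> Z_K G v" if "P N" for N v
  proof -
    let ?s = "\<lambda>v. Z_K G v - of_int (N v)"
    have "?s \<in> S" using that S by blast
    then have "0 \<le> ?s"
      by (intro antinef_nonneg_rat) (auto simp: S_def lipman'_def dual_lat_iff ip_curve fin)
    then show ?thesis using le_funD[of 0 ?s v] by simp
  qed
  have P0: "P 0" using canon_nonpos[OF min] by (simp add: P_def cyc_zero)
  have Psup: "P (sup a b)" if "P a" "P b" for a b
    unfolding P_def
  proof (intro conjI ballI)
    show "sup a b \<in> cyc G" using that by (intro cyc_sup) (auto simp: P_def)
    fix u assume u: "u \<in> V"
    show "canon G u \<le> dot G (sup a b) u"
    proof (cases "a u \<le> b u")
      case True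
      then have "dot G b u \<le> dot G (sup a b) u" using u by (intro dot_mono) (auto simp: sup_absorb2)
      then show ?thesis using that u by (force simp: P_def)
    next
      case False
      then have "dot G a u \<le> dot G (sup a b) u" using u by (intro dot_mono) (auto simp: sup_absorb1)
      then show ?thesis using that u by (force simp: P_def)
    qed
  qed
  define B where "B = nat (\<Sum>v\<in>V. \<lceil>Z_K G v\<rceil>)"
  have "size_between 0 N \<le> B" if "P N" for N
    unfolding B_def
  proof (intro nat_mono sum_mono)
    fix v show "N v - 0 v \<le> \<lceil>Z_K G v\<rceil>" using bound[OF that, of v] by (simp add: le_ceiling_iff)
  qed
  then have "size_between 0 N < Suc B" if "P N" for N using that by (simp add: less_Suc_eq_le)
  then obtain N where N: "P N" "0 \<le> N" and max: "\<And>b. P b \<Longrightarrow> 0 \<le> b \<Longrightarrow> size_between 0 b \<le> size_between 0 N"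
    using ex_has_greatest_nat[of "\<lambda>N. P N \<and> 0 \<le> N" 0 "size_between 0" "Suc B"] P0 by auto
  have greatest: "b \<le> N" if b: "P b" for b
  proof -
    have s: "P (sup N b)" "0 \<le> sup N b" using Psup[OF N(1) b] N(2) by (auto intro: le_supI1)
    have "0 \<le> (\<Sum>v\<in>V. N v)" using le_funD[OF N(2)] by (intro sum_nonneg) simp
    then have "(\<Sum>v\<in>V. sup N b v) \<le> (\<Sum>v\<in>V. N v)" using max[OF s] by simp
    then have "N = sup N b" using N(1) s(1) by (intro cyc_eqI_sum[OF fin]) (auto simp: P_def)
    then show ?thesis by (metis sup_ge2)
  qed
  have "s_ZK G = (\<lambda>v. Z_K G v - of_int (N v))"
    unfolding s_ZK_def
  proof (rule Least_equality)
    have "(\<lambda>v. Z_K G v - of_int (N v)) \<in> S" using S N(1) by blast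
    then show "(\<lambda>v. Z_K G v - of_int (N v)) \<in> lipman' G \<and> (\<lambda>v. Z_K G v - of_int (N v) - Z_K G v) \<in> lat G"
      by (simp add: S_def)
    fix y assume "y \<in> lipman' G \<and> (\<lambda>v. y v - Z_K G v) \<in> lat G"
    then have "y \<in> S" by (simp add: S_def)
    then obtain b where b: "P b" "y = (\<lambda>v. Z_K G v - of_int (b v))" using S by blast
    show "(\<lambda>v. Z_K G v - of_int (N v)) \<le> y"
      unfolding b(2) using le_funD[OF greatest[OF b(1)]] by (simp add: le_fun_def)
  qed
  then have "ell_N G = rat_cycle N" by (simp add: ell_N_def)
  moreover have "canon_max G N"
    unfolding canon_max_def
  proof (intro conjI ballI impI)
    show "N \<in> cyc G" "\<And>u. u \<in> V \<Longrightarrow> canon G u \<le> dot G N u" using N(1) by (auto simp: P_def)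
    fix l assume l: "l \<in> cyc G" "0 \<le> l" "l \<noteq> 0"
    show "\<exists>u\<in>V. dot G (N + l) u < canon G u"
    proof (rule ccontr)
      assume "\<not> ?thesis"
      then have "P (N + l)" using N(1) l(1) cyc_add[of N G l] by (auto simp: P_def not_less)
      then have "N + l \<le> N" by (rule greatest)
      then have "l \<le> 0" by (simp add: le_fun_def)
      then show False using l(2,3) by simp
    qed
  qed
  ultimately show ?thesis using N(2) by (intro that[of N])
qed

end

section \<open>Blowing down\<close>

text \<open>The total transform under the blow-up with exceptional curve E_v: the coefficient at
  \<open>v\<close> makes it orthogonal to E_v when E_v has self-intersection -1.\<close>

definition pullback :: "'v res \<Rightarrow> 'v \<Rightarrow> ('v \<Rightarrow> 'a::comm_ring_1) \<Rightarrow> 'v \<Rightarrow> 'a" where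
  "pullback G v a = (\<lambda>u. if u = v then (\<Sum>w\<in>verts G - {v}. a w * of_int (inter G w v)) else a u)"

lemma verts_blow_down [simp]: "verts (blow_down G v) = verts G - {v}"
  and inter_blow_down: "inter (blow_down G v) u w = inter G u w + inter G u v * inter G w v"
  and pa_blow_down: "pa (blow_down G v) u = pa G u + (nat (inter G u v) choose 2)"
  by (simp_all add: blow_down_def)

lemma pullback_other [simp]: "u \<noteq> v \<Longrightarrow> pullback G v a u = a u"
  by (simp add: pullback_def)

lemma pullback_diff: "pullback G v (a - b) = pullback G v a - pullback G v b"
  by (auto simp: pullback_def fun_eq_iff left_diff_distrib sum_subtractf)

lemma pullback_zero [simp]: "pullback G v 0 = 0"
  by (auto simp: pullback_def fun_eq_iff)

locale minus_one = plumbing G for G :: "'v res" +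
  fixes v
  assumes v: "minus_one_curve G v"
begin

abbreviation "G' \<equiv> blow_down G v"
abbreviation "r u \<equiv> inter G u v"
abbreviation "pull \<equiv> pullback G v"

lemma vV: "v \<in> V" and vv: "inter G v v = -1" and pav: "pa G v = 0"
  using v by (auto simp: minus_one_curve_def)

lemma r_nonneg: "u \<in> V - {v} \<Longrightarrow> 0 \<le> r u"
  using inter_nonneg vV by auto

lemma sum_verts: "(\<Sum>u\<in>V. f u) = f v + (\<Sum>u\<in>V - {v}. f u)"
  by (rule sum.remove[OF fin vV])

lemma dot_pull: "u \<in> V - {v} \<Longrightarrow> dot G (pull a) u = dot G' a u"
  and dot_pull_v: "dot G (pull a) v = 0"
proof -
  assume u: "u \<in> V - {v}"
  have "dot G (pull a) u = pull a v * of_int (inter G v u) + (\<Sum>w\<in>V - {v}. a w * of_int (inter G w u))"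
    unfolding dot_def sum_verts by simp
  also have "inter G v u = r u" using sym[of v u] u vV by auto
  also have "pull a v * of_int (r u) = (\<Sum>w\<in>V - {v}. a w * of_int (inter G w v * inter G u v))"
    by (simp add: pullback_def sum_distrib_right mult.assoc)
  finally show "dot G (pull a) u = dot G' a u"
    by (simp add: dot_def inter_blow_down distrib_left sum.distrib)
next
  show "dot G (pull a) v = 0" unfolding dot_def sum_verts vv by (simp add: pullback_def)
qed

text \<open>Negative definiteness descends because pulling back preserves intersection
  numbers.\<close>

lemma plumbing_blow_down: "plumbing G'"
proof
  show "finite (verts G')" using fin by simp
  show "inter G' u w = inter G' w u" if "u \<in> verts G'" "w \<in> verts G'" for u w
    using that sym[of u w] by (simp add: inter_blow_down)
  show "0 \<le> inter G' u w" if "u \<in> verts G'" "w \<in> verts G'" "u \<noteq> w" for u w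
    using that inter_nonneg[of u w] r_nonneg by (simp add: inter_blow_down)
  show "negative_definite G'"
    unfolding negative_definite_def
  proof (intro ballI impI)
    fix l assume l: "l \<in> rat_cycles G'" "l \<noteq> (\<lambda>_. 0)"
    have l0: "l u = 0" if "u \<notin> verts G'" for u
      using l(1) that by (auto simp: rat_cycles_def supp_def)
    obtain u where u: "l u \<noteq> 0" using l(2) by auto
    then have "u \<noteq> v" using l0[of u] by auto
    then have "pull l u \<noteq> 0" using u by simp
    then have "pull l \<noteq> 0" by auto
    moreover have "pull l w = 0" if "w \<notin> V" for w
      using that vV l0[of w] by (cases "w = v") auto
    ultimately have "(\<Sum>u\<in>V. pull l u * dot G (pull l) u) < 0" by (intro negdef_rat)
    also have "(\<Sum>u\<in>V. pull l u * dot G (pull l) u) = (\<Sum>u\<in>verts G'. l u * dot G' l u)"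
      unfolding sum_verts by (simp add: dot_pull_v dot_pull)
    finally show "ip G' l l < 0" using fin by (simp add: ip_eq_dot)
  qed
qed

text \<open>With r = (E_u, E_v), the self-intersection grows by r^2 and twice the arithmetic genus
  by r (r - 1), which leaves r.\<close>

lemma canon_blow_down: "u \<in> V - {v} \<Longrightarrow> canon G' u = canon G u + r u"
proof -
  assume u: "u \<in> V - {v}"
  obtain n where n: "r u = int n" using r_nonneg[OF u] zero_le_imp_eq_int by blast
  have "even (n * (n - 1))" by (cases "even n") auto
  then have "2 * (n choose 2) = n * (n - 1)" by (simp add: choose_two)
  then have "2 * int (n choose 2) = int n * int n - int n"
    by (cases n) (simp_all add: algebra_simps flip: of_nat_mult)
  then show ?thesis using n by (simp add: canon_def inter_blow_down pa_blow_down)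
qed

lemma canon_v: "canon G v = 1"
  by (simp add: canon_def vv pav)

definition exc :: "int \<Rightarrow> 'v \<Rightarrow> int" where
  "exc k = (\<lambda>u. if u = v then k else 0)"

lemma dot_exc: "u \<in> V - {v} \<Longrightarrow> dot G (exc k) u = k * r u" "dot G (exc k) v = - k"
proof -
  have d: "dot G (exc k) u = k * inter G v u" for u
    unfolding dot_def sum_verts by (simp add: exc_def)
  show "dot G (exc k) v = - k" by (simp add: d vv)
  show "dot G (exc k) u = k * r u" if "u \<in> V - {v}" using that sym[of u v] vV by (simp add: d)
qed

lemma decompose:
  assumes "a \<in> cyc G" "0 \<le> a"
  obtains b k where "b \<in> cyc G'" "a = pull b + exc k" "\<And>u. u \<noteq> v \<Longrightarrow> b u = a u" "0 \<le> b"
proof (rule that)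
  let ?b = "a(v := 0)"
  show "?b \<in> cyc G'" using assms by (auto simp: cyc_def)
  show "a = pull ?b + exc (a v - pull ?b v)" by (auto simp: fun_eq_iff exc_def)
  show "0 \<le> ?b" using assms(2) by (simp add: le_fun_def)
qed auto

lemma pull_cyc: "a \<in> cyc G' \<Longrightarrow> pull a \<in> cyc G"
  using vV by (auto simp: cyc_def pullback_def)

lemma pull_mono:
  fixes a b :: "'v \<Rightarrow> int"
  assumes "a \<le> b"
  shows "pull a \<le> pull b"
proof (rule le_funI)
  fix u show "pull a u \<le> pull b u"
    using le_funD[OF assms] r_nonneg
    by (cases "u = v") (auto simp: pullback_def intro!: sum_mono mult_right_mono)
qed

lemma pull_nonneg: "0 \<le> a \<Longrightarrow> 0 \<le> pull a" for a :: "'v \<Rightarrow> int"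
  using pull_mono[of 0 a] by simp

lemma cyc_le_iff:
  assumes "a \<in> cyc G'" "b \<in> cyc G'"
  shows "a \<le> b \<longleftrightarrow> (\<forall>u. u \<noteq> v \<longrightarrow> a u \<le> b u)" "a = b \<longleftrightarrow> (\<forall>u. u \<noteq> v \<longrightarrow> a u = b u)"
proof -
  have "a v = 0" "b v = 0" using assms by (auto simp: cyc_def)
  then show "a \<le> b \<longleftrightarrow> (\<forall>u. u \<noteq> v \<longrightarrow> a u \<le> b u)" "a = b \<longleftrightarrow> (\<forall>u. u \<noteq> v \<longrightarrow> a u = b u)"
    unfolding le_fun_def fun_eq_iff by (metis order_refl)+
qed

text \<open>Total transforms keep \<chi> and are orthogonal to E_v, so the multiple of E_v enters
  separately, with a term that is nonnegative for every integer \<open>k\<close>.\<close>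

lemma chi2_pull: "chi2 G (pull a + exc k) = chi2 G' a + k * k + k"
proof -
  have e: "(\<Sum>u\<in>V. exc k u * f u) = k * f v" for f
    unfolding sum_verts by (simp add: exc_def)
  have p: "pull a v = (\<Sum>u\<in>V - {v}. a u * r u)" by (simp add: pullback_def)
  have "chi2 G (pull a) = pull a v + (\<Sum>u\<in>V - {v}. a u * (canon G u - dot G' a u))"
    unfolding chi2_def sum_verts by (simp add: dot_pull_v dot_pull canon_v)
  also have "\<dots> = (\<Sum>u\<in>V - {v}. a u * (canon G' u - dot G' a u))"
    unfolding p sum.distrib[symmetric] by (intro sum.cong refl) (simp add: canon_blow_down algebra_simps)
  finally have "chi2 G (pull a) = chi2 G' a" by (simp add: chi2_def)
  moreover have "chi2 G (exc k) = k * k + k"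
    unfolding chi2_def e by (simp add: canon_v dot_exc algebra_simps)
  ultimately show ?thesis by (simp add: chi2_add e dot_pull_v)
qed

lemma exc_zero [simp]: "exc 0 = 0"
  by (auto simp: exc_def)

text \<open>Curves through E_v become adjacent to each other. Given a cut without edges, put E_v on
  the side of \<open>A\<close> if \<open>A\<close> meets E_v and on the other side otherwise; no
  edge crosses the resulting cut upstairs.\<close>

lemma cut_connected_blow_down:
  assumes con: "cut_connected G"
  shows "cut_connected G'"
  unfolding cut_connected_def
proof (intro allI impI)
  fix A assume A: "A \<subseteq> verts G'" "A \<noteq> {}" "A \<noteq> verts G'"
  show "\<exists>u\<in>A. \<exists>w\<in>verts G' - A. 0 < inter G' u w"
  proof (rule ccontr)
    assume neg: "\<not> ?thesis"
    have z: "inter G u w = 0 \<and> r u * r w = 0" if "u \<in> A" "w \<in> verts G' - A" for u w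
    proof -
      have "inter G' u w \<le> 0" using neg that by (auto simp: not_less)
      moreover have "0 \<le> inter G u w" using that A by (intro inter_nonneg) auto
      moreover have "0 \<le> r u * r w" using that A r_nonneg by (intro mult_nonneg_nonneg) auto
      ultimately show ?thesis unfolding inter_blow_down by linarith
    qed
    show False
    proof (cases "\<exists>u\<in>A. r u \<noteq> 0")
      case False
      have "A \<subseteq> V" "A \<noteq> V" using A vV by auto
      then obtain u w where uw: "u \<in> A" "w \<in> V" "w \<notin> A" "0 < inter G u w"
        using cut_connectedD[OF con _ A(2)] by metis
      then show False using z[of u w] False by (cases "w = v") auto
    next
      case True
      then have zr: "r w = 0" if "w \<in> verts G' - A" for w using z that by auto
      have "insert v A \<subseteq> V" "insert v A \<noteq> {}" "insert v A \<noteq> V" using A vV by auto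
      then obtain u w where uw: "u \<in> insert v A" "w \<in> V" "w \<notin> insert v A" "0 < inter G u w"
        using cut_connectedD[OF con] by metis
      then have w: "w \<in> verts G' - A" by auto
      show False
      proof (cases "u = v")
        case True
        then show False using zr[OF w] sym[of v w] uw vV by simp
      next
        case False
        then show False using z[of u w] w uw by auto
      qed
    qed
  qed
qed

text \<open>A zero cycle upstairs splits into a total transform and a multiple of E_v, both
  contributing nonnegatively, so the former comes from a zero cycle downstairs. That cycle is not 0,
  as positive multiples of E_v have \<chi> > 0.\<close>

lemma elliptic_base_blow_down:
  assumes "elliptic_base G"
  shows "elliptic_base G'"
proof -
  have nn: "0 \<le> chi2 G' l" if "l \<in> cyc G'" "0 \<le> l" for l
  proof -
    have "0 \<le> chi2 G (pull l)" using assms that pull_cyc pull_nonneg by (simp add: elliptic_base_def)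
    then show ?thesis using chi2_pull[of l 0] by simp
  qed
  obtain l where l: "l \<in> cyc G" "0 \<le> l" "l \<noteq> 0" "chi2 G l = 0"
    using assms by (auto simp: elliptic_base_def)
  obtain b k where b: "b \<in> cyc G'" "l = pull b + exc k" "\<And>u. u \<noteq> v \<Longrightarrow> b u = l u" and b0: "0 \<le> b"
    using decompose[OF l(1,2)] by blast
  have eq: "chi2 G' b + k * k + k = 0" using l(4) unfolding b(2) chi2_pull .
  have "0 \<le> k * k + k"
  proof (cases "0 \<le> k")
    case False
    then have "0 \<le> (- k - 1) * (- k)" by (intro mult_nonneg_nonneg) auto
    then show ?thesis by (simp add: algebra_simps)
  qed simp
  then have chi0: "chi2 G' b = 0" and k0: "k * k + k = 0" using eq nn[OF b(1) b0] by simp_all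
  have "b \<noteq> 0"
  proof
    assume "b = 0"
    then have "l = exc k" using b(2) by simp
    then have "k \<noteq> 0" "0 \<le> k" using l(3) le_funD[OF l(2), of v] by (auto simp: exc_def)
    then have "0 < k * k + k" by (simp add: add_pos_pos)
    then show False using k0 by simp
  qed
  then show ?thesis using nn b(1) b0 chi0 by (auto simp: elliptic_base_def)
qed

text \<open>The shift by E_v is that of Z_K. For maximality let l = pull b + k E_v: if k > 0, the
  curve E_v violates the bound; otherwise \<open>b\<close> is nonzero and a curve that fails for
  \<open>N + b\<close> still fails, since k r \<le> 0.\<close>

lemma canon_max_pull:
  assumes N: "canon_max G' N"
  shows "canon_max G (pull N - ei v)"
proof -
  have Nc: "N \<in> cyc G'" and N1: "\<And>u. u \<in> V - {v} \<Longrightarrow> canon G' u \<le> dot G' N u"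
    and N2: "\<And>l. l \<in> cyc G' \<Longrightarrow> 0 \<le> l \<Longrightarrow> l \<noteq> 0 \<Longrightarrow> \<exists>u\<in>V - {v}. dot G' (N + l) u < canon G' u"
    using N by (auto simp: canon_max_def)
  have d: "dot G (pull N - ei v) u = dot G' N u - r u" if "u \<in> V - {v}" for u
    using that sym[of u v] vV by (simp add: dot_diff dot_pull dot_ei)
  have dv: "dot G (pull N - ei v) v = 1" using vV by (simp add: dot_diff dot_pull_v dot_ei vv)
  show ?thesis
    unfolding canon_max_def
  proof (intro conjI ballI impI)
    show "pull N - ei v \<in> cyc G" using Nc vV by (intro cyc_diff pull_cyc cyc_ei)
    fix u assume u: "u \<in> V"
    show "canon G u \<le> dot G (pull N - ei v) u"
    proof (cases "u = v")
      case False
      then show ?thesis using N1[of u] u by (simp add: d canon_blow_down)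
    qed (simp add: dv canon_v)
  next
    fix l assume l: "l \<in> cyc G" "0 \<le> l" "l \<noteq> 0"
    obtain b k where b: "b \<in> cyc G'" "l = pull b + exc k" "\<And>u. u \<noteq> v \<Longrightarrow> b u = l u" and b0: "0 \<le> b"
      using decompose[OF l(1,2)] by blast
    show "\<exists>u\<in>V. dot G (pull N - ei v + l) u < canon G u"
    proof (cases "0 < k")
      case True
      then have "dot G (pull N - ei v + l) v < canon G v"
        by (simp add: dot_add dv b(2) dot_pull_v dot_exc canon_v)
      then show ?thesis using vV by blast
    next
      case False
      have "b \<noteq> 0"
      proof
        assume "b = 0"
        then have "l = exc k" using b(2) by simp
        moreover have "0 \<le> l v" using le_funD[OF l(2), of v] by simp
        ultimately have "k = 0" using False by (simp add: exc_def)
        then show False using \<open>l = exc k\<close> l(3) by simp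
      qed
      then obtain u where u: "u \<in> V - {v}" "dot G' (N + b) u < canon G' u" using N2 b(1) b0 by blast
      have "dot G (pull N - ei v + l) u = dot G' (N + b) u - r u + k * r u"
        using u(1) by (simp add: dot_add d b(2) dot_pull dot_exc)
      moreover have "k * r u \<le> 0" using False r_nonneg[OF u(1)] by (simp add: mult_nonpos_nonneg)
      ultimately have "dot G (pull N - ei v + l) u < canon G u" using u by (simp add: canon_blow_down)
      then show ?thesis using u(1) by blast
    qed
  qed
qed

text \<open>The delicate clause is minimality. Write y = pull y' + k E_v. Then k \<ge> 0: if E_v
  occurs in the total transform of b - a, the hypothesis at E_v reads -k \<le> 0, and otherwise
  \<open>y\<close> avoids E_v and k = 0. Hence \<open>y'\<close> inherits the hypotheses and equals
  b - a, unless it is 0.\<close>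

lemma elliptic_step_pull:
  assumes st: "elliptic_step G' T a b"
  shows "elliptic_step G (pull T) (pull a) (pull b)"
proof -
  have c: "a \<in> cyc G'" "b \<in> cyc G'" and ab: "a \<le> b" "b \<le> T" "a \<noteq> b" and chi: "chi2 G' (b - a) = 0"
    and orth: "\<And>u. u \<in> V - {v} \<Longrightarrow> a u \<noteq> T u \<Longrightarrow> dot G' a u = 0"
    and neg: "\<And>u. u \<in> V - {v} \<Longrightarrow> a u \<noteq> b u \<Longrightarrow> dot G' (b - a) u \<le> 0"
    and min: "\<And>y. y \<in> cyc G' \<Longrightarrow> 0 \<le> y \<Longrightarrow> y \<le> b - a \<Longrightarrow> y \<noteq> 0 \<Longrightarrow>
      (\<And>u. u \<in> V - {v} \<Longrightarrow> a u \<noteq> b u \<Longrightarrow> dot G' y u \<le> 0) \<Longrightarrow> y = b - a"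
    using st unfolding elliptic_step_def by auto
  have zc: "b - a \<in> cyc G'" using c by (intro cyc_diff)
  show ?thesis
    unfolding elliptic_step_def pullback_diff[symmetric]
  proof (intro conjI ballI impI)
    show "pull a \<in> cyc G" "pull b \<in> cyc G" "pull a \<le> pull b" "pull b \<le> pull T"
      using c ab by (auto intro: pull_cyc pull_mono)
    show "pull a \<noteq> pull b"
    proof
      assume "pull a = pull b"
      then have "a u = b u" if "u \<noteq> v" for u using that pullback_other by metis
      then show False using ab(3) c by (simp add: cyc_le_iff)
    qed
    show "chi2 G (pull (b - a)) = 0" using chi2_pull[of "b - a" 0] chi by simp
  next
    fix u assume "u \<in> V" "pull a u \<noteq> pull T u"
    then show "dot G (pull a) u = 0" using orth[of u] by (cases "u = v") (simp_all add: dot_pull_v dot_pull)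
  next
    fix u assume "u \<in> V" "pull a u \<noteq> pull b u"
    then show "dot G (pull (b - a)) u \<le> 0" using neg[of u] by (cases "u = v") (simp_all add: dot_pull_v dot_pull)
  next
    fix y assume y: "y \<in> cyc G" "0 \<le> y" "y \<le> pull (b - a)" "y \<noteq> 0"
      and yneg: "\<forall>u\<in>V. pull a u \<noteq> pull b u \<longrightarrow> dot G y u \<le> 0"
    obtain y' k where y': "y' \<in> cyc G'" "y = pull y' + exc k" "\<And>u. u \<noteq> v \<Longrightarrow> y' u = y u" and y'0: "0 \<le> y'"
      using decompose[OF y(1,2)] by blast
    have "y' u \<le> (b - a) u" if "u \<noteq> v" for u using le_funD[OF y(3), of u] y'(3) that by simp
    then have y'le: "y' \<le> b - a" using cyc_le_iff(1)[OF y'(1) zc] by blast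
    have yv: "0 \<le> y v" "y v \<le> pull (b - a) v" "y v = pull y' v + k"
      using le_funD[OF y(2), of v] le_funD[OF y(3), of v] by (simp_all add: y'(2) exc_def)
    have vk: "pull (b - a) v = 0 \<Longrightarrow> k = 0"
      using yv le_funD[OF pull_nonneg[OF y'0], of v] le_funD[OF pull_mono[OF y'le], of v] by simp
    have vb: "pull (b - a) v \<noteq> 0 \<Longrightarrow> 0 \<le> k"
      using yneg vV unfolding pullback_diff y'(2) by (auto simp: dot_add dot_pull_v dot_exc)
    have k0: "0 \<le> k" using vk vb by (cases "pull (b - a) v = 0") auto
    have dy: "dot G' y' u + k * r u \<le> 0" if "u \<in> V - {v}" "a u \<noteq> b u" for u
    proof -
      have "dot G y u \<le> 0" using yneg that by simp
      then show ?thesis using that by (simp add: y'(2) dot_add dot_pull dot_exc)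
    qed
    show "y = pull (b - a)"
    proof (cases "y' = 0")
      case False
      have "y' = b - a"
      proof (rule min[OF y'(1) y'0 y'le False])
        fix u assume u: "u \<in> V - {v}" "a u \<noteq> b u"
        have "0 \<le> k * r u" using k0 r_nonneg[OF u(1)] by simp
        then show "dot G' y' u \<le> 0" using dy[OF u] by simp
      qed
      then have "k = 0" using yv(2,3) k0 by simp
      then show ?thesis using \<open>y' = b - a\<close> y'(2) by simp
    next
      case True
      then have ye: "y = exc k" using y'(2) by simp
      then have "k \<noteq> 0" using y(4) by auto
      \<comment> \<open>E_v occurs in the total transform, so some curve of \<open>b - a\<close>
        passes through the blown-up point; a positive multiple of E_v has a positive pairing with
        it.\<close>
      then have "pull (b - a) v \<noteq> 0" using vk by blast
      then have "(\<Sum>w\<in>V - {v}. (b - a) w * r w) \<noteq> 0" by (simp add: pullback_def)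
      then obtain u where u: "u \<in> V - {v}" "(b - a) u * r u \<noteq> 0"
        by (rule sum.not_neutral_contains_not_neutral)
      have "0 < r u" using r_nonneg[OF u(1)] u(2) by (auto simp: order.strict_iff_order)
      then have "0 < k * r u" using k0 \<open>k \<noteq> 0\<close> by simp
      moreover have "a u \<noteq> b u" using u(2) by auto
      ultimately have False using dy[OF u(1)] True by simp
      then show ?thesis ..
    qed
  qed
qed

lemma elliptic_chain_pull:
  assumes "elliptic_chain G' N x m"
  shows "elliptic_chain G (pull N - ei v) (\<lambda>j. pull (x j)) m"
proof -
  have "pull N \<le> pull (x (Suc m))" using assms by (intro pull_mono) (simp add: elliptic_chain_def)
  then have "pull N - ei v \<le> pull (x (Suc m))" by (rule diff_ei_le)
  then show ?thesis
    using assms canon_max_pull elliptic_step_pull by (simp add: elliptic_chain_def)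
qed

end

section \<open>The elliptic sequence in the minimal resolution\<close>

definition restriction :: "'v res \<Rightarrow> 'v set \<Rightarrow> 'v res" where
  "restriction G B = G\<lparr>verts := B\<rparr>"

lemma verts_restriction [simp]: "verts (restriction G B) = B"
  and inter_restriction [simp]: "inter (restriction G B) = inter G"
  by (simp_all add: restriction_def)

context plumbing
begin

lemma plumbing_restriction:
  assumes "B \<subseteq> V"
  shows "plumbing (restriction G B)"
proof
  show "finite (verts (restriction G B))" using assms fin finite_subset by auto
  show "inter (restriction G B) u w = inter (restriction G B) w u"
    if "u \<in> verts (restriction G B)" "w \<in> verts (restriction G B)" for u w
    using that assms sym[of u w] by auto
  show "0 \<le> inter (restriction G B) u w"
    if "u \<in> verts (restriction G B)" "w \<in> verts (restriction G B)" "u \<noteq> w" for u w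
    using that assms inter_nonneg[of u w] by auto
  show "negative_definite (restriction G B)"
    unfolding negative_definite_def
  proof (intro ballI impI)
    fix l assume l: "l \<in> rat_cycles (restriction G B)" "l \<noteq> (\<lambda>_. 0)"
    then have "l \<in> rat_cycles G" using assms by (auto simp: rat_cycles_def)
    then have "ip G l l < 0" using l(2) negdef by (simp add: negative_definite_def)
    moreover have "ip (restriction G B) l l = ip G l l"
    proof -
      have z: "l u = 0" if "u \<notin> B" for u using l(1) that by (auto simp: rat_cycles_def supp_def)
      have fB: "finite B" using assms fin finite_subset by blast
      have "(\<Sum>w\<in>B. l u * l w * of_int (inter G u w)) = (\<Sum>w\<in>V. l u * l w * of_int (inter G u w))" for u
        using assms z fin by (intro sum.mono_neutral_left) auto
      moreover have "(\<Sum>u\<in>B. \<Sum>w\<in>V. l u * l w * of_int (inter G u w)) =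
          (\<Sum>u\<in>V. \<Sum>w\<in>V. l u * l w * of_int (inter G u w))"
        using assms z fin by (intro sum.mono_neutral_left) auto
      ultimately show ?thesis by (simp add: ip_def)
    qed
    ultimately show "ip (restriction G B) l l < 0" by simp
  qed
qed

lemma dot_restriction:
  assumes "B \<subseteq> V" "a \<in> cyc (restriction G B)"
  shows "dot (restriction G B) a u = dot G a u"
  unfolding dot_def using assms fin by (intro sum.mono_neutral_cong_left) (auto simp: cyc_def)

lemma cyc_restriction: "B \<subseteq> V \<Longrightarrow> a \<in> cyc (restriction G B) \<Longrightarrow> a \<in> cyc G"
  by (auto simp: cyc_def)

text \<open>It makes the sequence start. If \<open>N\<close> were 0, the minimal zero cycle C would
  contain a curve with (C, E_u) < (Z_K, E_u). Removing this curve does not increase \<chi>, so by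
  minimality nothing is left: C would be a rational curve, for which \<chi> = 1.\<close>

lemma canon_max_nonzero:
  assumes con: "cut_connected G" and base: "elliptic_base G" and N: "canon_max G N"
  shows "N \<noteq> 0"
proof
  assume N0: "N = 0"
  obtain C where C: "C \<in> zero_cycles G" and min: "\<And>l. l \<in> zero_cycles G \<Longrightarrow> C \<le> l"
    by (rule minimal_zero_cycle[OF con base]) blast
  have C': "C \<in> cyc G" "0 \<le> C" "C \<noteq> 0" "chi2 G C = 0" using C by (auto simp: zero_cycles_def)
  obtain u where u: "u \<in> V" "dot G C u < canon G u"
    using N C' unfolding N0 canon_max_def by auto
  have can: "canon G u \<le> 0" using N u(1) unfolding N0 canon_max_def by simp
  have "C u \<noteq> 0"
  proof
    assume "C u = 0"
    then have "dot G 0 u \<le> dot G C u" using C'(2) u(1) by (intro dot_mono) auto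
    then show False using u(2) can by simp
  qed
  then have Cu: "0 u < C u" using le_funD[OF C'(2), of u] by simp
  define l where "l = C - ei u"
  have l: "l \<in> cyc G" "0 \<le> l"
    unfolding l_def using C'(1) u(1) le_diff_ei[of 0 C, OF C'(2) Cu] by (auto intro: cyc_diff cyc_ei)
  have "chi2 G C = chi2 G l + 2 * (1 - int (pa G u) - dot G l u)"
    using chi2_step[OF u(1), of l] by (simp add: l_def)
  moreover have "dot G l u = dot G C u - inter G u u" by (simp add: l_def dot_diff dot_ei u(1))
  moreover have "0 \<le> chi2 G l" using base l by (simp add: elliptic_base_def)
  ultimately have "chi2 G l = 0" and pa: "pa G u = 0" using u(2) C'(4) by (simp_all add: canon_def)
  have "l = 0"
  proof (rule ccontr)
    assume "l \<noteq> 0"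
    then have "C \<le> l" using l \<open>chi2 G l = 0\<close> by (intro min) (simp add: zero_cycles_def)
    then have "C u \<le> l u" by (rule le_funD)
    then show False by (simp add: l_def ei_def)
  qed
  then have "C = ei u" by (simp add: l_def)
  then show False using C'(4) chi2_ei[OF u(1)] pa by simp
qed

text \<open>The cycles in question are the remainders of \<open>N\<close> in the elliptic sequence. Equality in the
  hypothesis means that such a cycle is the canonical cycle of its support.\<close>

lemma canonical_on_support:
  assumes base: "elliptic_base G" and M: "M \<in> cyc G" "0 \<le> M"
    and can: "\<And>u. u \<in> V \<Longrightarrow> M u \<noteq> 0 \<Longrightarrow> canon G u \<le> dot G M u"
  shows "chi2 G M = 0" "\<And>u. u \<in> V \<Longrightarrow> M u \<noteq> 0 \<Longrightarrow> dot G M u = canon G u"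
proof -
  have t: "0 \<le> M u * (dot G M u - canon G u)" if "u \<in> V" for u
    using can[OF that] le_funD[OF M(2), of u] by (cases "M u = 0") auto
  \<comment> \<open>A sum of nonnegative terms equals -2 \<chi>(M), which is at most 0; hence every
    term vanishes.\<close>
  have s: "(\<Sum>u\<in>V. M u * (dot G M u - canon G u)) = - chi2 G M"
    by (simp add: chi2_def right_diff_distrib sum_subtractf)
  have "0 \<le> (\<Sum>u\<in>V. M u * (dot G M u - canon G u))" using t by (rule sum_nonneg)
  moreover have "0 \<le> chi2 G M" using base M by (simp add: elliptic_base_def)
  ultimately show "chi2 G M = 0" using s by simp
  then have "(\<Sum>u\<in>V. M u * (dot G M u - canon G u)) = 0" using s by simp
  then have "\<forall>u\<in>V. M u * (dot G M u - canon G u) = 0" using t fin by (subst (asm) sum_nonneg_eq_0_iff) auto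
  then show "dot G M u = canon G u" if "u \<in> V" "M u \<noteq> 0" for u using that by force
qed

text \<open>Splitting \<open>M\<close> along a cut without edges would give two zero cycles with no
  common curve, against \<open>zero_cycles_meet\<close>.\<close>

lemma connected_support:
  assumes con: "cut_connected G" and base: "elliptic_base G" and M: "M \<in> cyc G" "0 \<le> M" "chi2 G M = 0"
  shows "cut_connected (restriction G {u. M u \<noteq> 0})"
  unfolding cut_connected_def verts_restriction inter_restriction
proof (intro allI impI)
  let ?B = "{u. M u \<noteq> 0}"
  have B: "?B \<subseteq> V" using M(1) by (auto simp: cyc_def)
  have nn: "\<And>l. l \<in> cyc G \<Longrightarrow> 0 \<le> l \<Longrightarrow> 0 \<le> chi2 G l" using base by (simp add: elliptic_base_def)
  fix A assume A: "A \<subseteq> ?B" "A \<noteq> {}" "A \<noteq> ?B"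
  show "\<exists>u\<in>A. \<exists>w\<in>?B - A. 0 < inter G u w"
  proof (rule ccontr)
    assume neg: "\<not> ?thesis"
    define M1 where "M1 u = (if u \<in> A then M u else 0)" for u
    define M2 where "M2 u = (if u \<in> A then 0 else M u)" for u
    have M12: "M = M1 + M2" by (auto simp: M1_def M2_def)
    have c: "M1 \<in> cyc G" "M2 \<in> cyc G" using M(1) by (auto simp: cyc_def M1_def M2_def)
    have p: "0 \<le> M1" "0 \<le> M2" using le_funD[OF M(2)] by (auto simp: M1_def M2_def le_fun_def)
    obtain u where "u \<in> A" using A(2) by blast
    then have "M1 u \<noteq> 0" using A(1) by (auto simp: M1_def)
    then have n1: "M1 \<noteq> 0" by auto
    obtain w where "w \<in> ?B - A" using A(1,3) by blast
    then have "M2 w \<noteq> 0" by (auto simp: M2_def)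
    then have n2: "M2 \<noteq> 0" by auto
    have "M2 w * dot G M1 w = 0" if w: "w \<in> V" for w
    proof (cases "M2 w = 0")
      case False
      then have w': "w \<in> ?B - A" by (auto simp: M2_def split: if_splits)
      have "M1 x * inter G x w = 0" if x: "x \<in> V" for x
      proof (cases "x \<in> A")
        case True
        then have "inter G x w \<le> 0" using neg w' by (auto simp: not_less)
        moreover have "0 \<le> inter G x w" using inter_nonneg[OF x w] True w' by auto
        ultimately show ?thesis by simp
      qed (simp add: M1_def)
      then have "dot G M1 w = 0" unfolding dot_def by (intro sum.neutral) simp
      then show ?thesis by simp
    qed simp
    then have "(\<Sum>w\<in>V. M2 w * dot G M1 w) = 0" by (intro sum.neutral) simp
    then have "chi2 G M1 + chi2 G M2 = 0" using M(3) unfolding M12 chi2_add by simp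
    then have "chi2 G M1 = 0" "chi2 G M2 = 0" using nn[OF c(1) p(1)] nn[OF c(2) p(2)] by linarith+
    then have "M1 \<in> zero_cycles G" "M2 \<in> zero_cycles G" using c p n1 n2 by (simp_all add: zero_cycles_def)
    then have "inf M1 M2 \<noteq> 0" using zero_cycles_meet[OF con nn] by blast
    moreover have "inf M1 M2 u = 0" for u
      using le_funD[OF M(2), of u] by (cases "u \<in> A") (simp_all add: M1_def M2_def inf_int_def)
    ultimately show False by (auto simp: fun_eq_iff)
  qed
qed

text \<open>On its support \<open>M\<close> pairs like Z_K, hence is antinef there and lies above
  the fundamental cycle \<open>Z\<close> of the support. Since (Z, M - Z) \<le> 0, we get 0 =
  \<chi>(M) \<ge> \<chi>(Z) + \<chi>(M - Z), and both terms vanish.\<close>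

lemma elliptic_remainder_step:
  assumes con: "cut_connected G" and base: "elliptic_base G"
    and neg: "\<And>u. u \<in> V \<Longrightarrow> canon G u \<le> 0"
    and M: "M \<in> cyc G" "0 \<le> M" "M \<noteq> 0"
    and can: "\<And>u. u \<in> V \<Longrightarrow> M u \<noteq> 0 \<Longrightarrow> canon G u \<le> dot G M u"
  obtains Z where "Z_fund G {u. M u \<noteq> 0} = rat_cycle Z" "Z \<in> cyc G" "0 \<le> Z" "Z \<le> M" "Z \<noteq> 0"
    "chi2 G Z = 0" "\<And>u. M u \<noteq> 0 \<Longrightarrow> Z u \<noteq> 0 \<and> dot G Z u \<le> 0"
    "\<And>y. y \<in> cyc G \<Longrightarrow> 0 \<le> y \<Longrightarrow> y \<le> Z \<Longrightarrow> y \<noteq> 0 \<Longrightarrow> (\<And>u. Z u \<noteq> 0 \<Longrightarrow> dot G y u \<le> 0) \<Longrightarrow> y = Z"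
proof -
  let ?B = "{u. M u \<noteq> 0}"
  have B: "?B \<subseteq> V" using M(1) by (auto simp: cyc_def)
  note chiM = canonical_on_support(1)[OF base M(1,2) can] and canM = canonical_on_support(2)[OF base M(1,2) can]
  interpret S: plumbing "restriction G ?B" by (rule plumbing_restriction[OF B])
  have conS: "cut_connected (restriction G ?B)" by (rule connected_support[OF con base M(1,2) chiM])
  have ne: "verts (restriction G ?B) \<noteq> {}" using M(3) by (auto simp: fun_eq_iff)
  obtain Z where Z: "Z \<in> antinef_cycles (restriction G ?B)"
    and least: "\<And>b. b \<in> antinef_cycles (restriction G ?B) \<Longrightarrow> Z \<le> b"
    and zm: "Z_min (restriction G ?B) = rat_cycle Z"
    and full: "\<And>v. v \<in> verts (restriction G ?B) \<Longrightarrow> 1 \<le> Z v"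
    using S.fundamental_cycle[OF conS ne] by blast
  have anti: "y \<in> antinef_cycles (restriction G ?B)"
    if "\<And>u. u \<notin> ?B \<Longrightarrow> y u = 0" "y \<noteq> 0" "\<And>u. u \<in> ?B \<Longrightarrow> dot G y u \<le> 0" for y
    using that dot_restriction[OF B, of y] by (simp add: antinef_cycles_def cyc_def)
  have ZS: "Z \<in> cyc (restriction G ?B)" and Z0: "Z \<noteq> 0" using Z by (auto simp: antinef_cycles_def)
  have dZ: "dot G Z u \<le> 0" if "u \<in> ?B" for u
    using Z that dot_restriction[OF B ZS] by (simp add: antinef_cycles_def)
  have Zout: "Z u = 0" if "u \<notin> ?B" for u using ZS that by (simp add: cyc_def)
  have Zc: "Z \<in> cyc G" using B ZS by (rule cyc_restriction)
  have Zn: "0 \<le> Z"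
  proof (rule le_funI)
    fix u show "0 u \<le> Z u" using full[of u] Zout[of u] by (cases "M u = 0") auto
  qed
  have ZM: "Z \<le> M"
    using M(3) canM neg B by (intro least anti) auto
  have MZ: "M - Z \<in> cyc G" "0 \<le> M - Z" using M(1) Zc ZM by (auto simp: le_fun_def intro: cyc_diff)
  have "(M - Z) u * dot G Z u \<le> 0" if "u \<in> V" for u
    using dZ[of u] Zout[of u] le_funD[OF MZ(2), of u] by (cases "M u = 0") (auto simp: mult_nonneg_nonpos)
  then have "(\<Sum>u\<in>V. (M - Z) u * dot G Z u) \<le> 0" by (rule sum_nonpos)
  moreover have "chi2 G M = chi2 G Z + chi2 G (M - Z) - 2 * (\<Sum>u\<in>V. (M - Z) u * dot G Z u)"
    using chi2_add[of Z "M - Z"] by simp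
  moreover have "0 \<le> chi2 G Z" "0 \<le> chi2 G (M - Z)" using base Zc Zn MZ by (simp_all add: elliptic_base_def)
  ultimately have chiZ: "chi2 G Z = 0" using chiM by linarith
  show ?thesis
  proof (rule that[of Z])
    show "Z_fund G ?B = rat_cycle Z" using zm by (simp add: Z_fund_def restriction_def)
    show "Z u \<noteq> 0 \<and> dot G Z u \<le> 0" if "M u \<noteq> 0" for u using that full[of u] dZ[of u] by auto
    fix y assume y: "y \<in> cyc G" "0 \<le> y" "y \<le> Z" "y \<noteq> 0" "\<And>u. Z u \<noteq> 0 \<Longrightarrow> dot G y u \<le> 0"
    have "Z \<le> y"
    proof (intro least anti y(4))
      show "y u = 0" if "u \<notin> ?B" for u
        using Zout[OF that] le_funD[OF y(2), of u] le_funD[OF y(3), of u] by simp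
      show "dot G y u \<le> 0" if "u \<in> ?B" for u using full[of u] that by (intro y(5)) auto
    qed
    then show "y = Z" using y(3) by simp
  qed (use Zc Zn ZM Z0 chiZ in auto)
qed

text \<open>The invariant \<open>P\<close> says that each remainder of \<open>N\<close> pairs at
  least like Z_K on its own support. Subtracting the fundamental cycle of the support, which is
  antinef there, preserves this.\<close>

lemma elliptic_chain_minimal_resolution:
  assumes con: "cut_connected G" and base: "elliptic_base G" and min: "\<nexists>v. minus_one_curve G v"
    and stop: "ell_seq_stops_at G m"
  shows "\<exists>N x. elliptic_chain G N x m"
proof -
  obtain N where N: "canon_max G N" "0 \<le> N" "ell_N G = rat_cycle N"
    using canon_max_of_s_ZK[OF min] by blast
  have Nc: "N \<in> cyc G" and Ncan: "\<And>u. u \<in> V \<Longrightarrow> canon G u \<le> dot G N u"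
    using N(1) by (auto simp: canon_max_def)
  have N0: "N \<noteq> 0" by (rule canon_max_nonzero[OF con base N(1)])
  note neg = canon_nonpos[OF min]
  have canN: "dot G N u = canon G u" if "u \<in> V" "N u \<noteq> 0" for u
    by (rule canonical_on_support(2)[OF base Nc N(2) _ that]) (rule Ncan)
  \<comment> \<open>The floor only changes the type: \<open>P\<close> records that these cycles are
    integral.\<close>
  define Zs where "Zs j v = \<lfloor>Z_fund G (ell_B G j) v\<rfloor>" for j v
  define x where "x j = (\<lambda>v. \<Sum>i<j. Zs i v)" for j
  have xS: "x (Suc j) = x j + Zs j" for j by (auto simp: x_def fun_eq_iff)
  have x0: "x 0 = 0" by (auto simp: x_def fun_eq_iff)
  define P where "P j \<longleftrightarrow> (\<forall>i<j. Z_fund G (ell_B G i) = rat_cycle (Zs i)) \<and> x j \<in> cyc G \<and> 0 \<le> x j \<and> x j \<le> N \<and>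
    (\<forall>u\<in>V. (N - x j) u \<noteq> 0 \<longrightarrow> canon G u \<le> dot G (N - x j) u)" for j
  have seq: "rat_cycle (x j) = (\<lambda>v. \<Sum>i<j. Z_fund G (ell_B G i) v)"
    if "\<And>i. i < j \<Longrightarrow> Z_fund G (ell_B G i) = rat_cycle (Zs i)" for j
    using that by (simp add: x_def)
  have step: "P (Suc j) \<and> elliptic_step G N (x j) (x (Suc j))" if Pj: "P j" and jm: "j \<le> m" for j
  proof -
    have xj: "x j \<in> cyc G" "0 \<le> x j" "x j \<le> N"
      and Zi: "\<And>i. i < j \<Longrightarrow> Z_fund G (ell_B G i) = rat_cycle (Zs i)"
      using Pj unfolding P_def by blast+
    define M where "M = N - x j"
    have M: "M \<in> cyc G" "0 \<le> M"
      using xj Nc by (simp_all add: M_def le_fun_def cyc_diff)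
    have pw: "(\<Sum>i<j. Z_fund G (ell_B G i) v) = of_int (x j v)" for v
      using fun_cong[OF seq[OF Zi], where x = v] by simp
    have Mne: "M \<noteq> 0"
    proof (cases j)
      case 0
      then show ?thesis using N0 by (simp add: M_def x0)
    next
      case (Suc i)
      have "ell_N G \<noteq> (\<lambda>v. \<Sum>k\<le>i. Z_fund G (ell_B G k) v)"
        using stop jm Suc unfolding ell_seq_stops_at_def by (metis Suc_le_eq)
      also have "(\<lambda>v. \<Sum>k\<le>i. Z_fund G (ell_B G k) v) = rat_cycle (x j)"
        using seq[OF Zi] by (simp add: Suc lessThan_Suc_atMost)
      finally have "rat_cycle N \<noteq> rat_cycle (x j)" unfolding N(3) .
      then show ?thesis by (auto simp: M_def)
    qed
    have Mcan: "canon G u \<le> dot G M u" if "u \<in> V" "M u \<noteq> 0" for u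
      using Pj that unfolding P_def M_def by blast
    have B: "ell_B G j = {u. M u \<noteq> 0}"
    proof -
      have "ell_B G j = supp (\<lambda>v. of_int (N v) - rat_cycle (x j) v)"
        unfolding ell_B.simps[of G j] N(3) pw ..
      then show ?thesis by (auto simp: supp_def M_def)
    qed
    obtain Z where Z: "Z_fund G {u. M u \<noteq> 0} = rat_cycle Z" "Z \<in> cyc G" "0 \<le> Z" "Z \<le> M" "Z \<noteq> 0"
      "chi2 G Z = 0" "\<And>u. M u \<noteq> 0 \<Longrightarrow> Z u \<noteq> 0 \<and> dot G Z u \<le> 0"
      "\<And>y. y \<in> cyc G \<Longrightarrow> 0 \<le> y \<Longrightarrow> y \<le> Z \<Longrightarrow> y \<noteq> 0 \<Longrightarrow> (\<And>u. Z u \<noteq> 0 \<Longrightarrow> dot G y u \<le> 0) \<Longrightarrow> y = Z"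
      using elliptic_remainder_step[OF con base neg M Mne Mcan] by blast
    have ZsZ: "Zs j = Z" by (auto simp: Zs_def B Z(1))
    have Zj: "Z_fund G (ell_B G j) = rat_cycle (Zs j)" unfolding B Z(1) ZsZ ..
    have M': "N - x (Suc j) = M - Z" by (simp add: M_def xS ZsZ)
    have Zsupp: "M u \<noteq> 0" if "Z u \<noteq> 0" for u
      using that le_funD[OF Z(3), of u] le_funD[OF Z(4), of u] by auto
    have xSc: "x (Suc j) \<in> cyc G" unfolding xS ZsZ using xj(1) Z(2) by (rule cyc_add)
    have xSN: "x (Suc j) \<le> N" using Z(4) by (simp add: xS ZsZ M_def le_fun_def algebra_simps)
    have xS0: "0 \<le> x (Suc j)" using xj(2) Z(3) by (simp add: xS ZsZ le_fun_def)
    have "P (Suc j)"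
      unfolding P_def
    proof (intro conjI allI impI ballI)
      show "Z_fund G (ell_B G i) = rat_cycle (Zs i)" if "i < Suc j" for i
        using that Zi Zj by (cases "i = j") auto
      fix u assume u: "u \<in> V" "(N - x (Suc j)) u \<noteq> 0"
      have "M u - Z u \<noteq> 0" using u(2) unfolding M' by simp
      then have Mu: "M u \<noteq> 0" using Zsupp[of u] by auto
      show "canon G u \<le> dot G (N - x (Suc j)) u"
        unfolding M' dot_diff using Mcan[OF u(1) Mu] Z(7)[OF Mu] by simp
    qed (rule xSc xSN xS0)+
    moreover have "elliptic_step G N (x j) (x (Suc j))"
      unfolding elliptic_step_def
    proof (intro conjI ballI impI)
      have d: "x (Suc j) - x j = Z" by (simp add: xS ZsZ)
      show "x j \<in> cyc G" by (rule xj(1))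
      show "x (Suc j) \<in> cyc G" "x (Suc j) \<le> N" by (rule xSc xSN)+
      show "x j \<le> x (Suc j)" using Z(3) by (simp add: xS ZsZ le_fun_def)
      show "x j \<noteq> x (Suc j)" using Z(5) by (simp add: xS ZsZ)
      show "chi2 G (x (Suc j) - x j) = 0" by (simp add: d Z(6))
      \<comment> \<open>Both \<open>N\<close> and the remainder \<open>M\<close> pair with E_u like
        Z_K, so their difference \<open>x j\<close> is orthogonal to E_u.\<close>
      show "dot G (x j) u = 0" if u: "u \<in> V" "x j u \<noteq> N u" for u
      proof -
        have Mu: "M u \<noteq> 0" using u(2) by (simp add: M_def)
        then have "N u \<noteq> 0"
          using le_funD[OF xj(2), of u] le_funD[OF M(2), of u] by (simp add: M_def)
        then have "dot G N u = canon G u" by (rule canN[OF u(1)])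
        moreover have "dot G M u = canon G u" by (rule canonical_on_support(2)[OF base M Mcan u(1) Mu])
        ultimately show ?thesis by (simp add: M_def dot_diff)
      qed
      show "dot G (x (Suc j) - x j) u \<le> 0" if u: "u \<in> V" "x j u \<noteq> x (Suc j) u" for u
      proof -
        have "Z u \<noteq> 0" using u(2) by (simp add: xS ZsZ)
        then show ?thesis unfolding d using Zsupp Z(7) by blast
      qed
      fix y assume y: "y \<in> cyc G" "0 \<le> y" "y \<le> x (Suc j) - x j" "y \<noteq> 0"
        "\<forall>u\<in>V. x j u \<noteq> x (Suc j) u \<longrightarrow> dot G y u \<le> 0"
      show "y = x (Suc j) - x j"
        unfolding d
      proof (rule Z(8)[OF y(1,2) _ y(4)])
        show "y \<le> Z" using y(3) unfolding d .
        fix u assume u: "Z u \<noteq> 0"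
        then have "u \<in> V" using Z(2) by (auto simp: cyc_def)
        moreover have "x j u \<noteq> x (Suc j) u" using u by (simp add: xS ZsZ)
        ultimately show "dot G y u \<le> 0" using y(5) by blast
      qed
    qed
    ultimately show ?thesis by blast
  qed
  have P0: "P 0" using N(2) Ncan by (simp add: P_def x0 cyc_zero)
  have P: "P j" if "j \<le> Suc m" for j
    using that
  proof (induction j)
    case (Suc j)
    have "P j" using Suc by simp
    then show ?case using step[of j] Suc.prems by simp
  qed (rule P0)
  have Zm: "\<And>i. i < Suc m \<Longrightarrow> Z_fund G (ell_B G i) = rat_cycle (Zs i)"
    using P[of "Suc m"] unfolding P_def by blast
  have "ell_N G = rat_cycle (x (Suc m))"
    using stop seq[OF Zm] by (simp add: ell_seq_stops_at_def lessThan_Suc_atMost)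
  then have "rat_cycle N = rat_cycle (x (Suc m))" using N(3) by simp
  then have T: "x (Suc m) = N" by (simp add: fun_eq_iff)
  have "elliptic_step G N (x j) (x (Suc j))" if "j \<le> m" for j
    using step[OF P[of j] that] that by simp
  then have "elliptic_chain G N x m"
    unfolding elliptic_chain_def T using N(1) x0 by simp
  then show ?thesis by blast
qed

end

text \<open>Connectedness and ellipticity are carried down to the minimal resolution, and the chain
  found there is carried back up.\<close>

lemma elliptic_chain_resolution:
  assumes "minimal_resolution G H" "plumbing G" "cut_connected G" "elliptic_base G" "ell_seq_stops_at H m"
  shows "\<exists>N x. elliptic_chain G N x m"
  using assms
proof (induction rule: minimal_resolution.induct)
  case (minimal G)
  then show ?case using plumbing.elliptic_chain_minimal_resolution by blast
next
  case (contract G v H)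
  interpret minus_one G v using contract.hyps(1) contract.prems(1) by (intro minus_one.intro minus_one_axioms.intro)
  obtain N x where "elliptic_chain (blow_down G v) N x m"
    using contract.IH plumbing_blow_down cut_connected_blow_down elliptic_base_blow_down contract.prems by blast
  then show ?case using elliptic_chain_pull by blast
qed

text \<open>Few edges force a vertex of degree one, and one removes it. Just an upper bound is
  assumed, because \<open>link_b1\<close> mixes edges with genera; the exact value in the conclusion
  then forces the genera to vanish.\<close>

lemma tree_of_degree_sum:
  assumes "finite V" "V \<noteq> {}"
    and "\<And>u w. u \<in> V \<Longrightarrow> w \<in> V \<Longrightarrow> q u w = q w u" "\<And>u w. u \<in> V \<Longrightarrow> w \<in> V \<Longrightarrow> u \<noteq> w \<Longrightarrow> 0 \<le> q u w"
    and "\<And>A. A \<subseteq> V \<Longrightarrow> A \<noteq> {} \<Longrightarrow> A \<noteq> V \<Longrightarrow> \<exists>u\<in>A. \<exists>w\<in>V - A. 0 < q u w"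
    and "(\<Sum>v\<in>V. degree_in q V v) < 2 * int (card V)"
  shows "tree q V \<and> (\<Sum>v\<in>V. degree_in q V v) = 2 * int (card V) - 2"
  using assms
proof (induction "card V" arbitrary: V rule: less_induct)
  case less
  note fin = less.prems(1) and ne = less.prems(2) and sym = less.prems(3) and nonneg = less.prems(4)
    and cut = less.prems(5) and deg = less.prems(6)
  show ?case
  proof (cases "card V = 1")
    case True
    then obtain v where "V = {v}" using card_1_singletonE by blast
    then show ?thesis by (simp add: tree.single degree_in_def)
  next
    case False
    have pos: "1 \<le> degree_in q V v" if v: "v \<in> V" for v
    proof -
      have "{v} \<noteq> V" using False by auto
      then obtain w where w: "w \<in> V - {v}" "0 < q v w" using cut[of "{v}"] v by blast
      have "q v w \<le> degree_in q V v"
        unfolding degree_in_def using w nonneg v fin by (intro member_le_sum) auto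
      then show ?thesis using w by simp
    qed
    have "\<exists>u\<in>V. degree_in q V u < 2"
    proof (rule ccontr)
      assume "\<not> ?thesis"
      then have "(\<Sum>v\<in>V. 2) \<le> (\<Sum>v\<in>V. degree_in q V v)" by (intro sum_mono) (auto simp: not_less)
      then show False using deg by simp
    qed
    then obtain u where u: "u \<in> V" "degree_in q V u = 1" using pos by force
    have "{u} \<noteq> V" using False by auto
    then obtain w where w: "w \<in> V - {u}" "0 < q u w" using cut[of "{u}"] u by blast
    define W where "W = V - {u}"
    have V: "V = insert u W" "u \<notin> W" "finite W" "w \<in> W" using u w fin by (auto simp: W_def)
    have dsum: "degree_in q V u = q u w + (\<Sum>x\<in>W - {w}. q u x)"
      unfolding degree_in_def W_def[symmetric] by (rule sum.remove[OF V(3,4)])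
    have nn: "0 \<le> q u x" if "x \<in> W" for x using nonneg[of u x] that u V by auto
    then have "0 \<le> (\<Sum>x\<in>W - {w}. q u x)" by (intro sum_nonneg) auto
    then have quw: "q u w = 1" and rest: "(\<Sum>x\<in>W - {w}. q u x) = 0" using dsum u(2) w(2) by linarith+
    have other: "q u x = 0" if "x \<in> W" "x \<noteq> w" for x
    proof -
      have "\<forall>x\<in>W - {w}. q u x = 0" using rest V(3) nn by (subst (asm) sum_nonneg_eq_0_iff) auto
      then show ?thesis using that by blast
    qed
    have qs: "q x u = q u x" if "x \<in> W" for x using sym[of x u] that V u by auto
    have "(\<Sum>x\<in>W. degree_in q V x) = (\<Sum>x\<in>W. degree_in q W x + (if x = w then 1 else 0))"
    proof (rule sum.cong[OF refl])
      fix x assume x: "x \<in> W"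
      then show "degree_in q V x = degree_in q W x + (if x = w then 1 else 0)"
        unfolding V(1) degree_in_insert[OF V(3,2) x] using qs[OF x] quw other[OF x] by auto
    qed
    also have "\<dots> = (\<Sum>x\<in>W. degree_in q W x) + 1" using V(3,4) by (simp add: sum.distrib)
    finally have dW: "(\<Sum>x\<in>V. degree_in q V x) = (\<Sum>x\<in>W. degree_in q W x) + 2"
      using u(2) V(2,3) by (subst (1) V(1)) simp
    have cV: "card V = Suc (card W)" using V by simp
    have "tree q W \<and> (\<Sum>v\<in>W. degree_in q W v) = 2 * int (card W) - 2"
    proof (rule less.hyps)
      show "card W < card V" using cV by simp
      show "W \<noteq> {}" using V by auto
      show "q a b = q b a" if "a \<in> W" "b \<in> W" for a b using that sym V by auto
      show "0 \<le> q a b" if "a \<in> W" "b \<in> W" "a \<noteq> b" for a b using that nonneg V by auto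
      show "(\<Sum>v\<in>W. degree_in q W v) < 2 * int (card W)" using deg dW cV by simp
      fix A assume A: "A \<subseteq> W" "A \<noteq> {}" "A \<noteq> W"
      \<comment> \<open>Put the leaf on the side of its neighbour: the edge across the enlarged cut
        then avoids the leaf.\<close>
      show "\<exists>a\<in>A. \<exists>b\<in>W - A. 0 < q a b"
      proof (cases "w \<in> A")
        case True
        have "insert u A \<subseteq> V" "insert u A \<noteq> {}" "insert u A \<noteq> V" using A V by auto
        then obtain a b where ab: "a \<in> insert u A" "b \<in> V - insert u A" "0 < q a b" using cut by meson
        have b: "b \<in> W" "b \<noteq> w" using ab V True by auto
        have "a \<noteq> u" using other[OF b] ab(3) by auto
        then show ?thesis using ab b by auto
      next
        case False
        have "A \<subseteq> V" "A \<noteq> V" using A V by auto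
        then obtain a b where ab: "a \<in> A" "b \<in> V - A" "0 < q a b" using cut A(2) by meson
        have a: "a \<in> W" "a \<noteq> w" using ab A False by auto
        have "b \<noteq> u" using other[OF a] qs[OF a(1)] ab(3) by auto
        then show ?thesis using ab V by auto
      qed
    qed (use V in auto)
    moreover from this have "tree q (insert u W)"
      using V quw qs other by (intro tree.leaf[where w = w]) auto
    ultimately show ?thesis using dW cV V(1) by simp
  qed
qed

lemma tree_of_rational_homology_sphere:
  assumes "plumbing G" "verts G \<noteq> {}" "cut_connected G" "rational_homology_sphere_link G"
  shows "tree (inter G) (verts G)" "\<And>u. u \<in> verts G \<Longrightarrow> pa G u = 0"
proof -
  interpret plumbing G by (rule assms(1))
  let ?D = "\<Sum>v\<in>verts G. degree_in (inter G) (verts G) v"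
  define P where "P = (\<Sum>v\<in>verts G. int (pa G v))"
  have P0: "0 \<le> P" by (simp add: P_def sum_nonneg)
  have b1: "2 * P + (?D div 2 - int (card (verts G)) + 1) = 0"
    using assms(4) by (simp add: rational_homology_sphere_link_def link_b1_def P_def valency_def degree_in_def)
  have "?D div 2 \<le> int (card (verts G)) - 1" using b1 P0 by linarith
  then have "?D < 2 * int (card (verts G))" by linarith
  then have t: "tree (inter G) (verts G) \<and> ?D = 2 * int (card (verts G)) - 2"
    using assms(3) fin assms(2) sym inter_nonneg
    by (intro tree_of_degree_sum) (auto simp: cut_connected_def)
  then show "tree (inter G) (verts G)" by blast
  have "?D div 2 = int (card (verts G)) - 1" using t by simp
  then have "P = 0" using b1 by simp
  then show "pa G u = 0" if "u \<in> verts G" for u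
    using that fin unfolding P_def by (subst (asm) sum_nonneg_eq_0_iff) auto
qed

theorem theorem5p1p1:
  fixes G H :: "'v res" and m :: nat
  assumes "good_resolution_graph G"
    and "rational_homology_sphere_link G"
    and "elliptic G"
    and "minimal_resolution G H"
    and "ell_seq_stops_at H m"
  shows "sw_bar0 G = of_nat (m + 1)"
proof -
  interpret plumbing G using assms(1) by (rule plumbing_of_good)
  have con: "cut_connected G" and ne: "verts G \<noteq> {}"
    using assms(1) cut_connected_of_connected_graph by (auto simp: good_resolution_graph_def)
  note tree = tree_of_rational_homology_sphere[OF plumbing_axioms ne con assms(2)]
  have base: "elliptic_base G" by (rule elliptic_base_of_elliptic[OF con ne assms(3)])
  obtain N x where chain: "elliptic_chain G N x m"
    using elliptic_chain_resolution[OF assms(4) plumbing_axioms con base assms(5)] by blast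
  show ?thesis
  proof (rule sw_bar0_eq)
    fix y assume y: "y \<in> cyc G" "\<And>v. v \<in> verts G \<Longrightarrow> dot G y v \<le> inter G v v"
    have "retractable G y" "0 \<le> y" using deep_retractable[OF tree(2) y] by auto
    then show "counting_function G (rat_cycle y) = chi G (rat_cycle y) + of_nat (m + 1)"
      unfolding counting_function_rat_cycle chi_rat_cycle
      using zprod_sum[OF con tree base chain y(1)] by blast
  qed
qed

end
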